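(* Let $H$ be a Gaussian Hilbert space and suppose that $X$ is a random variable such that (i) $X-\mathbb E X\in H^{:2:}$; (ii) $X\ge0$ a.s. and $\Pr(X<\varepsilon)>0$ for every $\varepsilon>0$; (iii) the bilinear form $\mathcal B(\xi,\eta):=\frac12\mathbb E\bigl((X-\mathbb E X)\xi\eta\bigr)$, $\xi,\eta\in H$, is positive, i.e. $\mathcal B(\xi,\xi)\ge0$ for all $\xi\in H$. Let $(\lambda_j)_{j=1}^N$, $0\le N\le\infty$, be the non-zero eigenvalues (with multiplicity) of the compact symmetric operator on $H$ associated with $\mathcal B$. Then every $\lambda_j>0$, \[ X\overset{d}{=}\sum_{j=1}^N\lambda_j\xi_j^2 \] with $\xi_j$ i.i.d. $N(0,1)$, $\mathbb E X=\sum_{j=1}^N\lambda_j<\infty$, and for all real $t<(2\max_j\lambda_j)^{-1}$, \[ \mathbb E e^{tX}=\prod_j(1-2\lambda_jt)^{-1/2}. \]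
   Context: A Gaussian Hilbert space is a closed subspace $H$ of $L^2_{\mathbb R}(\Omega,\mathcal F,\Pr)$ every element of which is a centered Gaussian random variable. For $\xi,\eta\in H$ the Wick product is $:\!\xi\eta\!:\,=\xi\eta-\mathbb E(\xi\eta)$, and $H^{:2:}$ is the closed linear span in $L^2$ of all Wick products $:\!\xi\eta\!:$ with $\xi,\eta\in H$. For $Y\in H^{:2:}$ the form $(\xi,\eta)\mapsto\frac12\mathbb E(Y\xi\eta)$ on $H$ is a bounded symmetric bilinear form given by a compact symmetric operator on $H$. *)

theory Defs
  imports "HOL-Probability.Probability"
begin

text \<open>Random variables are real-valued measurable functions on a probability space M.
  Elements of L2 are represented by functions; equality in L2 is a.e. equality.\<close>

definition centered_gaussian :: "'a measure \<Rightarrow> ('a \<Rightarrow> real) \<Rightarrow> bool" where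
  "centered_gaussian M \<xi> \<longleftrightarrow> \<xi> \<in> borel_measurable M \<and>
     ((AE \<omega> in M. \<xi> \<omega> = 0) \<or>
      (\<exists>\<sigma>>0. distributed M lborel \<xi> (normal_density 0 \<sigma>)))"

definition L2_conv :: "'a measure \<Rightarrow> (nat \<Rightarrow> 'a \<Rightarrow> real) \<Rightarrow> ('a \<Rightarrow> real) \<Rightarrow> bool" where
  "L2_conv M f g \<longleftrightarrow> (\<lambda>n. integral\<^sup>L M (\<lambda>\<omega>. (f n \<omega> - g \<omega>)\<^sup>2)) \<longlonglongrightarrow> 0"

text \<open>A Gaussian Hilbert space: a closed linear subspace of L2(M) all of whose elements
  are centered Gaussian (closed also under a.e. modification, i.e. a set of L2 classes).\<close>
definition gaussian_hilbert_space :: "'a measure \<Rightarrow> ('a \<Rightarrow> real) set \<Rightarrow> bool" where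
  "gaussian_hilbert_space M H \<longleftrightarrow>
     (\<lambda>\<omega>. 0) \<in> H \<and>
     (\<forall>\<xi>\<in>H. \<forall>\<eta>\<in>H. (\<lambda>\<omega>. \<xi> \<omega> + \<eta> \<omega>) \<in> H) \<and>
     (\<forall>\<xi>\<in>H. \<forall>c::real. (\<lambda>\<omega>. c * \<xi> \<omega>) \<in> H) \<and>
     (\<forall>\<xi>\<in>H. \<forall>\<eta>\<in>borel_measurable M. (AE \<omega> in M. \<xi> \<omega> = \<eta> \<omega>) \<longrightarrow> \<eta> \<in> H) \<and>
     (\<forall>f g. (\<forall>n. f n \<in> H) \<and> g \<in> borel_measurable M \<and> integrable M (\<lambda>\<omega>. (g \<omega>)\<^sup>2)
            \<and> L2_conv M f g \<longrightarrow> g \<in> H) \<and>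
     (\<forall>\<xi>\<in>H. centered_gaussian M \<xi>)"

definition wick2 :: "'a measure \<Rightarrow> ('a \<Rightarrow> real) \<Rightarrow> ('a \<Rightarrow> real) \<Rightarrow> 'a \<Rightarrow> real" where
  "wick2 M \<xi> \<eta> = (\<lambda>\<omega>. \<xi> \<omega> * \<eta> \<omega> - integral\<^sup>L M (\<lambda>\<omega>. \<xi> \<omega> * \<eta> \<omega>))"

definition wick2_span :: "'a measure \<Rightarrow> ('a \<Rightarrow> real) set \<Rightarrow> ('a \<Rightarrow> real) set" where
  "wick2_span M H = {Y. \<exists>(n::nat) c \<xi> \<eta>. (\<forall>i<n. \<xi> i \<in> H \<and> \<eta> i \<in> H) \<and>
        Y = (\<lambda>\<omega>. \<Sum>i<n. c i * wick2 M (\<xi> i) (\<eta> i) \<omega>)}"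

definition wick_chaos2 :: "'a measure \<Rightarrow> ('a \<Rightarrow> real) set \<Rightarrow> ('a \<Rightarrow> real) set" where
  "wick_chaos2 M H = {Y. Y \<in> borel_measurable M \<and> integrable M (\<lambda>\<omega>. (Y \<omega>)\<^sup>2) \<and>
        (\<exists>f. (\<forall>n. f n \<in> wick2_span M H) \<and> L2_conv M f Y)}"

text \<open>An eigenvector of the (bounded symmetric) operator T on H associated with the
  bilinear form B, i.e. <T xi, eta> = B xi eta: T xi = lambda xi.\<close>
definition form_eigvec ::
  "'a measure \<Rightarrow> ('a \<Rightarrow> real) set \<Rightarrow> (('a \<Rightarrow> real) \<Rightarrow> ('a \<Rightarrow> real) \<Rightarrow> real) \<Rightarrow> real \<Rightarrow> ('a \<Rightarrow> real) \<Rightarrow> bool" where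
  "form_eigvec M H B c \<xi> \<longleftrightarrow> \<xi> \<in> H \<and>
      (\<forall>\<eta>\<in>H. B \<xi> \<eta> = c * integral\<^sup>L M (\<lambda>\<omega>. \<xi> \<omega> * \<eta> \<omega>))"

text \<open>lam j (j \<in> J) is the list of the non-zero eigenvalues of the operator associated
  with B, counted with multiplicity: there is an orthonormal family e of eigenvectors
  with e j having eigenvalue lam j \<noteq> 0, which spans every eigenspace of a non-zero
  eigenvalue (so #{j. lam j = c} = dim of the \<lambda>-eigenspace).\<close>
definition nonzero_eigenvalues_mult ::
  "'a measure \<Rightarrow> ('a \<Rightarrow> real) set \<Rightarrow> (('a \<Rightarrow> real) \<Rightarrow> ('a \<Rightarrow> real) \<Rightarrow> real) \<Rightarrow> nat set \<Rightarrow> (nat \<Rightarrow> real) \<Rightarrow> bool" where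
  "nonzero_eigenvalues_mult M H B J lam \<longleftrightarrow>
     (\<exists>e. (\<forall>j\<in>J. lam j \<noteq> 0 \<and> form_eigvec M H B (lam j) (e j)) \<and>
          (\<forall>i\<in>J. \<forall>j\<in>J. integral\<^sup>L M (\<lambda>\<omega>. e i \<omega> * e j \<omega>) = (if i = j then 1 else 0)) \<and>
          (\<forall>c \<xi>. c \<noteq> 0 \<and> form_eigvec M H B c \<xi> \<longrightarrow>
              finite {j\<in>J. lam j = c} \<and>
              (AE \<omega> in M. \<xi> \<omega> = (\<Sum>j\<in>{j\<in>J. lam j = c}.
                      integral\<^sup>L M (\<lambda>\<omega>'. \<xi> \<omega>' * e j \<omega>') * e j \<omega>))))"

end

theory Submission
  imports Defs
begin

text \<open>
  Write \<open>Y = X - E X\<close> and let \<open>e j\<close> be orthonormal eigenvectors for the eigenvalues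
  \<open>lam j\<close>. Wick's formula makes the variables \<open>(e j)\<^sup>2 - 1\<close> orthogonal, and the spectral theorem
  for the compact form of \<open>Y\<close> gives \<open>Y = (\<Sum>j. lam j * ((e j)\<^sup>2 - 1))\<close> in mean square. The
  \<open>e j\<close> are jointly Gaussian and uncorrelated, hence independent. Since \<open>X \<ge> 0\<close>, restricting to the
  event that the first \<open>n\<close> of the \<open>e j\<close> are small shows \<open>(\<Sum>j<n. lam j) \<le> E X\<close>, so
  \<open>X = c + (\<Sum>j. lam j * (e j)\<^sup>2)\<close> with a constant \<open>c \<ge> 0\<close>, and \<open>c = 0\<close> because \<open>X\<close> takes
  values arbitrarily close to \<open>0\<close>.
\<close>

section \<open>Square integrable functions\<close>

text \<open>The sum of the \<open>lam j\<close> is not known to converge in advance. Membership in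
  the second chaos only yields square summability, which is why the expansion uses centred squares;
  convergence of the trace comes later, from \<open>X \<ge> 0\<close>. Once it is known, positivity
  of the \<open>lam j\<close> makes the uncentred partial sums increasing. Mean square convergence
  by itself gives convergence almost everywhere only along a subsequence, and monotonicity extends
  this to all partial sums. The form is never diagonalized completely: the list of eigenvalues is
  given, and it is enough to produce a single eigenvector of the remainder, since this contradicts
  the completeness of the list. Elements of \<open>H\<close> are functions and not classes, so the
  Hilbert space arguments run with the seminorm on \<open>sqint\<close>, and completeness means the
  existence of a limit function.\<close>

definition sqint :: "'a measure \<Rightarrow> ('a \<Rightarrow> real) set" where
  "sqint M = {f \<in> borel_measurable M. integrable M (\<lambda>x. (f x)\<^sup>2)}"

lemma sqint_measurable: "f \<in> sqint M \<Longrightarrow> f \<in> borel_measurable M"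
  and sqint_square: "f \<in> sqint M \<Longrightarrow> integrable M (\<lambda>x. (f x)\<^sup>2)"
  by (auto simp: sqint_def)

lemma sqint_mult_integrable:
  assumes "f \<in> sqint M" "g \<in> sqint M"
  shows "integrable M (\<lambda>x. f x * g x)"
proof (rule Bochner_Integration.integrable_bound)
  show "integrable M (\<lambda>x. (f x)\<^sup>2 + (g x)\<^sup>2)"
    using assms by (auto simp: sqint_def)
  show "(\<lambda>x. f x * g x) \<in> borel_measurable M"
    using assms by (auto simp: sqint_def)
  have "\<bar>f x * g x\<bar> \<le> (f x)\<^sup>2 + (g x)\<^sup>2" for x
    using sum_squares_bound[of "\<bar>f x\<bar>" "\<bar>g x\<bar>"] abs_ge_zero[of "f x * g x"]
    by (simp only: abs_mult power2_abs mult.assoc)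
  thus "AE x in M. norm (f x * g x) \<le> norm ((f x)\<^sup>2 + (g x)\<^sup>2)"
    by (auto intro!: AE_I2 simp: order_trans)
qed

lemma sqint_add:
  assumes "f \<in> sqint M" "g \<in> sqint M"
  shows "(\<lambda>x. f x + g x) \<in> sqint M"
proof -
  have "integrable M (\<lambda>x. (f x)\<^sup>2 + 2 * (f x * g x) + (g x)\<^sup>2)"
    using assms sqint_mult_integrable[OF assms] by (auto simp: sqint_def)
  thus ?thesis
    using assms by (auto simp: sqint_def power2_sum algebra_simps)
qed

lemma sqint_scale: "f \<in> sqint M \<Longrightarrow> (\<lambda>x. c * f x) \<in> sqint M"
  by (auto simp: sqint_def power_mult_distrib)

lemma sqint_diff: "f \<in> sqint M \<Longrightarrow> g \<in> sqint M \<Longrightarrow> (\<lambda>x. f x - g x) \<in> sqint M"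
  using sqint_add[of f M "\<lambda>x. (-1) * g x"] sqint_scale[of g M "-1"] by simp

lemma sqint_zero: "(\<lambda>_. 0) \<in> sqint M"
  by (auto simp: sqint_def)

lemma sqint_sum: "(\<And>i. i \<in> I \<Longrightarrow> f i \<in> sqint M) \<Longrightarrow> (\<lambda>x. \<Sum>i\<in>I. f i x) \<in> sqint M"
  by (induction I rule: infinite_finite_induct) (auto intro: sqint_zero sqint_add)

lemma (in finite_measure) sqint_const: "(\<lambda>_. c) \<in> sqint M"
  by (auto simp: sqint_def)

lemma (in finite_measure) sqint_integrable: "f \<in> sqint M \<Longrightarrow> integrable M f"
  using sqint_mult_integrable[of f M "\<lambda>_. 1"] sqint_const[of 1] by simp

text \<open>The discriminant inequality, stated so that the leading coefficient may vanish. It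
  yields Cauchy-Schwarz for integrals and also for the semidefinite form \<open>G\<close> in the
  construction of an eigenvector.\<close>

lemma square_le_mult_of_quadratic_nonneg:
  fixes a b c :: real
  assumes "\<And>t. 0 \<le> a + 2 * t * b + t\<^sup>2 * c"
  shows "b\<^sup>2 \<le> a * c"
proof -
  have a: "0 \<le> a" using assms[of 0] by simp
  show ?thesis
  proof (cases "c = 0")
    case True
    show ?thesis
    proof (rule ccontr)
      assume "\<not> ?thesis"
      hence "b \<noteq> 0" using True by auto
      \<comment> \<open>At this argument the affine function \<open>a + 2 * t * b\<close> takes the
        value -1.\<close>
      thus False using assms[of "-(a+1)/(2*b)"] True by (simp add: field_simps)
    qed
  next
    case False
    have "c > 0"
    proof (rule ccontr)
      assume "\<not> c > 0"
      hence c: "c < 0" using False by simp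
      \<comment> \<open>Large enough for \<open>s\<^sup>2 * c \<le> -(a + 1)\<close>; adding the
        values at \<open>s\<close> and \<open>-s\<close> cancels the linear term and leaves a
        negative number.\<close>
      define s where "s = (a + 1) / (-c) + 1"
      have s: "s \<ge> 1" "s * (-c) \<ge> a + 1" using c a by (auto simp: s_def field_simps)
      have "s\<^sup>2 \<ge> s" using s by (simp add: power2_eq_square)
      hence "s\<^sup>2 * (-c) \<ge> s * (-c)" using c by (intro mult_right_mono) auto
      hence "s\<^sup>2 * c \<le> -(a + 1)" using s by simp
      moreover have "0 \<le> 2*a + 2 * (s\<^sup>2 * c)" using assms[of s] assms[of "-s"] by simp
      ultimately show False by simp
    qed
    have "0 \<le> c * (a + 2 * (-b/c) * b + (-b/c)\<^sup>2 * c)"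
      using \<open>c > 0\<close> assms[of "-b/c"] by (intro mult_nonneg_nonneg) auto
    also have "\<dots> = a * c - b\<^sup>2" using \<open>c > 0\<close> by (simp add: field_simps power2_eq_square)
    finally show ?thesis by simp
  qed
qed

lemma sqint_Cauchy_Schwarz:
  assumes "f \<in> sqint M" "g \<in> sqint M"
  shows "(\<integral>x. f x * g x \<partial>M)\<^sup>2 \<le> (\<integral>x. (f x)\<^sup>2 \<partial>M) * (\<integral>x. (g x)\<^sup>2 \<partial>M)"
proof (rule square_le_mult_of_quadratic_nonneg)
  fix t :: real
  have "0 \<le> (\<integral>x. (f x + t * g x)\<^sup>2 \<partial>M)" by simp
  also have "(\<lambda>x. (f x + t * g x)\<^sup>2) = (\<lambda>x. (f x)\<^sup>2 + 2 * t * (f x * g x) + t\<^sup>2 * (g x)\<^sup>2)"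
    by (auto simp: power2_eq_square algebra_simps)
  also have "(\<integral>x. \<dots> x \<partial>M) = (\<integral>x. (f x)\<^sup>2 \<partial>M) + 2 * t * (\<integral>x. f x * g x \<partial>M) + t\<^sup>2 * (\<integral>x. (g x)\<^sup>2 \<partial>M)"
    using sqint_square[OF assms(1)] sqint_square[OF assms(2)] sqint_mult_integrable[OF assms] by simp
  finally show "0 \<le> (\<integral>x. (f x)\<^sup>2 \<partial>M) + 2 * t * (\<integral>x. f x * g x \<partial>M) + t\<^sup>2 * (\<integral>x. (g x)\<^sup>2 \<partial>M)" .
qed

lemma (in prob_space) sqint_L1_le:
  assumes "f \<in> sqint M"
  shows "(\<integral>x. \<bar>f x\<bar> \<partial>M)\<^sup>2 \<le> (\<integral>x. (f x)\<^sup>2 \<partial>M)"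
proof -
  have "(\<lambda>x. \<bar>f x\<bar>) \<in> sqint M" using assms by (auto simp: sqint_def)
  from sqint_Cauchy_Schwarz[OF this sqint_const[of 1]] show ?thesis by (simp add: prob_space)
qed

lemma sqint_sum_square_le:
  assumes "f \<in> sqint M" "g \<in> sqint M"
  shows "(\<integral>x. (f x + g x)\<^sup>2 \<partial>M) \<le> 2 * (\<integral>x. (f x)\<^sup>2 \<partial>M) + 2 * (\<integral>x. (g x)\<^sup>2 \<partial>M)"
proof -
  have "(\<integral>x. (f x + g x)\<^sup>2 \<partial>M) \<le> (\<integral>x. 2 * (f x)\<^sup>2 + 2 * (g x)\<^sup>2 \<partial>M)"
  proof (rule integral_mono)
    show "integrable M (\<lambda>x. (f x + g x)\<^sup>2)" using sqint_square[OF sqint_add[OF assms]] .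
    show "integrable M (\<lambda>x. 2 * (f x)\<^sup>2 + 2 * (g x)\<^sup>2)" using assms by (auto simp: sqint_def)
    show "(f x + g x)\<^sup>2 \<le> 2 * (f x)\<^sup>2 + 2 * (g x)\<^sup>2" for x
      using sum_squares_bound[of "f x" "g x"] by (simp add: power2_sum)
  qed
  thus ?thesis using assms by (simp add: sqint_def)
qed

text \<open>A subsequence with geometrically small increments converges almost everywhere;
  Fatou's lemma upgrades this to convergence of the whole sequence in mean square.\<close>

lemma (in prob_space) sqint_complete:
  assumes f: "\<And>n. f n \<in> sqint M"
    and cau: "\<And>\<epsilon>. \<epsilon> > 0 \<Longrightarrow> \<exists>K. \<forall>m\<ge>K. \<forall>n\<ge>K. (\<integral>x. (f m x - f n x)\<^sup>2 \<partial>M) < \<epsilon>"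
  shows "\<exists>g\<in>sqint M. (\<lambda>n. \<integral>x. (f n x - g x)\<^sup>2 \<partial>M) \<longlonglongrightarrow> 0"
proof -
  have [measurable]: "f n \<in> borel_measurable M" for n using f sqint_measurable by blast
  \<comment> \<open>The bound \<open>(1/4)^k\<close> on squared distances becomes
    \<open>(1/2)^k\<close> for the integrals of absolute values, which is summable.\<close>
  have "\<forall>k. \<exists>K. \<forall>m\<ge>K. \<forall>n\<ge>K. (\<integral>x. (f m x - f n x)\<^sup>2 \<partial>M) < (1/4)^k"
    by (intro allI cau) simp
  then obtain K where K: "\<And>k m n. m \<ge> K k \<Longrightarrow> n \<ge> K k \<Longrightarrow> (\<integral>x. (f m x - f n x)\<^sup>2 \<partial>M) < (1/4)^k"
    by metis
  \<comment> \<open>Summing the thresholds makes \<open>r\<close> monotone and at least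
    \<open>K k\<close>; the extra \<open>k\<close> forces \<open>r k \<ge> k\<close>, so that
    \<open>r i\<close> eventually passes every threshold.\<close>
  define r where "r k = (\<Sum>i\<le>k. K i) + k" for k
  have rK: "r k \<ge> K k" for k unfolding r_def
    by (rule trans_le_add1, rule member_le_sum) auto
  have rmono: "r k \<le> r (Suc k)" and rk: "r k \<ge> k" for k by (auto simp: r_def)
  define d where "d k x = f (r (Suc k)) x - f (r k) x" for k x
  have d: "d k \<in> sqint M" for k unfolding d_def using f by (intro sqint_diff) auto
  have dm[measurable]: "d k \<in> borel_measurable M" for k using d sqint_measurable by blast
  have dle: "(\<integral>x. \<bar>d k x\<bar> \<partial>M) \<le> (1/2)^k" for k
  proof -
    have "(\<integral>x. \<bar>d k x\<bar> \<partial>M)\<^sup>2 \<le> (\<integral>x. (d k x)\<^sup>2 \<partial>M)" by (rule sqint_L1_le[OF d])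
    also have "\<dots> \<le> (1/4)^k" unfolding d_def
      using K[OF order_trans[OF rK rmono] rK, of k] by simp
    also have "(1/4::real)^k = ((1/2)^k)\<^sup>2"
      by (simp add: power2_eq_square power_mult_distrib[symmetric])
    finally show ?thesis by (rule power2_le_imp_le) simp
  qed
  have "(\<integral>\<^sup>+x. (\<Sum>k. ennreal \<bar>d k x\<bar>) \<partial>M) = (\<Sum>k. \<integral>\<^sup>+x. ennreal \<bar>d k x\<bar> \<partial>M)"
    by (rule nn_integral_suminf) measurable
  also have "\<dots> = (\<Sum>k. ennreal (\<integral>x. \<bar>d k x\<bar> \<partial>M))"
    using sqint_integrable[OF d] by (intro suminf_cong nn_integral_eq_integral) auto
  also have "\<dots> \<le> (\<Sum>k. ennreal ((1/2)^k))"
    using dle by (intro suminf_le) auto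
  also have "\<dots> = ennreal (\<Sum>k. (1/2)^k)"
    by (intro suminf_ennreal2) (auto intro: summable_geometric)
  finally have fin: "(\<integral>\<^sup>+x. (\<Sum>k. ennreal \<bar>d k x\<bar>) \<partial>M) < \<infinity>"
    using le_less_trans by fastforce
  have "AE x in M. (\<Sum>k. ennreal \<bar>d k x\<bar>) \<noteq> \<infinity>"
    using fin by (intro nn_integral_PInf_AE) auto
  hence conv: "AE x in M. convergent (\<lambda>k. f (r k) x)"
  proof eventually_elim
    case (elim x)
    have "summable (\<lambda>k. \<bar>d k x\<bar>)"
      using elim by (intro summable_suminf_not_top) auto
    hence "summable (\<lambda>k. d k x)" by (rule summable_rabs_cancel)
    hence "convergent (\<lambda>n. \<Sum>k<n. d k x)" by (simp add: summable_iff_convergent)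
    moreover have "(\<Sum>k<n. d k x) = f (r n) x - f (r 0) x" for n
      unfolding d_def by (rule sum_lessThan_telescope)
    ultimately have "convergent (\<lambda>n. f (r n) x - f (r 0) x)" by simp
    hence "convergent (\<lambda>n. (f (r n) x - f (r 0) x) + f (r 0) x)"
      by (intro convergent_add convergent_const)
    thus ?case by simp
  qed
  define g where "g x = lim (\<lambda>k. f (r k) x)" for x
  have [measurable]: "g \<in> borel_measurable M" unfolding g_def by measurable
  have g: "AE x in M. (\<lambda>k. f (r k) x) \<longlonglongrightarrow> g x"
    using conv by eventually_elim (simp add: g_def convergent_LIMSEQ_iff)
  have bound: "(\<integral>\<^sup>+x. ennreal ((f n x - g x)\<^sup>2) \<partial>M) \<le> ennreal ((1/4)^k)" if n: "n \<ge> K k" for n k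
  proof -
    have "(\<integral>\<^sup>+x. ennreal ((f n x - g x)\<^sup>2) \<partial>M) = (\<integral>\<^sup>+x. liminf (\<lambda>i. ennreal ((f n x - f (r i) x)\<^sup>2)) \<partial>M)"
    proof (rule nn_integral_cong_AE)
      show "AE x in M. ennreal ((f n x - g x)\<^sup>2) = liminf (\<lambda>i. ennreal ((f n x - f (r i) x)\<^sup>2))"
        using g
      proof eventually_elim
        case (elim x)
        have "(\<lambda>i. ennreal ((f n x - f (r i) x)\<^sup>2)) \<longlonglongrightarrow> ennreal ((f n x - g x)\<^sup>2)"
          by (intro tendsto_intros elim tendsto_ennrealI)
        thus ?case by (rule lim_imp_Liminf[symmetric, OF trivial_limit_sequentially])
      qed
    qed
    also have "\<dots> \<le> liminf (\<lambda>i. \<integral>\<^sup>+x. ennreal ((f n x - f (r i) x)\<^sup>2) \<partial>M)"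
      by (rule nn_integral_liminf) measurable
    also have "\<dots> \<le> liminf (\<lambda>i::nat. ennreal ((1/4)^k))"
    proof (rule Liminf_mono)
      have "(\<integral>\<^sup>+x. ennreal ((f n x - f (r i) x)\<^sup>2) \<partial>M) \<le> ennreal ((1/4)^k)" if "i \<ge> K k" for i
      proof -
        have "(\<integral>\<^sup>+x. ennreal ((f n x - f (r i) x)\<^sup>2) \<partial>M) = ennreal (\<integral>x. (f n x - f (r i) x)\<^sup>2 \<partial>M)"
          using sqint_square[OF sqint_diff[OF f f]] by (intro nn_integral_eq_integral) auto
        also have "\<dots> \<le> ennreal ((1/4)^k)"
          using K[OF n, of "r i"] rk[of i] that by (intro ennreal_leI) simp
        finally show ?thesis .
      qed
      thus "\<forall>\<^sub>F i in sequentially. (\<integral>\<^sup>+x. ennreal ((f n x - f (r i) x)\<^sup>2) \<partial>M) \<le> ennreal ((1/4)^k)"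
        by (auto simp: eventually_sequentially)
    qed
    also have "\<dots> = ennreal ((1/4)^k)" by (simp add: Liminf_const)
    finally show ?thesis .
  qed
  have int: "integrable M (\<lambda>x. (f n x - g x)\<^sup>2)" if "n \<ge> K k" for n k
  proof (rule integrableI_bounded)
    show "(\<integral>\<^sup>+x. ennreal (norm ((f n x - g x)\<^sup>2)) \<partial>M) < \<infinity>"
      using bound[OF that] le_less_trans by fastforce
  qed measurable
  have "(\<lambda>x. f (K 0) x - g x) \<in> sqint M"
    using int[of 0] by (auto simp: sqint_def)
  from sqint_diff[OF f[of "K 0"] this] have gs: "g \<in> sqint M" by simp
  have "(\<lambda>n. \<integral>x. (f n x - g x)\<^sup>2 \<partial>M) \<longlonglongrightarrow> 0"
  proof (rule LIMSEQ_I)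
    fix \<epsilon> :: real assume "\<epsilon> > 0"
    then obtain k where k: "(1/4)^k < \<epsilon>"
      using real_arch_pow_inv[of \<epsilon> "1/4"] by auto
    have "norm ((\<integral>x. (f n x - g x)\<^sup>2 \<partial>M) - 0) < \<epsilon>" if n: "n \<ge> K k" for n
    proof -
      have "ennreal (\<integral>x. (f n x - g x)\<^sup>2 \<partial>M) = (\<integral>\<^sup>+x. ennreal ((f n x - g x)\<^sup>2) \<partial>M)"
        using int[OF n] by (intro nn_integral_eq_integral[symmetric]) auto
      also have "\<dots> \<le> ennreal ((1/4)^k)" by (rule bound[OF n])
      finally have "(\<integral>x. (f n x - g x)\<^sup>2 \<partial>M) \<le> (1/4)^k"
        by (subst (asm) ennreal_le_iff) auto
      thus ?thesis using k by simp
    qed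
    thus "\<exists>no. \<forall>n\<ge>no. norm ((\<integral>x. (f n x - g x)\<^sup>2 \<partial>M) - 0) < \<epsilon>" by blast
  qed
  thus ?thesis using gs by blast
qed

text \<open>Cauchy-Schwarz against a fixed \<open>h\<close>. With \<open>h\<close> equal to 1, to a
  product of two elements of \<open>H\<close>, or to a product of indicators, it carries
  expectations, forms and localized expectations to the limit.\<close>

lemma sqint_tendsto_inner:
  assumes f: "\<And>n. f n \<in> sqint M" and g: "g \<in> sqint M" and h: "h \<in> sqint M"
    and lim: "(\<lambda>n. \<integral>x. (f n x - g x)\<^sup>2 \<partial>M) \<longlonglongrightarrow> 0"
  shows "(\<lambda>n. \<integral>x. f n x * h x \<partial>M) \<longlonglongrightarrow> (\<integral>x. g x * h x \<partial>M)"
proof -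
  have "(\<lambda>n. (\<integral>x. (f n x - g x) * h x \<partial>M)\<^sup>2) \<longlonglongrightarrow> 0"
  proof (rule tendsto_sandwich[OF _ _ tendsto_const])
    show "\<forall>\<^sub>F n in sequentially. (\<integral>x. (f n x - g x) * h x \<partial>M)\<^sup>2
        \<le> (\<integral>x. (f n x - g x)\<^sup>2 \<partial>M) * (\<integral>x. (h x)\<^sup>2 \<partial>M)"
      using sqint_Cauchy_Schwarz[OF sqint_diff[OF f g] h] by auto
    show "(\<lambda>n. (\<integral>x. (f n x - g x)\<^sup>2 \<partial>M) * (\<integral>x. (h x)\<^sup>2 \<partial>M)) \<longlonglongrightarrow> 0"
      using tendsto_mult_right[OF lim, of "\<integral>x. (h x)\<^sup>2 \<partial>M"] by simp
  qed auto
  hence "(\<lambda>n. \<integral>x. (f n x - g x) * h x \<partial>M) \<longlonglongrightarrow> 0"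
    by (simp add: tendsto_power_zero power_tendsto_0_iff)
  hence "(\<lambda>n. (\<integral>x. (f n x - g x) * h x \<partial>M) + (\<integral>x. g x * h x \<partial>M)) \<longlonglongrightarrow> 0 + (\<integral>x. g x * h x \<partial>M)"
    by (intro tendsto_add tendsto_const)
  moreover have "(\<integral>x. (f n x - g x) * h x \<partial>M) + (\<integral>x. g x * h x \<partial>M) = (\<integral>x. f n x * h x \<partial>M)" for n
    using sqint_mult_integrable[OF f h] sqint_mult_integrable[OF g h] by (simp add: left_diff_distrib)
  ultimately show ?thesis by simp
qed

section \<open>Moments in a Gaussian Hilbert space\<close>

text \<open>All signs of \<open>b\<close>, \<open>c\<close>, \<open>d\<close> are summed with the
  product of the signs as weight. Only monomials odd in each of the three survive, and in degree 4
  this leaves \<open>a * b * c * d\<close> alone, with coefficient 4! in each of 8 terms.\<close>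

lemma fourth_power_polarization:
  fixes a b c d :: real
  shows "192 * (a * b * c * d) = (a + b + c + d)^4 - (a + b + c - d)^4 - (a + b - c + d)^4
    - (a - b + c + d)^4 + (a + b - c - d)^4 + (a - b + c - d)^4 + (a - b - c + d)^4 - (a - b - c - d)^4"
  by algebra

text \<open>The same signed sum for squared variances: \<open>s\<close> stands for the sum of the
  four second moments, the other letters for mixed moments. The factor 3 in the Gaussian fourth
  moment turns 64 into the 192 of \<open>fourth_power_polarization\<close>.\<close>

lemma pairing_polarization:
  fixes s ab ac ad bc bd cd :: real
  shows "(s + 2 * ab + 2 * ac + 2 * ad + 2 * bc + 2 * bd + 2 * cd)\<^sup>2
    - (s + 2 * ab + 2 * ac - 2 * ad + 2 * bc - 2 * bd - 2 * cd)\<^sup>2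
    - (s + 2 * ab - 2 * ac + 2 * ad - 2 * bc + 2 * bd - 2 * cd)\<^sup>2
    - (s - 2 * ab + 2 * ac + 2 * ad - 2 * bc - 2 * bd + 2 * cd)\<^sup>2
    + (s + 2 * ab - 2 * ac - 2 * ad - 2 * bc - 2 * bd + 2 * cd)\<^sup>2
    + (s - 2 * ab + 2 * ac - 2 * ad - 2 * bc + 2 * bd - 2 * cd)\<^sup>2
    + (s - 2 * ab - 2 * ac + 2 * ad + 2 * bc - 2 * bd - 2 * cd)\<^sup>2
    - (s - 2 * ab - 2 * ac - 2 * ad + 2 * bc + 2 * bd + 2 * cd)\<^sup>2
    = 64 * (ab * cd + ac * bd + ad * bc)"
  by algebra

locale gaussian_space = prob_space M for M :: "'a measure" +
  fixes H :: "('a \<Rightarrow> real) set"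
  assumes ghs: "gaussian_hilbert_space M H"
begin

lemma H_zero: "(\<lambda>_. 0) \<in> H"
  and H_add: "\<xi> \<in> H \<Longrightarrow> \<eta> \<in> H \<Longrightarrow> (\<lambda>\<omega>. \<xi> \<omega> + \<eta> \<omega>) \<in> H"
  and H_scale: "\<xi> \<in> H \<Longrightarrow> (\<lambda>\<omega>. c * \<xi> \<omega>) \<in> H"
  and H_gaussian: "\<xi> \<in> H \<Longrightarrow> centered_gaussian M \<xi>"
  using ghs unfolding gaussian_hilbert_space_def by blast+

lemma H_diff: "\<xi> \<in> H \<Longrightarrow> \<eta> \<in> H \<Longrightarrow> (\<lambda>\<omega>. \<xi> \<omega> - \<eta> \<omega>) \<in> H"
  using H_add[of \<xi> "\<lambda>\<omega>. (-1) * \<eta> \<omega>"] H_scale[of \<eta> "-1"] by simp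

lemma H_sum: "(\<And>i. i \<in> I \<Longrightarrow> f i \<in> H) \<Longrightarrow> (\<lambda>\<omega>. \<Sum>i\<in>I. f i \<omega>) \<in> H"
  by (induction I rule: infinite_finite_induct) (auto intro: H_zero H_add)

lemma H_closed:
  assumes "\<And>n. f n \<in> H" "g \<in> sqint M" "(\<lambda>n. \<integral>x. (f n x - g x)\<^sup>2 \<partial>M) \<longlonglongrightarrow> 0"
  shows "g \<in> H"
proof -
  have "\<forall>f g. (\<forall>n. f n \<in> H) \<and> g \<in> borel_measurable M \<and> integrable M (\<lambda>\<omega>. (g \<omega>)\<^sup>2) \<and> L2_conv M f g \<longrightarrow> g \<in> H"
    using ghs unfolding gaussian_hilbert_space_def by (elim conjE)
  thus ?thesis using assms unfolding L2_conv_def sqint_def by blast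
qed

lemma H_measurable [measurable]: "\<xi> \<in> H \<Longrightarrow> \<xi> \<in> borel_measurable M"
  using H_gaussian by (auto simp: centered_gaussian_def)

text \<open>The characteristic function is needed at the argument 1 only: \<open>H\<close> is closed
  under linear combinations, so this value determines all joint characteristic functions of elements
  of \<open>H\<close>.\<close>

lemma H_moments:
  assumes "\<xi> \<in> H"
  shows "integrable M (\<lambda>x. (\<xi> x)\<^sup>2)" "integrable M (\<lambda>x. \<xi> x ^ 4)"
    "(\<integral>x. \<xi> x ^ 4 \<partial>M) = 3 * (\<integral>x. (\<xi> x)\<^sup>2 \<partial>M)\<^sup>2"
    "(CLINT x|M. iexp (\<xi> x)) = complex_of_real (exp (- (\<integral>x. (\<xi> x)\<^sup>2 \<partial>M) / 2))"
proof -
  note [measurable] = H_measurable[OF assms]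
  have "integrable M (\<lambda>x. (\<xi> x)\<^sup>2) \<and> integrable M (\<lambda>x. \<xi> x ^ 4) \<and>
    (\<integral>x. \<xi> x ^ 4 \<partial>M) = 3 * (\<integral>x. (\<xi> x)\<^sup>2 \<partial>M)\<^sup>2 \<and>
    (CLINT x|M. iexp (\<xi> x)) = complex_of_real (exp (- (\<integral>x. (\<xi> x)\<^sup>2 \<partial>M) / 2))"
    using H_gaussian[OF assms] unfolding centered_gaussian_def
  proof (elim conjE disjE exE)
    assume ae: "AE \<omega> in M. \<xi> \<omega> = 0"
    have 2: "AE x in M. (\<xi> x)\<^sup>2 = 0" and 4: "AE x in M. \<xi> x ^ 4 = 0"
      and c: "AE x in M. iexp (\<xi> x) = 1"
      using ae by (eventually_elim, simp)+
    have i: "integrable M (\<lambda>x. (\<xi> x)\<^sup>2) \<longleftrightarrow> integrable M (\<lambda>x. 0::real)"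
      "integrable M (\<lambda>x. \<xi> x ^ 4) \<longleftrightarrow> integrable M (\<lambda>x. 0::real)"
      by (rule integrable_cong_AE; use 2 4 in simp)+
    have e: "(\<integral>x. (\<xi> x)\<^sup>2 \<partial>M) = (\<integral>x. 0 \<partial>M)" "(\<integral>x. \<xi> x ^ 4 \<partial>M) = (\<integral>x. 0 \<partial>M)"
      "(CLINT x|M. iexp (\<xi> x)) = (CLINT x|M. 1)"
      by (rule integral_cong_AE; use 2 4 c in simp)+
    show ?thesis unfolding i e by (simp add: prob_space)
  next
    fix \<sigma> :: real assume \<sigma>: "\<sigma> > 0" and D: "distributed M lborel \<xi> (normal_density 0 \<sigma>)"
    have m2: "has_bochner_integral lborel (\<lambda>x. normal_density 0 \<sigma> x * x\<^sup>2) (\<sigma>\<^sup>2)"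
      using normal_moment_even[OF \<sigma>, of 0 1] by simp
    have m4: "has_bochner_integral lborel (\<lambda>x. normal_density 0 \<sigma> x * x^4) (3 * (\<sigma>\<^sup>2)\<^sup>2)"
      using normal_moment_even[OF \<sigma>, of 0 2] by (simp add: fact_numeral power_divide)
    have i2: "integrable M (\<lambda>x. (\<xi> x)\<^sup>2)"
      using distributed_integrable[OF D, of "\<lambda>x. x\<^sup>2"] m2 by (auto simp: has_bochner_integral_iff)
    have i4: "integrable M (\<lambda>x. \<xi> x ^ 4)"
      using distributed_integrable[OF D, of "\<lambda>x. x^4"] m4 by (auto simp: has_bochner_integral_iff)
    have e2: "(\<integral>x. (\<xi> x)\<^sup>2 \<partial>M) = \<sigma>\<^sup>2"
      using distributed_integral[OF D, of "\<lambda>x. x\<^sup>2"] m2 by (auto simp: has_bochner_integral_iff)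
    have e4: "(\<integral>x. \<xi> x ^ 4 \<partial>M) = 3 * (\<sigma>\<^sup>2)\<^sup>2"
      using distributed_integral[OF D, of "\<lambda>x. x^4"] m4 by (auto simp: has_bochner_integral_iff)
    \<comment> \<open>Evaluating the characteristic function of the standardized variable at
      \<open>\<sigma>\<close> gives that of \<open>\<xi>\<close> at 1.\<close>
    have D1: "distributed M lborel (\<lambda>x. \<xi> x / \<sigma>) std_normal_density"
      using normal_standard_normal_convert[OF \<sigma>, of \<xi> 0] D by simp
    have "distr M borel (\<lambda>x. \<xi> x / \<sigma>) = distr M lborel (\<lambda>x. \<xi> x / \<sigma>)"
      by (intro distr_cong) auto
    also have "\<dots> = std_normal_distribution"
      using distributed_distr_eq_density[OF D1] by simp
    finally have "char (distr M borel (\<lambda>x. \<xi> x / \<sigma>)) \<sigma> = complex_of_real (exp (- (\<sigma>\<^sup>2) / 2))"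
      using char_std_normal_distribution by simp
    also have "char (distr M borel (\<lambda>x. \<xi> x / \<sigma>)) \<sigma> = (CLINT x|M. iexp (\<xi> x))"
      unfolding char_def using \<sigma> by (subst integral_distr) auto
    finally show ?thesis using i2 i4 e2 e4 by simp
  qed
  thus "integrable M (\<lambda>x. (\<xi> x)\<^sup>2)" "integrable M (\<lambda>x. \<xi> x ^ 4)"
    "(\<integral>x. \<xi> x ^ 4 \<partial>M) = 3 * (\<integral>x. (\<xi> x)\<^sup>2 \<partial>M)\<^sup>2"
    "(CLINT x|M. iexp (\<xi> x)) = complex_of_real (exp (- (\<integral>x. (\<xi> x)\<^sup>2 \<partial>M) / 2))" by auto
qed

lemma H_sqint: "\<xi> \<in> H \<Longrightarrow> \<xi> \<in> sqint M"
  by (auto simp: sqint_def H_moments H_measurable)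

lemma H_mult_integrable: "\<xi> \<in> H \<Longrightarrow> \<eta> \<in> H \<Longrightarrow> integrable M (\<lambda>x. \<xi> x * \<eta> x)"
  by (intro sqint_mult_integrable H_sqint)

text \<open>Wick's formula, obtained by polarizing the fourth moment of a Gaussian variable.\<close>

lemma H_wick:
  assumes a: "a \<in> H" and b: "b \<in> H" and c: "c \<in> H" and d: "d \<in> H"
  shows "integrable M (\<lambda>x. a x * b x * c x * d x)"
    and "(\<integral>x. a x * b x * c x * d x \<partial>M) = (\<integral>x. a x * b x \<partial>M) * (\<integral>x. c x * d x \<partial>M)
      + (\<integral>x. a x * c x \<partial>M) * (\<integral>x. b x * d x \<partial>M) + (\<integral>x. a x * d x \<partial>M) * (\<integral>x. b x * c x \<partial>M)"
proof -
  \<comment> \<open>One sign can stay fixed because fourth powers are even.\<close>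
  define L where "L p q r x = a x + p * b x + q * c x + r * d x" for p q r x
  have L: "L p q r \<in> H" for p q r
    unfolding L_def by (intro H_add H_scale a b c d)
  have pol: "a x * b x * c x * d x = (L 1 1 1 x^4 - L 1 1 (-1) x^4 - L 1 (-1) 1 x^4 - L (-1) 1 1 x^4
      + L 1 (-1) (-1) x^4 + L (-1) 1 (-1) x^4 + L (-1) (-1) 1 x^4 - L (-1) (-1) (-1) x^4) / 192" for x
    unfolding L_def using fourth_power_polarization[of "a x" "b x" "c x" "d x"] by simp
  note i4 = H_moments(2)[OF L] and e4 = H_moments(3)[OF L]
  show "integrable M (\<lambda>x. a x * b x * c x * d x)"
    unfolding pol using i4 by (intro integrable_divide_zero Bochner_Integration.integrable_add
        Bochner_Integration.integrable_diff) auto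
  have q: "(\<integral>x. (L p q r x)\<^sup>2 \<partial>M) = (\<integral>x. a x * a x \<partial>M) + p\<^sup>2 * (\<integral>x. b x * b x \<partial>M) + q\<^sup>2 * (\<integral>x. c x * c x \<partial>M)
      + r\<^sup>2 * (\<integral>x. d x * d x \<partial>M) + 2 * p * (\<integral>x. a x * b x \<partial>M) + 2 * q * (\<integral>x. a x * c x \<partial>M)
      + 2 * r * (\<integral>x. a x * d x \<partial>M) + 2 * (p * q) * (\<integral>x. b x * c x \<partial>M) + 2 * (p * r) * (\<integral>x. b x * d x \<partial>M)
      + 2 * (q * r) * (\<integral>x. c x * d x \<partial>M)" for p q r
  proof -
    have "(L p q r x)\<^sup>2 = a x * a x + p\<^sup>2 * (b x * b x) + q\<^sup>2 * (c x * c x)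
      + r\<^sup>2 * (d x * d x) + 2 * p * (a x * b x) + 2 * q * (a x * c x)
      + 2 * r * (a x * d x) + 2 * (p * q) * (b x * c x) + 2 * (p * r) * (b x * d x)
      + 2 * (q * r) * (c x * d x)" for x
      unfolding L_def by (simp add: power2_eq_square algebra_simps)
    thus ?thesis using a b c d by (simp add: H_mult_integrable)
  qed
  have "(\<integral>x. a x * b x * c x * d x \<partial>M) = ((\<integral>x. L 1 1 1 x^4 \<partial>M) - (\<integral>x. L 1 1 (-1) x^4 \<partial>M)
      - (\<integral>x. L 1 (-1) 1 x^4 \<partial>M) - (\<integral>x. L (-1) 1 1 x^4 \<partial>M) + (\<integral>x. L 1 (-1) (-1) x^4 \<partial>M)
      + (\<integral>x. L (-1) 1 (-1) x^4 \<partial>M) + (\<integral>x. L (-1) (-1) 1 x^4 \<partial>M) - (\<integral>x. L (-1) (-1) (-1) x^4 \<partial>M)) / 192"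
    unfolding pol using i4 by simp
  also have "\<dots> = (\<integral>x. a x * b x \<partial>M) * (\<integral>x. c x * d x \<partial>M)
      + (\<integral>x. a x * c x \<partial>M) * (\<integral>x. b x * d x \<partial>M) + (\<integral>x. a x * d x \<partial>M) * (\<integral>x. b x * c x \<partial>M)"
    unfolding e4 q using pairing_polarization[of "(\<integral>x. a x * a x \<partial>M) + (\<integral>x. b x * b x \<partial>M) + (\<integral>x. c x * c x \<partial>M) + (\<integral>x. d x * d x \<partial>M)"
        "\<integral>x. a x * b x \<partial>M" "\<integral>x. a x * c x \<partial>M" "\<integral>x. a x * d x \<partial>M" "\<integral>x. b x * c x \<partial>M" "\<integral>x. b x * d x \<partial>M" "\<integral>x. c x * d x \<partial>M"]
    by simp
  finally show "(\<integral>x. a x * b x * c x * d x \<partial>M) = (\<integral>x. a x * b x \<partial>M) * (\<integral>x. c x * d x \<partial>M)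
      + (\<integral>x. a x * c x \<partial>M) * (\<integral>x. b x * d x \<partial>M) + (\<integral>x. a x * d x \<partial>M) * (\<integral>x. b x * c x \<partial>M)" .
qed

lemma H_mult_sqint:
  assumes "a \<in> H" "b \<in> H"
  shows "(\<lambda>x. a x * b x) \<in> sqint M"
  using H_wick(1)[OF assms assms] assms by (auto simp: sqint_def power2_eq_square algebra_simps)

text \<open>Wick's formula produces the squared inner product twice, and Cauchy-Schwarz bounds each
  copy. Products of elements of \<open>H\<close> are thereby controlled in mean square by the norms
  of the factors, which is what makes the forms below bounded.\<close>

lemma H_mult_square_le:
  assumes "a \<in> H" "b \<in> H"
  shows "(\<integral>x. (a x * b x)\<^sup>2 \<partial>M) \<le> 3 * ((\<integral>x. (a x)\<^sup>2 \<partial>M) * (\<integral>x. (b x)\<^sup>2 \<partial>M))"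
proof -
  have "(\<integral>x. (a x * b x)\<^sup>2 \<partial>M) = 2 * (\<integral>x. a x * b x \<partial>M)\<^sup>2 + (\<integral>x. (a x)\<^sup>2 \<partial>M) * (\<integral>x. (b x)\<^sup>2 \<partial>M)"
    using H_wick(2)[OF assms(1) assms(1) assms(2) assms(2)]
    by (simp add: power2_eq_square algebra_simps)
  thus ?thesis using sqint_Cauchy_Schwarz[OF H_sqint[OF assms(1)] H_sqint[OF assms(2)]] by simp
qed

lemma wick2_sqint: "a \<in> H \<Longrightarrow> b \<in> H \<Longrightarrow> wick2 M a b \<in> sqint M"
  unfolding wick2_def by (intro sqint_diff H_mult_sqint sqint_const)

text \<open>Centring cancels the pairing of \<open>a\<close> with \<open>b\<close>, and the two
  cross pairings remain. Hence the form attached to a Wick product has rank at most 2.\<close>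

lemma wick2_inner:
  assumes "a \<in> H" "b \<in> H" "c \<in> H" "d \<in> H"
  shows "(\<integral>x. wick2 M a b x * (c x * d x) \<partial>M) =
    (\<integral>x. a x * c x \<partial>M) * (\<integral>x. b x * d x \<partial>M) + (\<integral>x. a x * d x \<partial>M) * (\<integral>x. b x * c x \<partial>M)"
proof -
  have "(\<integral>x. wick2 M a b x * (c x * d x) \<partial>M) =
      (\<integral>x. a x * b x * c x * d x - (\<integral>x. a x * b x \<partial>M) * (c x * d x) \<partial>M)"
    unfolding wick2_def by (simp add: algebra_simps)
  thus ?thesis using H_wick[OF assms] H_mult_integrable[OF assms(3,4)] by simp
qed

lemma wick2_expectation:
  assumes "a \<in> H" "b \<in> H"
  shows "(\<integral>x. wick2 M a b x \<partial>M) = 0"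
  unfolding wick2_def using H_mult_integrable[OF assms] by (simp add: prob_space)

lemma wick2_span_sqint: "f \<in> wick2_span M H \<Longrightarrow> f \<in> sqint M"
  by (auto simp: wick2_span_def intro!: sqint_sum sqint_scale wick2_sqint)

lemma wick_chaos2_sqint: "Y \<in> wick_chaos2 M H \<Longrightarrow> Y \<in> sqint M"
  by (auto simp: wick_chaos2_def sqint_def)

end

section \<open>Independence from factorization of characteristic functions\<close>

text \<open>Both sides are, up to normalization, the law of \<open>U\<close> under the measure with density
  \<open>h\<close>, shifted by a constant to make it positive; Levy's theorem identifies the laws.\<close>

lemma (in prob_space) integral_indicator_mult_of_char_real:
  fixes U h :: "'a \<Rightarrow> real"
  assumes [measurable]: "U \<in> borel_measurable M" "h \<in> borel_measurable M"
    and bound: "\<And>x. \<bar>h x\<bar> \<le> C"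
    and char: "\<And>u. (CLINT x|M. iexp (u * U x) * complex_of_real (h x)) =
      (CLINT x|M. iexp (u * U x)) * complex_of_real (\<integral>x. h x \<partial>M)"
    and [measurable]: "S \<in> sets borel"
  shows "(\<integral>x. indicator S (U x) * h x \<partial>M) = prob (U -` S \<inter> space M) * (\<integral>x. h x \<partial>M)"
proof -
  define w where "w x = h x + (C + 1)" for x
  have wpos: "w x \<ge> 1" and wbound: "\<bar>w x\<bar> \<le> 2 * C + 1" for x
    using bound[of x] by (auto simp: w_def)
  have [measurable]: "w \<in> borel_measurable M" unfolding w_def by measurable
  have inth: "integrable M h"
    using bound by (intro integrable_const_bound[of _ C]) auto
  have intw: "integrable M w"
    using wbound by (intro integrable_const_bound[of _ "2 * C + 1"]) auto
  define W where "W = (\<integral>x. w x \<partial>M)"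
  have Weq: "W = (\<integral>x. h x \<partial>M) + (C + 1)"
    unfolding W_def w_def using inth by (simp add: prob_space)
  have "W \<ge> (\<integral>x. 1 \<partial>M)"
    unfolding W_def by (intro integral_mono intw wpos) auto
  hence Wpos: "W \<ge> 1" by (simp add: prob_space)
  define D where "D = density M (\<lambda>x. ennreal (w x / W))"
  have nn: "w x / W \<ge> 0" for x using wpos[of x] Wpos by simp
  have sD: "sets D = sets M" "space D = space M" by (auto simp: D_def)
  have [measurable]: "U \<in> borel_measurable D" by (simp add: D_def)
  have "emeasure D (space D) = (\<integral>\<^sup>+x. ennreal (w x / W) \<partial>M)"
    unfolding D_def by (simp add: emeasure_density cong: nn_integral_cong)
  also have "\<dots> = ennreal (\<integral>x. w x / W \<partial>M)"
    using intw nn by (intro nn_integral_eq_integral) auto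
  also have "(\<integral>x. w x / W \<partial>M) = 1"
    using Wpos by (simp add: W_def[symmetric])
  finally interpret D: prob_space D by (intro prob_spaceI) simp
  have ic: "integrable M (\<lambda>x. iexp (u * U x))" for u
    by (intro integrable_const_bound[of _ 1]) auto
  have ich: "integrable M (\<lambda>x. iexp (u * U x) * complex_of_real (h x))" for u
    using bound by (intro integrable_const_bound[of _ C]) (auto simp: norm_mult)
  \<comment> \<open>The hypothesis pulls the mean of \<open>h\<close> out of the integral, and the
    constant \<open>C + 1\<close> comes out trivially; their sum is \<open>W\<close>, so the
    normalization cancels.\<close>
  have "char (distr D borel U) u = char (distr M borel U) u" for u
  proof -
    have "char (distr D borel U) u = (CLINT x|D. iexp (u * U x))"
      unfolding char_def by (subst integral_distr) auto
    also have "\<dots> = (CLINT x|M. (w x / W) *\<^sub>R iexp (u * U x))"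
      unfolding D_def using nn by (subst integral_density) auto
    also have "\<dots> = (CLINT x|M. (iexp (u * U x) * complex_of_real (h x) + complex_of_real (C + 1) * iexp (u * U x)) / complex_of_real W)"
      by (intro Bochner_Integration.integral_cong) (auto simp: w_def scaleR_conv_of_real field_simps)
    also have "\<dots> = (CLINT x|M. iexp (u * U x)) * (complex_of_real (\<integral>x. h x \<partial>M) + complex_of_real (C + 1)) / complex_of_real W"
    proof -
      have "(CLINT x|M. (iexp (u * U x) * complex_of_real (h x) + complex_of_real (C + 1) * iexp (u * U x)) / complex_of_real W)
        = ((CLINT x|M. iexp (u * U x) * complex_of_real (h x)) + complex_of_real (C + 1) * (CLINT x|M. iexp (u * U x))) / complex_of_real W"
        using ic[of u] ich[of u] by simp
      thus ?thesis unfolding char by (simp add: algebra_simps)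
    qed
    also have "\<dots> = (CLINT x|M. iexp (u * U x))"
      using Wpos Weq by (simp flip: of_real_add)
    also have "\<dots> = char (distr M borel U) u"
      unfolding char_def by (subst integral_distr) auto
    finally show ?thesis .
  qed
  hence eq: "distr D borel U = distr M borel U"
    by (intro Levy_uniqueness D.real_distribution_distr real_distribution_distr) auto
  have SU [measurable]: "U -` S \<inter> space M \<in> sets M" by measurable
  have "emeasure D (U -` S \<inter> space M) = emeasure M (U -` S \<inter> space M)"
    using arg_cong[OF eq, of "\<lambda>N. emeasure N S"] by (simp add: emeasure_distr sD)
  hence "prob (U -` S \<inter> space M) = measure D (U -` S \<inter> space M)"
    by (simp add: measure_def)
  also have "\<dots> = (\<integral>x. indicator (U -` S \<inter> space M) x \<partial>D)"
    using sD sets.sets_into_space[OF SU] by (simp add: Int_absorb2)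
  also have "\<dots> = (\<integral>x. (w x / W) *\<^sub>R indicator (U -` S \<inter> space M) x \<partial>M)"
    unfolding D_def using nn by (subst integral_density) auto
  also have "\<dots> = (\<integral>x. indicator S (U x) * w x / W \<partial>M)"
    by (intro Bochner_Integration.integral_cong) (auto simp: indicator_def)
  finally have "prob (U -` S \<inter> space M) * W = (\<integral>x. indicator S (U x) * w x \<partial>M)"
    using Wpos by (simp add: field_simps)
  also have "\<dots> = (\<integral>x. indicator S (U x) * h x + (C + 1) * indicator (U -` S \<inter> space M) x \<partial>M)"
    by (intro Bochner_Integration.integral_cong) (auto simp: indicator_def w_def)
  also have "\<dots> = (\<integral>x. indicator S (U x) * h x \<partial>M) + (C + 1) * prob (U -` S \<inter> space M)"
  proof -
    have "integrable M (\<lambda>x. indicator S (U x) * h x)"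
      using bound order_trans[OF abs_ge_zero bound]
      by (intro integrable_const_bound[of _ C]) (auto simp: abs_mult indicator_def)
    thus ?thesis using sets.sets_into_space[OF SU]
      by (simp add: Int_absorb2 emeasure_eq_measure)
  qed
  finally show ?thesis by (simp add: Weq algebra_simps)
qed

text \<open>The real version is applied to the real and imaginary parts of \<open>g\<close>. The
  factorization is inherited by them because it holds for every \<open>u\<close>: conjugating it at
  \<open>-u\<close> gives the same identity for the conjugate of \<open>g\<close>.\<close>

lemma (in prob_space) integral_indicator_mult_of_char:
  fixes U :: "'a \<Rightarrow> real" and g :: "'a \<Rightarrow> complex"
  assumes [measurable]: "U \<in> borel_measurable M" "g \<in> borel_measurable M"
    and bound: "\<And>x. cmod (g x) \<le> C"
    and char: "\<And>u. (CLINT x|M. iexp (u * U x) * g x) = (CLINT x|M. iexp (u * U x)) * (CLINT x|M. g x)"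
    and [measurable]: "S \<in> sets borel"
  shows "(CLINT x|M. indicator S (U x) * g x) = complex_of_real (prob (U -` S \<inter> space M)) * (CLINT x|M. g x)"
proof -
  have ig: "integrable M g" using bound by (intro integrable_const_bound[of _ C]) auto
  have iu: "integrable M (\<lambda>x. iexp (u * U x))" for u
    by (intro integrable_const_bound[of _ 1]) auto
  have iug: "integrable M (\<lambda>x. iexp (u * U x) * g x)" for u
    using bound by (intro integrable_const_bound[of _ C]) (auto simp: norm_mult)
  have [measurable]: "(\<lambda>x. cnj (g x)) \<in> borel_measurable M"
    by (rule measurable_compose[OF _ borel_measurable_continuous_onI]) (auto intro: continuous_intros)
  have iug': "integrable M (\<lambda>x. iexp (u * U x) * cnj (g x))" for u
    using bound by (intro integrable_const_bound[of _ C]) (auto simp: norm_mult)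
  have isg: "integrable M (\<lambda>x. indicator S (U x) * g x)"
    using bound order_trans[OF norm_ge_zero bound]
    by (intro integrable_const_bound[of _ C]) (auto simp: norm_mult indicator_def)
  have cnj_iexp: "cnj (iexp t) = iexp (- t)" for t :: real
    by (simp add: exp_cnj)
  have char': "(CLINT x|M. iexp (u * U x) * cnj (g x)) = (CLINT x|M. iexp (u * U x)) * cnj (CLINT x|M. g x)" for u
  proof -
    have "(CLINT x|M. iexp (u * U x) * cnj (g x)) = (CLINT x|M. cnj (iexp (- u * U x) * g x))"
      by (intro Bochner_Integration.integral_cong refl) (simp only: complex_cnj_mult cnj_iexp, simp)
    also have "\<dots> = cnj (CLINT x|M. iexp (- u * U x) * g x)" by (rule Bochner_Integration.integral_cnj)
    also have "\<dots> = cnj (CLINT x|M. iexp (- u * U x)) * cnj (CLINT x|M. g x)"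
      unfolding char by simp
    also have "cnj (CLINT x|M. iexp (- u * U x)) = (CLINT x|M. cnj (iexp (- u * U x)))"
      by (rule Bochner_Integration.integral_cnj[symmetric])
    also have "\<dots> = (CLINT x|M. iexp (u * U x))"
      by (intro Bochner_Integration.integral_cong refl) (simp only: cnj_iexp, simp)
    finally show ?thesis .
  qed
  have "(\<integral>x. indicator S (U x) * Re (g x) \<partial>M) = prob (U -` S \<inter> space M) * (\<integral>x. Re (g x) \<partial>M)"
  proof (rule integral_indicator_mult_of_char_real)
    show "\<bar>Re (g x)\<bar> \<le> C" for x using bound[of x] abs_Re_le_cmod[of "g x"] by linarith
    show "(CLINT x|M. iexp (u * U x) * complex_of_real (Re (g x))) =
      (CLINT x|M. iexp (u * U x)) * complex_of_real (\<integral>x. Re (g x) \<partial>M)" for u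
    proof -
      have "(CLINT x|M. iexp (u * U x) * complex_of_real (Re (g x))) =
          (CLINT x|M. (iexp (u * U x) * g x + iexp (u * U x) * cnj (g x)) / 2)"
        by (intro Bochner_Integration.integral_cong refl) (simp add: complex_add_cnj flip: distrib_left)
      also have "\<dots> = (CLINT x|M. iexp (u * U x)) * (((CLINT x|M. g x) + cnj (CLINT x|M. g x)) / 2)"
      proof -
        have "(CLINT x|M. (iexp (u * U x) * g x + iexp (u * U x) * cnj (g x)) / 2) =
            ((CLINT x|M. iexp (u * U x) * g x) + (CLINT x|M. iexp (u * U x) * cnj (g x))) / 2"
          using iug[of u] iug'[of u] by simp
        thus ?thesis unfolding char char' by (simp add: algebra_simps)
      qed
      also have "((CLINT x|M. g x) + cnj (CLINT x|M. g x)) / 2 = complex_of_real (\<integral>x. Re (g x) \<partial>M)"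
        using ig by (simp add: complex_add_cnj integral_Re)
      finally show ?thesis .
    qed
  qed measurable
  moreover have "(\<integral>x. indicator S (U x) * Im (g x) \<partial>M) = prob (U -` S \<inter> space M) * (\<integral>x. Im (g x) \<partial>M)"
  proof (rule integral_indicator_mult_of_char_real)
    show "\<bar>Im (g x)\<bar> \<le> C" for x using bound[of x] abs_Im_le_cmod[of "g x"] by linarith
    show "(CLINT x|M. iexp (u * U x) * complex_of_real (Im (g x))) =
      (CLINT x|M. iexp (u * U x)) * complex_of_real (\<integral>x. Im (g x) \<partial>M)" for u
    proof -
      have "(CLINT x|M. iexp (u * U x) * complex_of_real (Im (g x))) =
          (CLINT x|M. (iexp (u * U x) * g x - iexp (u * U x) * cnj (g x)) / (2 * \<i>))"
      proof (intro Bochner_Integration.integral_cong refl)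
        fix x
        have "complex_of_real (Im (g x)) = (g x - cnj (g x)) / (2 * \<i>)"
          by (subst nonzero_eq_divide_eq) (simp_all add: complex_diff_cnj)
        thus "iexp (u * U x) * complex_of_real (Im (g x)) =
            (iexp (u * U x) * g x - iexp (u * U x) * cnj (g x)) / (2 * \<i>)"
          by (simp only: times_divide_eq_right right_diff_distrib)
      qed
      also have "\<dots> = (CLINT x|M. iexp (u * U x)) * (((CLINT x|M. g x) - cnj (CLINT x|M. g x)) / (2 * \<i>))"
      proof -
        have "(CLINT x|M. (iexp (u * U x) * g x - iexp (u * U x) * cnj (g x)) / (2 * \<i>)) =
            ((CLINT x|M. iexp (u * U x) * g x) - (CLINT x|M. iexp (u * U x) * cnj (g x))) / (2 * \<i>)"
          using iug[of u] iug'[of u] by simp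
        thus ?thesis unfolding char char' by (simp add: algebra_simps)
      qed
      also have "((CLINT x|M. g x) - cnj (CLINT x|M. g x)) / (2 * \<i>) = complex_of_real (\<integral>x. Im (g x) \<partial>M)"
        using ig by (subst nonzero_divide_eq_eq) (simp_all add: complex_diff_cnj integral_Im)
      finally show ?thesis .
    qed
  qed measurable
  moreover have "Re (CLINT x|M. indicator S (U x) * g x) = (\<integral>x. indicator S (U x) * Re (g x) \<partial>M)"
    unfolding integral_Re[OF isg, symmetric]
    by (intro Bochner_Integration.integral_cong) (auto simp: indicator_def)
  moreover have "Im (CLINT x|M. indicator S (U x) * g x) = (\<integral>x. indicator S (U x) * Im (g x) \<partial>M)"
    unfolding integral_Im[OF isg, symmetric]
    by (intro Bochner_Integration.integral_cong) (auto simp: indicator_def)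
  ultimately show ?thesis
    using ig by (intro complex_eqI) (simp_all add: integral_Re integral_Im)
qed

text \<open>Kac's criterion. Exponentials are traded for indicators one index at a time, so the
  auxiliary claim \<open>key\<close> carries indicators over \<open>A\<close> and exponentials over
  a disjoint set \<open>K\<close>, with \<open>K\<close> and \<open>u\<close> free in the
  induction.\<close>

lemma (in prob_space) indep_vars_of_char:
  fixes e :: "'i \<Rightarrow> 'a \<Rightarrow> real"
  assumes meas: "\<And>j. j \<in> J \<Longrightarrow> e j \<in> borel_measurable M"
    and char: "\<And>K u. finite K \<Longrightarrow> K \<subseteq> J \<Longrightarrow>
      (CLINT x|M. iexp (\<Sum>j\<in>K. u j * e j x)) = (\<Prod>j\<in>K. CLINT x|M. iexp (u j * e j x))"
  shows "indep_vars (\<lambda>_. borel) e J"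
proof -
  have key: "(CLINT x|M. (\<Prod>j\<in>A. indicator (S j) (e j x)) * iexp (\<Sum>j\<in>K. u j * e j x)) =
      (\<Prod>j\<in>A. complex_of_real (prob (e j -` S j \<inter> space M))) * (\<Prod>j\<in>K. CLINT x|M. iexp (u j * e j x))"
    if "finite A" "A \<subseteq> J" "\<And>j. j \<in> A \<Longrightarrow> S j \<in> sets borel" "finite K" "K \<subseteq> J" "A \<inter> K = {}" for A K S u
    using that
  proof (induction A arbitrary: K u rule: finite_induct)
    case empty
    thus ?case by (simp only: prod.empty mult_1 char)
  next
    case (insert a A)
    have [measurable]: "e a \<in> borel_measurable M" "S a \<in> sets borel"
      using meas insert.prems by auto
    have m: "e j \<in> borel_measurable M" if "j \<in> A \<union> K" for j using meas insert.prems that by blast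
    define g where "g x = (\<Prod>j\<in>A. indicator (S j) (e j x)) * iexp (\<Sum>j\<in>K. u j * e j x)" for x
    have [measurable]: "g \<in> borel_measurable M"
    proof -
      have "(\<lambda>x. \<Prod>j\<in>A. indicator (S j) (e j x) :: complex) \<in> borel_measurable M"
      proof (rule borel_measurable_prod)
        fix j assume j: "j \<in> A"
        have [measurable]: "e j \<in> borel_measurable M" "S j \<in> sets borel"
          using m insert.prems j by auto
        show "(\<lambda>x. indicator (S j) (e j x) :: complex) \<in> borel_measurable M" by measurable
      qed
      moreover have "(\<lambda>x. \<Sum>j\<in>K. u j * e j x) \<in> borel_measurable M"
        using m by (intro borel_measurable_sum borel_measurable_times) auto
      ultimately show ?thesis unfolding g_def by measurable
    qed
    have g1: "cmod (g x) \<le> 1" for x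
      unfolding g_def by (auto simp: norm_mult prod_norm[symmetric] indicator_def intro!: prod_le_1)
    have IH: "(CLINT x|M. g x) =
      (\<Prod>j\<in>A. complex_of_real (prob (e j -` S j \<inter> space M))) * (\<Prod>j\<in>K. CLINT x|M. iexp (u j * e j x))"
      unfolding g_def using insert.prems by (intro insert.IH) auto
    have "(CLINT x|M. indicator (S a) (e a x) * g x) =
        complex_of_real (prob (e a -` S a \<inter> space M)) * (CLINT x|M. g x)"
    proof (rule integral_indicator_mult_of_char[OF _ _ g1])
      fix t :: real
      \<comment> \<open>The extra exponential in \<open>e a\<close> is absorbed by enlarging
        \<open>K\<close> to \<open>insert a K\<close>, where the induction hypothesis for
        \<open>A\<close> applies.\<close>
      define v where "v = u(a := t)"
      have aK: "a \<notin> K" using insert.prems by auto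
      have "(CLINT x|M. iexp (t * e a x) * g x) =
          (CLINT x|M. (\<Prod>j\<in>A. indicator (S j) (e j x)) * iexp (\<Sum>j\<in>insert a K. v j * e j x))"
      proof (intro Bochner_Integration.integral_cong refl)
        fix x
        have "(\<Sum>j\<in>insert a K. v j * e j x) = t * e a x + (\<Sum>j\<in>K. u j * e j x)"
          using aK \<open>finite K\<close> by (auto simp: v_def intro!: sum.cong)
        thus "iexp (t * e a x) * g x = (\<Prod>j\<in>A. indicator (S j) (e j x)) * iexp (\<Sum>j\<in>insert a K. v j * e j x)"
          by (simp add: g_def exp_add distrib_left)
      qed
      also have "\<dots> = (\<Prod>j\<in>A. complex_of_real (prob (e j -` S j \<inter> space M))) *
          (\<Prod>j\<in>insert a K. CLINT x|M. iexp (v j * e j x))"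
        using insert.prems insert.hyps by (intro insert.IH) auto
      also have "(\<Prod>j\<in>insert a K. CLINT x|M. iexp (v j * e j x)) =
          (CLINT x|M. iexp (t * e a x)) * (\<Prod>j\<in>K. CLINT x|M. iexp (u j * e j x))"
      proof -
        have "(\<Prod>j\<in>K. CLINT x|M. iexp (v j * e j x)) = (\<Prod>j\<in>K. CLINT x|M. iexp (u j * e j x))"
          using aK by (intro prod.cong) (auto simp: v_def)
        thus ?thesis using aK \<open>finite K\<close> by (simp add: v_def)
      qed
      finally show "(CLINT x|M. iexp (t * e a x) * g x) = (CLINT x|M. iexp (t * e a x)) * (CLINT x|M. g x)"
        unfolding IH by (simp only: mult_ac)
    qed measurable
    thus ?case unfolding IH unfolding g_def
      by (simp only: prod.insert[OF insert.hyps] mult.assoc)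
  qed
  show ?thesis unfolding indep_vars_def2
  proof (intro conjI ballI indep_setsI)
    fix j assume "j \<in> J" thus "random_variable borel (e j)" by (rule meas)
  next
    fix j assume "j \<in> J" thus "{e j -` A \<inter> space M |A. A \<in> sets borel} \<subseteq> events"
      using meas by auto
  next
    fix B and K :: "'i set"
    assume K: "K \<noteq> {}" "K \<subseteq> J" "finite K" and B: "\<forall>j\<in>K. B j \<in> {e j -` A \<inter> space M |A. A \<in> sets borel}"
    then obtain S where S: "\<And>j. j \<in> K \<Longrightarrow> S j \<in> sets borel" "\<And>j. j \<in> K \<Longrightarrow> B j = e j -` S j \<inter> space M"
      by (simp add: Bex_def) metis
    have ev: "(\<Inter>j\<in>K. B j) \<in> events"
      using K S measurable_sets[OF meas] by (intro sets.finite_INT) auto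
    have "complex_of_real (prob (\<Inter>j\<in>K. B j)) = complex_of_real (\<integral>x. indicator (\<Inter>j\<in>K. B j) x \<partial>M)"
      using sets.sets_into_space[OF ev] by (simp add: Int_absorb2)
    also have "\<dots> = (CLINT x|M. complex_of_real (indicator (\<Inter>j\<in>K. B j) x))"
      by (rule integral_complex_of_real[symmetric])
    \<comment> \<open>The empty sum contributes the factor 1 and brings the integral into the shape
      of \<open>key\<close> with an empty set of exponentials.\<close>
    also have "\<dots> = (CLINT x|M. (\<Prod>j\<in>K. indicator (S j) (e j x)) * iexp (\<Sum>j\<in>{}. 0 * e j x))"
    proof (intro Bochner_Integration.integral_cong refl)
      fix x assume x: "x \<in> space M"
      show "complex_of_real (indicator (\<Inter>j\<in>K. B j) x) = (\<Prod>j\<in>K. indicator (S j) (e j x)) * iexp (\<Sum>j\<in>{}. 0 * e j x)"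
      proof (cases "\<forall>j\<in>K. e j x \<in> S j")
        case True
        thus ?thesis using x S by (auto simp: indicator_def)
      next
        case False
        then obtain j where "j \<in> K" "e j x \<notin> S j" by auto
        thus ?thesis using S K by (auto simp: indicator_def)
      qed
    qed
    also have "\<dots> = (\<Prod>j\<in>K. complex_of_real (prob (e j -` S j \<inter> space M))) * (\<Prod>j\<in>{}. CLINT x|M. iexp (0 * e j x))"
      using K S by (intro key) auto
    also have "\<dots> = complex_of_real (\<Prod>j\<in>K. prob (B j))"
      using S by simp
    finally show "prob (\<Inter>j\<in>K. B j) = (\<Prod>j\<in>K. prob (B j))"
      by (simp only: of_real_eq_iff)
  qed
qed

section \<open>Quadratic forms of the second chaos\<close>

text \<open>The form of the theorem with a free weight \<open>Z\<close>, since it is also needed for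
  the approximants of \<open>Y\<close>, the partial sums of its expansion and the remainder.\<close>

definition wform :: "'a measure \<Rightarrow> ('a \<Rightarrow> real) \<Rightarrow> ('a \<Rightarrow> real) \<Rightarrow> ('a \<Rightarrow> real) \<Rightarrow> real" where
  "wform M Z \<xi> \<eta> = (1/2) * integral\<^sup>L M (\<lambda>\<omega>. Z \<omega> * \<xi> \<omega> * \<eta> \<omega>)"

lemma wform_sym: "wform M Z a b = wform M Z b a"
  by (simp add: wform_def mult_ac)

lemma sqint_tendsto_square:
  assumes f: "\<And>n. f n \<in> sqint M" and g: "g \<in> sqint M"
    and lim: "(\<lambda>n. \<integral>x. (f n x - g x)\<^sup>2 \<partial>M) \<longlonglongrightarrow> 0"
  shows "(\<lambda>n. \<integral>x. (f n x)\<^sup>2 \<partial>M) \<longlonglongrightarrow> (\<integral>x. (g x)\<^sup>2 \<partial>M)"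
proof -
  have eq: "(\<integral>x. (f n x)\<^sup>2 \<partial>M) = (\<integral>x. (f n x - g x)\<^sup>2 \<partial>M) + 2 * (\<integral>x. f n x * g x \<partial>M) - (\<integral>x. (g x)\<^sup>2 \<partial>M)" for n
  proof -
    have "(\<integral>x. (f n x)\<^sup>2 \<partial>M) = (\<integral>x. (f n x - g x)\<^sup>2 + 2 * (f n x * g x) - (g x)\<^sup>2 \<partial>M)"
      by (intro Bochner_Integration.integral_cong) (auto simp: power2_eq_square algebra_simps)
    thus ?thesis
      using sqint_square[OF sqint_diff[OF f g], of n] sqint_mult_integrable[OF f g, of n] sqint_square[OF g] by simp
  qed
  have "(\<lambda>n. (\<integral>x. (f n x - g x)\<^sup>2 \<partial>M) + 2 * (\<integral>x. f n x * g x \<partial>M) - (\<integral>x. (g x)\<^sup>2 \<partial>M))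
      \<longlonglongrightarrow> 0 + 2 * (\<integral>x. g x * g x \<partial>M) - (\<integral>x. (g x)\<^sup>2 \<partial>M)"
    by (intro tendsto_intros lim sqint_tendsto_inner[OF f g g lim])
  thus ?thesis unfolding eq by (simp add: power2_eq_square)
qed

context gaussian_space
begin

lemma wform_integrable:
  assumes "Z \<in> sqint M" "a \<in> H" "b \<in> H"
  shows "integrable M (\<lambda>x. Z x * a x * b x)"
  using sqint_mult_integrable[OF assms(1) H_mult_sqint[OF assms(2,3)]] by (simp add: mult.assoc)

text \<open>The norm of the form is at most the norm of its weight, so mean square approximation of
  the weight approximates the form uniformly on bounded sets.\<close>

lemma wform_bound:
  assumes "Z \<in> sqint M" "a \<in> H" "b \<in> H"
  shows "(wform M Z a b)\<^sup>2 \<le> (\<integral>x. (Z x)\<^sup>2 \<partial>M) * ((\<integral>x. (a x)\<^sup>2 \<partial>M) * (\<integral>x. (b x)\<^sup>2 \<partial>M))"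
proof -
  have "(wform M Z a b)\<^sup>2 = (1/4) * (\<integral>x. Z x * (a x * b x) \<partial>M)\<^sup>2"
    by (simp add: wform_def power2_eq_square mult.assoc)
  also have "\<dots> \<le> (1/4) * ((\<integral>x. (Z x)\<^sup>2 \<partial>M) * (\<integral>x. (a x * b x)\<^sup>2 \<partial>M))"
    using sqint_Cauchy_Schwarz[OF assms(1) H_mult_sqint[OF assms(2,3)]] by simp
  \<comment> \<open>Rounding the 3 of \<open>H_mult_square_le\<close> up to 4 cancels the square of
    the factor 1/2.\<close>
  also have "\<dots> \<le> (1/4) * ((\<integral>x. (Z x)\<^sup>2 \<partial>M) * (4 * ((\<integral>x. (a x)\<^sup>2 \<partial>M) * (\<integral>x. (b x)\<^sup>2 \<partial>M))))"
  proof -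
    have "0 \<le> (\<integral>x. (a x)\<^sup>2 \<partial>M) * (\<integral>x. (b x)\<^sup>2 \<partial>M)" by (intro mult_nonneg_nonneg) auto
    hence "(\<integral>x. (a x * b x)\<^sup>2 \<partial>M) \<le> 4 * ((\<integral>x. (a x)\<^sup>2 \<partial>M) * (\<integral>x. (b x)\<^sup>2 \<partial>M))"
      using H_mult_square_le[OF assms(2,3)] by linarith
    thus ?thesis by (intro mult_left_mono) auto
  qed
  finally show ?thesis by simp
qed

lemma wform_quadratic:
  assumes Z: "Z \<in> sqint M" and H: "a \<in> H" "b \<in> H"
  shows "wform M Z (\<lambda>x. a x + t * b x) (\<lambda>x. a x + t * b x) =
    wform M Z a a + 2 * t * wform M Z a b + t\<^sup>2 * wform M Z b b"
proof -
  have "(\<integral>x. Z x * (a x + t * b x) * (a x + t * b x) \<partial>M) =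
    (\<integral>x. Z x * a x * a x + 2 * t * (Z x * a x * b x) + t\<^sup>2 * (Z x * b x * b x) \<partial>M)"
    by (intro Bochner_Integration.integral_cong) (auto simp: power2_eq_square algebra_simps)
  also have "\<dots> = (\<integral>x. Z x * a x * a x \<partial>M) + 2 * t * (\<integral>x. Z x * a x * b x \<partial>M) + t\<^sup>2 * (\<integral>x. Z x * b x * b x \<partial>M)"
    using wform_integrable[OF Z] H by simp
  finally show ?thesis unfolding wform_def by (simp add: algebra_simps)
qed

lemma inner_quadratic:
  assumes H: "a \<in> H" "b \<in> H"
  shows "(\<integral>x. (a x + t * b x)\<^sup>2 \<partial>M) =
    (\<integral>x. (a x)\<^sup>2 \<partial>M) + 2 * t * (\<integral>x. a x * b x \<partial>M) + t\<^sup>2 * (\<integral>x. (b x)\<^sup>2 \<partial>M)"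
proof -
  have "(\<integral>x. (a x + t * b x)\<^sup>2 \<partial>M) = (\<integral>x. (a x)\<^sup>2 + 2 * t * (a x * b x) + t\<^sup>2 * (b x)\<^sup>2 \<partial>M)"
    by (intro Bochner_Integration.integral_cong) (auto simp: power2_eq_square algebra_simps)
  thus ?thesis using H_mult_integrable[OF H] H_moments(1) H by simp
qed

lemma wform_scale:
  "wform M Z (\<lambda>x. t * a x) (\<lambda>x. t * a x) = t\<^sup>2 * wform M Z a a"
proof -
  have "(\<integral>x. Z x * (t * a x) * (t * a x) \<partial>M) = (\<integral>x. t\<^sup>2 * (Z x * a x * a x) \<partial>M)"
    by (intro Bochner_Integration.integral_cong) (auto simp: power2_eq_square algebra_simps)
  thus ?thesis by (simp add: wform_def)
qed

lemma wform_diff_weight: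
  assumes "Z \<in> sqint M" "Z' \<in> sqint M" "a \<in> H" "b \<in> H"
  shows "wform M (\<lambda>x. Z x - Z' x) a b = wform M Z a b - wform M Z' a b"
  using wform_integrable assms by (simp add: wform_def algebra_simps)

text \<open>The arguments enter only through their inner products with the finitely many
  \<open>a i\<close> and \<open>b i\<close>. This finite rank is the source of compactness.\<close>

lemma wform_span:
  assumes "\<And>i. i < n \<Longrightarrow> a i \<in> H" "\<And>i. i < n \<Longrightarrow> b i \<in> H" "\<xi> \<in> H" "\<eta> \<in> H"
  shows "wform M (\<lambda>\<omega>. \<Sum>i<n::nat. c i * wick2 M (a i) (b i) \<omega>) \<xi> \<eta> =
    (\<Sum>i<n. c i * (((\<integral>x. a i x * \<xi> x \<partial>M) * (\<integral>x. b i x * \<eta> x \<partial>M)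
      + (\<integral>x. a i x * \<eta> x \<partial>M) * (\<integral>x. b i x * \<xi> x \<partial>M)) / 2))"
proof -
  have int: "integrable M (\<lambda>\<omega>. wick2 M (a i) (b i) \<omega> * (\<xi> \<omega> * \<eta> \<omega>))" if "i < n" for i
    using assms that by (intro sqint_mult_integrable wick2_sqint H_mult_sqint) auto
  have "wform M (\<lambda>\<omega>. \<Sum>i<n. c i * wick2 M (a i) (b i) \<omega>) \<xi> \<eta> =
    (1/2) * (\<integral>\<omega>. (\<Sum>i<n. c i * (wick2 M (a i) (b i) \<omega> * (\<xi> \<omega> * \<eta> \<omega>))) \<partial>M)"
    by (simp add: wform_def sum_distrib_right mult.assoc)
  also have "\<dots> = (1/2) * (\<Sum>i<n. c i * (\<integral>\<omega>. wick2 M (a i) (b i) \<omega> * (\<xi> \<omega> * \<eta> \<omega>) \<partial>M))"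
    using int by (subst Bochner_Integration.integral_sum) auto
  also have "\<dots> = (1/2) * (\<Sum>i<n. c i * ((\<integral>x. a i x * \<xi> x \<partial>M) * (\<integral>x. b i x * \<eta> x \<partial>M)
      + (\<integral>x. a i x * \<eta> x \<partial>M) * (\<integral>x. b i x * \<xi> x \<partial>M)))"
    using assms by (simp add: wick2_inner)
  finally show ?thesis by (simp add: sum_distrib_left)
qed

lemma wform_tendsto:
  assumes Z: "Z \<in> sqint M" and y: "\<And>n. y n \<in> H" and \<xi>: "\<xi> \<in> H"
    and lim: "(\<lambda>n. \<integral>x. (y n x - \<xi> x)\<^sup>2 \<partial>M) \<longlonglongrightarrow> 0"
  shows "(\<lambda>n. wform M Z (y n) (y n)) \<longlonglongrightarrow> wform M Z \<xi> \<xi>"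
proof -
  define D where "D n x = y n x - \<xi> x" for n x
  have D: "D n \<in> H" for n unfolding D_def by (intro H_diff y \<xi>)
  have lim: "(\<lambda>n. \<integral>x. (D n x)\<^sup>2 \<partial>M) \<longlonglongrightarrow> 0" using lim by (simp add: D_def)
  have "(\<lambda>n. (wform M Z (D n) (D n))\<^sup>2) \<longlonglongrightarrow> 0"
  proof (rule tendsto_sandwich[OF _ _ tendsto_const])
    show "\<forall>\<^sub>F n in sequentially. (wform M Z (D n) (D n))\<^sup>2
        \<le> (\<integral>x. (Z x)\<^sup>2 \<partial>M) * ((\<integral>x. (D n x)\<^sup>2 \<partial>M) * (\<integral>x. (D n x)\<^sup>2 \<partial>M))"
      using wform_bound[OF Z D D] by auto
    show "(\<lambda>n. (\<integral>x. (Z x)\<^sup>2 \<partial>M) * ((\<integral>x. (D n x)\<^sup>2 \<partial>M) * (\<integral>x. (D n x)\<^sup>2 \<partial>M))) \<longlonglongrightarrow> 0"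
      by (rule tendsto_eq_intros lim refl)+ simp
  qed auto
  hence 1: "(\<lambda>n. wform M Z (D n) (D n)) \<longlonglongrightarrow> 0" by (simp add: power_tendsto_0_iff)
  have "(\<lambda>n. (wform M Z (D n) \<xi>)\<^sup>2) \<longlonglongrightarrow> 0"
  proof (rule tendsto_sandwich[OF _ _ tendsto_const])
    show "\<forall>\<^sub>F n in sequentially. (wform M Z (D n) \<xi>)\<^sup>2
        \<le> (\<integral>x. (Z x)\<^sup>2 \<partial>M) * ((\<integral>x. (D n x)\<^sup>2 \<partial>M) * (\<integral>x. (\<xi> x)\<^sup>2 \<partial>M))"
      using wform_bound[OF Z D \<xi>] by auto
    show "(\<lambda>n. (\<integral>x. (Z x)\<^sup>2 \<partial>M) * ((\<integral>x. (D n x)\<^sup>2 \<partial>M) * (\<integral>x. (\<xi> x)\<^sup>2 \<partial>M))) \<longlonglongrightarrow> 0"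
      by (rule tendsto_eq_intros lim refl)+ simp
  qed auto
  hence 2: "(\<lambda>n. wform M Z (D n) \<xi>) \<longlonglongrightarrow> 0" by (simp add: power_tendsto_0_iff)
  have "wform M Z (y n) (y n) = wform M Z (D n) (D n) + 2 * wform M Z (D n) \<xi> + wform M Z \<xi> \<xi>" for n
    using wform_quadratic[OF Z D \<xi>, of n 1] by (simp add: D_def)
  moreover have "(\<lambda>n. wform M Z (D n) (D n) + 2 * wform M Z (D n) \<xi> + wform M Z \<xi> \<xi>)
      \<longlonglongrightarrow> 0 + 2 * 0 + wform M Z \<xi> \<xi>"
    by (intro tendsto_intros 1 2)
  ultimately show ?thesis by simp
qed

end

section \<open>Compactness and the existence of an eigenvector\<close>

text \<open>Tychonoff's theorem in place of a diagonal argument: the product of the intervals is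
  compact, and countability of the index type makes the product metrizable, hence sequentially
  compact.\<close>

lemma bounded_coordinates_convergent_subseq:
  fixes x :: "nat \<Rightarrow> 'i::countable \<Rightarrow> real"
  assumes "\<And>n p. \<bar>x n p\<bar> \<le> C p"
  shows "\<exists>r l. strict_mono (r :: nat \<Rightarrow> nat) \<and> (\<forall>p. (\<lambda>n. x (r n) p) \<longlonglongrightarrow> l p)"
proof -
  have "compact (PiE UNIV (\<lambda>p. {- C p..C p}))"
    unfolding compactin_euclidean_iff[symmetric] euclidean_product_topology[symmetric] compactin_PiE by simp
  moreover have "x n \<in> PiE UNIV (\<lambda>p. {- C p..C p})" for n
    using assms[of n] by (auto simp: abs_le_iff) (metis minus_le_iff)
  ultimately obtain l r where r: "strict_mono (r :: nat \<Rightarrow> nat)" "(x \<circ> r) \<longlonglongrightarrow> l"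
    unfolding compact_eq_seq_compact_metric seq_compact_def by metis
  have "(\<lambda>n. x (r n) p) \<longlonglongrightarrow> l p" for p
    using continuous_on_tendsto_compose[OF continuous_on_product_coordinates[of p] r(2)] by (simp add: o_def)
  thus ?thesis using r(1) by blast
qed

text \<open>The form of an element of the second chaos is a norm limit of finite rank forms. So a
  maximizing sequence of unit vectors, refined until all inner products occurring in the
  approximants converge, is Cauchy, and its limit is an eigenvector for the supremum.\<close>

lemma (in gaussian_space) wform_eigenvector_exists:
  assumes ZC: "Z \<in> wick_chaos2 M H"
    and pos: "\<And>\<xi>. \<xi> \<in> H \<Longrightarrow> 0 \<le> wform M Z \<xi> \<xi>"
    and nz: "\<xi>0 \<in> H" "wform M Z \<xi>0 \<xi>0 > 0"
  obtains \<mu> \<xi> where "\<mu> > 0" "\<xi> \<in> H" "(\<integral>x. (\<xi> x)\<^sup>2 \<partial>M) = 1"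
    "\<And>\<eta>. \<eta> \<in> H \<Longrightarrow> wform M Z \<xi> \<eta> = \<mu> * (\<integral>x. \<xi> x * \<eta> x \<partial>M)"
proof -
  have Z: "Z \<in> sqint M" using wick_chaos2_sqint[OF ZC] .
  define C where "C = (\<integral>x. (Z x)\<^sup>2 \<partial>M)"
  define S where "S = {wform M Z \<xi> \<xi> | \<xi>. \<xi> \<in> H \<and> (\<integral>x. (\<xi> x)\<^sup>2 \<partial>M) = 1}"
  have wle: "(wform M Z \<xi> \<xi>)\<^sup>2 \<le> C * (\<integral>x. (\<xi> x)\<^sup>2 \<partial>M)\<^sup>2" if "\<xi> \<in> H" for \<xi>
    using wform_bound[OF Z that that] by (simp add: C_def power2_eq_square)
  have Sle: "s \<le> C + 1" if "s \<in> S" for s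
  proof -
    have "s\<^sup>2 \<le> C" using that wle by (force simp: S_def)
    moreover have "2 * s \<le> s\<^sup>2 + 1" using sum_squares_bound[of s 1] by simp
    ultimately show ?thesis using zero_le_power2[of s] by linarith
  qed
  have bdd: "bdd_above S" using Sle by (rule bdd_aboveI)
  have wnorm: "wform M Z \<eta> \<eta> / (\<integral>x. (\<eta> x)\<^sup>2 \<partial>M) \<in> S" if \<eta>: "\<eta> \<in> H" "(\<integral>x. (\<eta> x)\<^sup>2 \<partial>M) > 0" for \<eta>
  proof -
    define t where "t = 1 / sqrt (\<integral>x. (\<eta> x)\<^sup>2 \<partial>M)"
    have t2: "t\<^sup>2 = 1 / (\<integral>x. (\<eta> x)\<^sup>2 \<partial>M)" using \<eta> by (simp add: t_def power_divide)
    have "(\<integral>x. (t * \<eta> x)\<^sup>2 \<partial>M) = 1" using t2 \<eta> by (simp add: power_mult_distrib)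
    moreover have "wform M Z (\<lambda>x. t * \<eta> x) (\<lambda>x. t * \<eta> x) = wform M Z \<eta> \<eta> / (\<integral>x. (\<eta> x)\<^sup>2 \<partial>M)"
      unfolding wform_scale t2 by simp
    ultimately show ?thesis unfolding S_def using H_scale[OF \<eta>(1), of t] by force
  qed
  have wzero: "wform M Z \<eta> \<eta> = 0" if "\<eta> \<in> H" "(\<integral>x. (\<eta> x)\<^sup>2 \<partial>M) = 0" for \<eta>
    using wle[OF that(1)] that(2) by simp
  have n0: "(\<integral>x. (\<xi>0 x)\<^sup>2 \<partial>M) > 0"
    using wzero[OF nz(1)] nz(2) by (metis integral_nonneg_AE AE_I2 less_eq_real_def zero_le_power2)
  define \<mu> where "\<mu> = Sup S"
  have "0 < wform M Z \<xi>0 \<xi>0 / (\<integral>x. (\<xi>0 x)\<^sup>2 \<partial>M)" using n0 nz by simp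
  also have "\<dots> \<le> \<mu>" unfolding \<mu>_def by (rule cSup_upper[OF wnorm[OF nz(1) n0] bdd])
  finally have \<mu>: "\<mu> > 0" .
  have ne: "S \<noteq> {}" using wnorm[OF nz(1) n0] by auto
  \<comment> \<open>Nonnegative on \<open>H\<close> because \<open>\<mu>\<close> is the supremum,
    and zero at a maximizer. Cauchy-Schwarz for \<open>G\<close> turns such a zero into an
    eigenvector, and its parallelogram law controls differences of near maximizers.\<close>
  define G where "G a = \<mu> * (\<integral>x. (a x)\<^sup>2 \<partial>M) - wform M Z a a" for a
  have Gpos: "G \<eta> \<ge> 0" if \<eta>: "\<eta> \<in> H" for \<eta>
  proof (cases "(\<integral>x. (\<eta> x)\<^sup>2 \<partial>M) = 0")
    case True
    thus ?thesis using wzero[OF \<eta>] by (simp add: G_def)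
  next
    case False
    hence p: "(\<integral>x. (\<eta> x)\<^sup>2 \<partial>M) > 0" by (simp add: less_le)
    have "wform M Z \<eta> \<eta> / (\<integral>x. (\<eta> x)\<^sup>2 \<partial>M) \<le> \<mu>"
      unfolding \<mu>_def by (rule cSup_upper[OF wnorm[OF \<eta> p] bdd])
    thus ?thesis using p by (simp add: G_def field_simps)
  qed
  have Gquad: "G (\<lambda>x. a x + t * b x) = G a + 2 * t * (\<mu> * (\<integral>x. a x * b x \<partial>M) - wform M Z a b) + t\<^sup>2 * G b"
    if "a \<in> H" "b \<in> H" for a b t
    unfolding G_def wform_quadratic[OF Z that] inner_quadratic[OF that] by (simp add: algebra_simps)
  have "\<exists>\<xi>. \<xi> \<in> H \<and> (\<integral>x. (\<xi> x)\<^sup>2 \<partial>M) = 1 \<and> wform M Z \<xi> \<xi> > \<mu> - 1 / Suc n" for n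
  proof -
    have "\<mu> - 1 / Suc n < Sup S" by (simp add: \<mu>_def)
    thus ?thesis using less_cSup_iff[OF ne bdd] by (auto simp: S_def)
  qed
  then obtain \<zeta> where \<zeta>: "\<And>n. \<zeta> n \<in> H" "\<And>n. (\<integral>x. (\<zeta> n x)\<^sup>2 \<partial>M) = 1"
    and \<zeta>w: "\<And>n. wform M Z (\<zeta> n) (\<zeta> n) > \<mu> - 1 / Suc n" by metis
  have \<zeta>G: "G (\<zeta> n) \<le> 1 / Suc n" for n using \<zeta>w[of n] \<zeta>(2)[of n] by (simp add: G_def)
  obtain f where f: "\<And>k. f k \<in> wick2_span M H" and fZ: "(\<lambda>k. \<integral>x. (f k x - Z x)\<^sup>2 \<partial>M) \<longlonglongrightarrow> 0"
    using ZC by (auto simp: wick_chaos2_def L2_conv_def)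
  have "\<forall>k. \<exists>(n::nat) c a b. (\<forall>i<n. a i \<in> H \<and> b i \<in> H) \<and> f k = (\<lambda>\<omega>. \<Sum>i<n. c i * wick2 M (a i) (b i) \<omega>)"
    using f by (simp add: wick2_span_def)
  hence "\<exists>(nn :: nat \<Rightarrow> nat) c a b. \<forall>k. (\<forall>i<nn k. a k i \<in> H \<and> b k i \<in> H) \<and>
      f k = (\<lambda>\<omega>. \<Sum>i<nn k. c k i * wick2 M (a k i) (b k i) \<omega>)"
    by (simp only: choice_iff)
  then obtain nn :: "nat \<Rightarrow> nat" and c a b where ab: "\<And>k i. i < nn k \<Longrightarrow> a k i \<in> H" "\<And>k i. i < nn k \<Longrightarrow> b k i \<in> H"
    and fk: "\<And>k. f k = (\<lambda>\<omega>. \<Sum>i<nn k. c k i * wick2 M (a k i) (b k i) \<omega>)" by blast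
  define v :: "nat \<times> nat \<times> bool \<Rightarrow> 'a \<Rightarrow> real" where
    "v p = (case p of (k, i, s) \<Rightarrow> if i < nn k then (if s then a k i else b k i) else (\<lambda>_. 0))" for p
  have v: "v p \<in> H" for p using ab H_zero by (auto simp: v_def split: prod.splits)
  define x where "x n p = (\<integral>\<omega>. v p \<omega> * \<zeta> n \<omega> \<partial>M)" for n p
  have "\<bar>x n p\<bar> \<le> (\<integral>\<omega>. (v p \<omega>)\<^sup>2 \<partial>M) + 1" for n p
  proof -
    have "(x n p)\<^sup>2 \<le> (\<integral>\<omega>. (v p \<omega>)\<^sup>2 \<partial>M)"
      using sqint_Cauchy_Schwarz[OF H_sqint[OF v] H_sqint[OF \<zeta>(1)], of p n] \<zeta>(2)[of n] by (simp add: x_def)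
    moreover have "2 * \<bar>x n p\<bar> \<le> (x n p)\<^sup>2 + 1" using sum_squares_bound[of "\<bar>x n p\<bar>" 1] by simp
    ultimately show ?thesis using zero_le_power2[of "x n p"] by linarith
  qed
  then obtain r l where r: "strict_mono (r :: nat \<Rightarrow> nat)" and l: "\<And>p. (\<lambda>n. x (r n) p) \<longlonglongrightarrow> l p"
    using bounded_coordinates_convergent_subseq[of x "\<lambda>p. (\<integral>\<omega>. (v p \<omega>)\<^sup>2 \<partial>M) + 1"] by auto
  define y where "y n = \<zeta> (r n)" for n
  have y: "y n \<in> H" and y1: "(\<integral>x. (y n x)\<^sup>2 \<partial>M) = 1" for n using \<zeta> by (auto simp: y_def)
  have yG: "G (y n) \<le> 1 / Suc n" for n
  proof -
    have "G (y n) \<le> 1 / Suc (r n)" unfolding y_def by (rule \<zeta>G)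
    also have "\<dots> \<le> 1 / Suc n" using seq_suble[OF r, of n] by (intro divide_left_mono) auto
    finally show ?thesis .
  qed
  define D where "D n m x = y n x - y m x" for n m x
  have D: "D n m \<in> H" for n m unfolding D_def by (intro H_diff y)
  have Dsum: "(\<lambda>x. y n x + y m x) \<in> H" for n m by (intro H_add y)
  have D4: "(\<integral>x. (D n m x)\<^sup>2 \<partial>M) \<le> 4" for n m
  proof -
    have "(\<integral>x. (D n m x)\<^sup>2 \<partial>M) + (\<integral>x. (y n x + y m x)\<^sup>2 \<partial>M) = 4"
      using inner_quadratic[OF y y, of n 1 m] inner_quadratic[OF y y, of n "-1" m] y1 by (simp add: D_def)
    moreover have "(\<integral>x. (y n x + y m x)\<^sup>2 \<partial>M) \<ge> 0" by simp
    ultimately show ?thesis by linarith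
  qed
  \<comment> \<open>Parallelogram law for \<open>G\<close>; the value at the sum is nonnegative and
    may be dropped.\<close>
  have GD: "G (D n m) \<le> 2 / Suc n + 2 / Suc m" for n m
  proof -
    have "G (D n m) + G (\<lambda>x. y n x + y m x) = 2 * G (y n) + 2 * G (y m)"
      using Gquad[OF y y, of n 1 m] Gquad[OF y y, of n "-1" m] by (simp add: D_def[abs_def])
    thus ?thesis using Gpos[OF Dsum[of n m]] yG[of n] yG[of m] by simp
  qed
  have cau: "\<exists>K. \<forall>n\<ge>K. \<forall>m\<ge>K. (\<integral>x. (y n x - y m x)\<^sup>2 \<partial>M) < \<epsilon>" if \<epsilon>: "\<epsilon> > 0" for \<epsilon>
  proof -
    \<comment> \<open>Three errors of size at most \<open>\<delta>\<close> are added: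
      \<open>G\<close> at the difference, the finite rank form, and the distance of that form from
      the form of \<open>Z\<close>. So 3/4 of \<open>\<mu> * \<epsilon>\<close> is used. The 16 in
      the choice of \<open>k\<close> compensates for the two factors 4 from
      \<open>D4\<close>.\<close>
    define \<delta> where "\<delta> = \<mu> * \<epsilon> / 4"
    have \<delta>: "\<delta> > 0" using \<mu> \<epsilon> by (simp add: \<delta>_def)
    have "\<forall>\<^sub>F k in sequentially. (\<integral>x. (f k x - Z x)\<^sup>2 \<partial>M) < \<delta>\<^sup>2 / 16"
      using fZ \<delta> by (intro order_tendstoD(2)[OF fZ]) auto
    then obtain k where k: "(\<integral>x. (f k x - Z x)\<^sup>2 \<partial>M) < \<delta>\<^sup>2 / 16"
      by (auto simp: eventually_sequentially)
    have fs: "f k \<in> sqint M" by (rule wick2_span_sqint[OF f])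
    have fZw: "\<bar>wform M (f k) (D n m) (D n m) - wform M Z (D n m) (D n m)\<bar> \<le> \<delta>" for n m
    proof -
      have "(wform M (f k) (D n m) (D n m) - wform M Z (D n m) (D n m))\<^sup>2
          \<le> (\<integral>x. (f k x - Z x)\<^sup>2 \<partial>M) * ((\<integral>x. (D n m x)\<^sup>2 \<partial>M) * (\<integral>x. (D n m x)\<^sup>2 \<partial>M))"
        using wform_bound[OF sqint_diff[OF fs Z] D D, of n m n m] wform_diff_weight[OF fs Z D D, of n m n m] by simp
      also have "\<dots> \<le> \<delta>\<^sup>2 / 16 * (4 * 4)"
        using k D4 by (intro mult_mono) auto
      finally have "\<bar>wform M (f k) (D n m) (D n m) - wform M Z (D n m) (D n m)\<bar>\<^sup>2 \<le> \<delta>\<^sup>2" by simp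
      thus ?thesis by (rule power2_le_imp_le) (use \<delta> in simp)
    qed
    \<comment> \<open>The finite rank form at \<open>D n m\<close>, written in coordinates. Taking
      the pair as one argument permits a limit along the product filter, and there the limit is 0
      since both indices give the same limiting coordinates.\<close>
    define R where "R q = (\<Sum>i<nn k. c k i * ((x (r (fst q)) (k,i,True) - x (r (snd q)) (k,i,True))
        * (x (r (fst q)) (k,i,False) - x (r (snd q)) (k,i,False))))" for q :: "nat \<times> nat"
    have inner: "(\<integral>\<omega>. v p \<omega> * D n m \<omega> \<partial>M) = x (r n) p - x (r m) p" for p n m
      unfolding x_def D_def y_def[symmetric]
      using H_mult_integrable[OF v y] by (simp add: right_diff_distrib)
    have wR: "wform M (f k) (D n m) (D n m) = R (n, m)" for n m
    proof -
      have eq: "a k i = v (k,i,True)" "b k i = v (k,i,False)" if "i < nn k" for i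
        using that by (auto simp: v_def)
      have "wform M (f k) (D n m) (D n m) = (\<Sum>i<nn k. c k i * ((\<integral>x. a k i x * D n m x \<partial>M) * (\<integral>x. b k i x * D n m x \<partial>M)))"
        unfolding fk by (subst wform_span) (use ab D in auto)
      also have "\<dots> = R (n, m)" unfolding R_def
        by (intro sum.cong refl) (simp add: eq inner)
      finally show ?thesis .
    qed
    have fst: "((\<lambda>q. x (r (fst q)) p) \<longlongrightarrow> l p) (sequentially \<times>\<^sub>F sequentially)" for p
      by (rule filterlim_compose[OF l filterlim_fst])
    have snd: "((\<lambda>q. x (r (snd q)) p) \<longlongrightarrow> l p) (sequentially \<times>\<^sub>F sequentially)" for p
      by (rule filterlim_compose[OF l filterlim_snd])
    have "(R \<longlongrightarrow> (\<Sum>i<nn k. c k i * ((l (k,i,True) - l (k,i,True)) * (l (k,i,False) - l (k,i,False)))))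
        (sequentially \<times>\<^sub>F sequentially)"
      unfolding R_def[abs_def] by (intro tendsto_intros fst snd)
    hence "(R \<longlongrightarrow> 0) (sequentially \<times>\<^sub>F sequentially)" by simp
    hence "\<forall>\<^sub>F q in sequentially \<times>\<^sub>F sequentially. R q < \<delta>" using \<delta> by (rule order_tendstoD(2))
    then obtain K1 where K1: "\<And>n m. n \<ge> K1 \<Longrightarrow> m \<ge> K1 \<Longrightarrow> R (n, m) < \<delta>"
      unfolding eventually_prod_sequentially by blast
    obtain K2 :: nat where K2: "4 / \<delta> < K2" using reals_Archimedean2 by blast
    have small: "2 / Suc n < \<delta> / 2" if "n \<ge> K2" for n
    proof -
      have "4 / \<delta> < Suc n" using K2 that by linarith
      thus ?thesis using \<delta> by (simp add: field_simps)
    qed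
    have "(\<integral>x. (y n x - y m x)\<^sup>2 \<partial>M) < \<epsilon>" if nm: "n \<ge> max K1 K2" "m \<ge> max K1 K2" for n m
    proof -
      have "\<mu> * (\<integral>x. (D n m x)\<^sup>2 \<partial>M) = G (D n m) + wform M Z (D n m) (D n m)" by (simp add: G_def)
      also have "\<dots> < \<delta> + (\<delta> + \<delta>)"
        using GD[of n m] small[of n] small[of m] fZw[of n m] K1[of n m] nm unfolding wR by linarith
      also have "\<dots> < \<mu> * \<epsilon>" using \<mu> \<epsilon> by (simp add: \<delta>_def)
      finally show ?thesis using \<mu> by (simp add: D_def)
    qed
    thus ?thesis by blast
  qed
  obtain \<xi> where \<xi>s: "\<xi> \<in> sqint M" and lim: "(\<lambda>n. \<integral>x. (y n x - \<xi> x)\<^sup>2 \<partial>M) \<longlonglongrightarrow> 0"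
    using sqint_complete[OF H_sqint[OF y] cau] by blast
  have \<xi>: "\<xi> \<in> H" by (rule H_closed[OF y \<xi>s lim])
  have "(\<lambda>n. \<integral>x. (y n x)\<^sup>2 \<partial>M) \<longlonglongrightarrow> (\<integral>x. (\<xi> x)\<^sup>2 \<partial>M)"
    by (rule sqint_tendsto_square[OF H_sqint[OF y] \<xi>s lim])
  hence \<xi>1: "(\<integral>x. (\<xi> x)\<^sup>2 \<partial>M) = 1" unfolding y1 by (simp add: LIMSEQ_const_iff)
  have "(\<lambda>n. G (y n)) \<longlonglongrightarrow> G \<xi>"
    unfolding G_def y1 \<xi>1 by (intro tendsto_intros wform_tendsto[OF Z y \<xi> lim])
  moreover have "(\<lambda>n. 1 / Suc n) \<longlonglongrightarrow> (0::real)" using LIMSEQ_inverse_real_of_nat by (simp add: inverse_eq_divide)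
  ultimately have "G \<xi> \<le> 0" using yG by (intro LIMSEQ_le) auto
  hence G0: "G \<xi> = 0" using Gpos[OF \<xi>] by simp
  have "wform M Z \<xi> \<eta> = \<mu> * (\<integral>x. \<xi> x * \<eta> x \<partial>M)" if \<eta>: "\<eta> \<in> H" for \<eta>
  proof -
    have "(\<mu> * (\<integral>x. \<xi> x * \<eta> x \<partial>M) - wform M Z \<xi> \<eta>)\<^sup>2 \<le> G \<xi> * G \<eta>"
    proof (rule square_le_mult_of_quadratic_nonneg)
      fix t
      show "0 \<le> G \<xi> + 2 * t * (\<mu> * (\<integral>x. \<xi> x * \<eta> x \<partial>M) - wform M Z \<xi> \<eta>) + t\<^sup>2 * G \<eta>"
        unfolding Gquad[OF \<xi> \<eta>, symmetric] by (intro Gpos H_add H_scale \<xi> \<eta>)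
    qed
    thus ?thesis by (simp add: G0)
  qed
  thus ?thesis using that \<mu> \<xi> \<xi>1 by blast
qed

section \<open>Spectral expansion in the second chaos\<close>

context gaussian_space
begin

lemma wick2_span_add_term:
  assumes f: "f \<in> wick2_span M H" and "\<xi> \<in> H" "\<eta> \<in> H"
  shows "(\<lambda>\<omega>. f \<omega> + t * wick2 M \<xi> \<eta> \<omega>) \<in> wick2_span M H"
proof -
  obtain n c a b where ab: "\<forall>i<n. a i \<in> H \<and> b i \<in> H"
    and f: "f = (\<lambda>\<omega>. \<Sum>i<n::nat. c i * wick2 M (a i) (b i) \<omega>)"
    using f unfolding wick2_span_def by blast
  have "(\<lambda>\<omega>. f \<omega> + t * wick2 M \<xi> \<eta> \<omega>) =
      (\<lambda>\<omega>. \<Sum>i<Suc n. (c(n := t)) i * wick2 M ((a(n := \<xi>)) i) ((b(n := \<eta>)) i) \<omega>)"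
    unfolding f by (auto intro!: sum.cong)
  moreover have "\<forall>i<Suc n. (a(n := \<xi>)) i \<in> H \<and> (b(n := \<eta>)) i \<in> H"
    using ab assms by (auto simp: less_Suc_eq)
  ultimately show ?thesis unfolding wick2_span_def by blast
qed

lemma wick2_span_add_sum:
  assumes "finite A" "f \<in> wick2_span M H" "\<And>j. j \<in> A \<Longrightarrow> \<xi> j \<in> H" "\<And>j. j \<in> A \<Longrightarrow> \<eta> j \<in> H"
  shows "(\<lambda>\<omega>. f \<omega> + (\<Sum>j\<in>A. c j * wick2 M (\<xi> j) (\<eta> j) \<omega>)) \<in> wick2_span M H"
  using assms
proof (induction A rule: finite_induct)
  case (insert j A)
  have "(\<lambda>\<omega>. (f \<omega> + (\<Sum>j\<in>A. c j * wick2 M (\<xi> j) (\<eta> j) \<omega>)) + c j * wick2 M (\<xi> j) (\<eta> j) \<omega>) \<in> wick2_span M H"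
    using insert by (intro wick2_span_add_term) auto
  thus ?case using insert by (simp add: add_ac)
qed auto

text \<open>Against \<open>Z\<close>, a Wick product of \<open>a\<close> and \<open>b\<close>
  integrates to twice the form at \<open>a\<close>, \<open>b\<close> minus a multiple of the mean of
  \<open>Z\<close>. This makes a remainder with vanishing form orthogonal to the whole
  chaos.\<close>

lemma wick2_span_inner:
  assumes "g \<in> wick2_span M H" "Z \<in> sqint M" "(\<integral>x. Z x \<partial>M) = 0"
    "\<And>a b. a \<in> H \<Longrightarrow> b \<in> H \<Longrightarrow> wform M Z a b = 0"
  shows "(\<integral>x. g x * Z x \<partial>M) = 0"
proof -
  obtain n c a b where ab: "\<And>i. i < n \<Longrightarrow> a i \<in> H" "\<And>i. i < n \<Longrightarrow> b i \<in> H"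
    and g: "g = (\<lambda>\<omega>. \<Sum>i<n::nat. c i * wick2 M (a i) (b i) \<omega>)"
    using assms(1) unfolding wick2_span_def by blast
  have 0: "(\<integral>x. wick2 M (a i) (b i) x * Z x \<partial>M) = 0" if i: "i < n" for i
  proof -
    have "(\<integral>x. wick2 M (a i) (b i) x * Z x \<partial>M) = (\<integral>x. Z x * a i x * b i x - (\<integral>x. a i x * b i x \<partial>M) * Z x \<partial>M)"
      by (simp add: wick2_def algebra_simps)
    also have "\<dots> = 0"
      using wform_integrable[OF assms(2) ab[OF i]] sqint_integrable[OF assms(2)] assms(3,4) ab[OF i]
      by (simp add: wform_def)
    finally show ?thesis .
  qed
  have "(\<integral>x. g x * Z x \<partial>M) = (\<integral>x. (\<Sum>i<n. c i * (wick2 M (a i) (b i) x * Z x)) \<partial>M)"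
    by (simp add: g sum_distrib_right mult.assoc)
  also have "\<dots> = (\<Sum>i<n. c i * (\<integral>x. wick2 M (a i) (b i) x * Z x \<partial>M))"
    using ab assms(2) by (subst Bochner_Integration.integral_sum) (auto intro!: integrable_mult_right sqint_mult_integrable wick2_sqint)
  finally show ?thesis by (simp add: 0)
qed

text \<open>Expectation is the inner product with 1, hence stable under mean square limits.\<close>

lemma wick_chaos2_expectation:
  assumes "Y \<in> wick_chaos2 M H"
  shows "(\<integral>x. Y x \<partial>M) = 0"
proof -
  obtain f where f: "\<And>k. f k \<in> wick2_span M H" and fY: "(\<lambda>k. \<integral>x. (f k x - Y x)\<^sup>2 \<partial>M) \<longlonglongrightarrow> 0"
    using assms by (auto simp: wick_chaos2_def L2_conv_def)
  have "(\<integral>x. f k x \<partial>M) = 0" for k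
  proof -
    obtain n c a b where ab: "\<And>i. i < n \<Longrightarrow> a i \<in> H" "\<And>i. i < n \<Longrightarrow> b i \<in> H"
      and g: "f k = (\<lambda>\<omega>. \<Sum>i<n::nat. c i * wick2 M (a i) (b i) \<omega>)"
      using f[of k] unfolding wick2_span_def by blast
    show ?thesis unfolding g using ab
      by (subst Bochner_Integration.integral_sum) (auto simp: wick2_expectation intro!: sqint_integrable wick2_sqint)
  qed
  moreover have "(\<lambda>k. \<integral>x. f k x * 1 \<partial>M) \<longlonglongrightarrow> (\<integral>x. Y x * 1 \<partial>M)"
    by (rule sqint_tendsto_inner[OF wick2_span_sqint[OF f] wick_chaos2_sqint[OF assms] sqint_const fY])
  ultimately show ?thesis by (simp add: LIMSEQ_const_iff)
qed

text \<open>If the remainder \<open>Z\<close> of the expansion were non-zero, the maximal eigenvector of its form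
  would be orthogonal to all \<open>e j\<close> and hence an eigenvector of the form of \<open>Y\<close> not in
  their span.\<close>

lemma wick_chaos2_expansion:
  fixes J :: "nat set" and lam :: "nat \<Rightarrow> real"
  assumes YC: "Y \<in> wick_chaos2 M H"
    and pos: "\<And>\<xi>. \<xi> \<in> H \<Longrightarrow> 0 \<le> wform M Y \<xi> \<xi>"
    and e: "\<And>j. j \<in> J \<Longrightarrow> e j \<in> H"
    and eig: "\<And>j \<eta>. j \<in> J \<Longrightarrow> \<eta> \<in> H \<Longrightarrow> wform M Y (e j) \<eta> = lam j * (\<integral>x. e j x * \<eta> x \<partial>M)"
    and orth: "\<And>i j. i \<in> J \<Longrightarrow> j \<in> J \<Longrightarrow> (\<integral>x. e i x * e j x \<partial>M) = (if i = j then 1 else 0)"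
    and span: "\<And>c \<xi>. c \<noteq> 0 \<Longrightarrow> \<xi> \<in> H \<Longrightarrow> (\<And>\<eta>. \<eta> \<in> H \<Longrightarrow> wform M Y \<xi> \<eta> = c * (\<integral>x. \<xi> x * \<eta> x \<partial>M)) \<Longrightarrow>
      AE \<omega> in M. \<xi> \<omega> = (\<Sum>j\<in>{j\<in>J. lam j = c}. (\<integral>x. \<xi> x * e j x \<partial>M) * e j \<omega>)"
  shows "(\<lambda>m. \<integral>x. ((\<Sum>j\<in>{j\<in>J. j < m}. lam j * ((e j x)\<^sup>2 - 1)) - Y x)\<^sup>2 \<partial>M) \<longlonglongrightarrow> 0"
proof -
  have Y: "Y \<in> sqint M" by (rule wick_chaos2_sqint[OF YC])
  have Y0: "(\<integral>x. Y x \<partial>M) = 0" by (rule wick_chaos2_expectation[OF YC])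
  define w where "w j = wick2 M (e j) (e j)" for j
  have w_eq: "w j x = (e j x)\<^sup>2 - 1" if "j \<in> J" for j x
    using orth[OF that that] by (simp add: w_def wick2_def power2_eq_square)
  have ws: "w j \<in> sqint M" if "j \<in> J" for j unfolding w_def using that e by (intro wick2_sqint) auto
  \<comment> \<open>In the second factor \<open>(e j)\<^sup>2 - 1\<close> the constant drops out
    because \<open>w i\<close> has mean zero, and \<open>wick2_inner\<close> handles the
    rest.\<close>
  have winner: "(\<integral>x. w i x * w j x \<partial>M) = (if i = j then 2 else 0)" if ij: "i \<in> J" "j \<in> J" for i j
  proof -
    have "(\<integral>x. w i x * w j x \<partial>M) = (\<integral>x. wick2 M (e i) (e i) x * (e j x * e j x) - wick2 M (e i) (e i) x \<partial>M)"
      unfolding w_eq[OF ij(2)] by (simp add: w_def power2_eq_square right_diff_distrib)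
    also have "\<dots> = (\<integral>x. wick2 M (e i) (e i) x * (e j x * e j x) \<partial>M) - (\<integral>x. wick2 M (e i) (e i) x \<partial>M)"
      using ij e by (intro Bochner_Integration.integral_diff sqint_mult_integrable sqint_integrable wick2_sqint H_mult_sqint) auto
    also have "\<dots> = (if i = j then 2 else 0)"
      using ij e orth[OF ij] by (simp add: wick2_inner wick2_expectation)
    finally show ?thesis .
  qed
  have Yw: "(\<integral>x. Y x * w j x \<partial>M) = 2 * lam j" if j: "j \<in> J" for j
  proof -
    have "(\<integral>x. Y x * w j x \<partial>M) = (\<integral>x. Y x * e j x * e j x - Y x \<partial>M)"
      unfolding w_eq[OF j] by (simp add: power2_eq_square right_diff_distrib mult.assoc)
    also have "\<dots> = 2 * wform M Y (e j) (e j)"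
      using wform_integrable[OF Y e[OF j] e[OF j]] sqint_integrable[OF Y] by (simp add: wform_def Y0)
    finally show ?thesis using eig[OF j e[OF j]] orth[OF j j] by simp
  qed
  define Q where "Q A x = (\<Sum>j\<in>A. lam j * w j x)" for A x
  have Qs: "Q A \<in> sqint M" if "A \<subseteq> J" for A
    unfolding Q_def using that ws by (intro sqint_sum sqint_scale) auto
  have Qnorm: "(\<integral>x. (Q A x)\<^sup>2 \<partial>M) = 2 * (\<Sum>j\<in>A. (lam j)\<^sup>2)" if A: "finite A" "A \<subseteq> J" for A
  proof -
    have "(\<integral>x. (Q A x)\<^sup>2 \<partial>M) = (\<integral>x. (\<Sum>i\<in>A. \<Sum>j\<in>A. lam i * lam j * (w i x * w j x)) \<partial>M)"
      by (simp add: Q_def power2_eq_square sum_product algebra_simps)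
    also have "\<dots> = (\<Sum>i\<in>A. \<Sum>j\<in>A. lam i * lam j * (\<integral>x. w i x * w j x \<partial>M))"
    proof -
      have "integrable M (\<lambda>x. w i x * w j x)" if "i \<in> A" "j \<in> A" for i j
        using ws A that by (intro sqint_mult_integrable) auto
      thus ?thesis by (simp add: Bochner_Integration.integral_sum Bochner_Integration.integrable_sum)
    qed
    also have "\<dots> = (\<Sum>i\<in>A. \<Sum>j\<in>A. if i = j then 2 * (lam i)\<^sup>2 else 0)"
      using A by (intro sum.cong refl) (auto simp: winner power2_eq_square subset_iff)
    also have "\<dots> = 2 * (\<Sum>j\<in>A. (lam j)\<^sup>2)"
      using A by (simp add: sum_distrib_left)
    finally show ?thesis .
  qed
  \<comment> \<open>The coefficient of \<open>Y\<close> along \<open>w j\<close> is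
    \<open>2 * lam j / 2\<close>, so \<open>Q A\<close> is the orthogonal projection of
    \<open>Y\<close> onto the \<open>w j\<close> with \<open>j\<close> in \<open>A\<close>, and
    Bessel's inequality bounds the squares of the eigenvalues.\<close>
  have bessel: "(\<Sum>j\<in>A. (lam j)\<^sup>2) \<le> (\<integral>x. (Y x)\<^sup>2 \<partial>M)" if A: "finite A" "A \<subseteq> J" for A
  proof -
    have "(\<integral>x. Y x * Q A x \<partial>M) = (\<integral>x. (\<Sum>j\<in>A. lam j * (Y x * w j x)) \<partial>M)"
      by (simp add: Q_def sum_distrib_left mult_ac)
    also have "\<dots> = (\<Sum>j\<in>A. lam j * (\<integral>x. Y x * w j x \<partial>M))"
      using A ws Y by (subst Bochner_Integration.integral_sum) (auto intro!: integrable_mult_right sqint_mult_integrable)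
    also have "\<dots> = 2 * (\<Sum>j\<in>A. (lam j)\<^sup>2)"
      using A by (simp add: Yw subset_iff sum_distrib_left power2_eq_square mult_ac)
    finally have YQ: "(\<integral>x. Y x * Q A x \<partial>M) = 2 * (\<Sum>j\<in>A. (lam j)\<^sup>2)" .
    have "0 \<le> (\<integral>x. (Y x - Q A x)\<^sup>2 \<partial>M)" by simp
    also have "\<dots> = (\<integral>x. (Y x)\<^sup>2 - 2 * (Y x * Q A x) + (Q A x)\<^sup>2 \<partial>M)"
      by (simp add: power2_eq_square algebra_simps)
    also have "\<dots> = (\<integral>x. (Y x)\<^sup>2 \<partial>M) - 2 * (\<integral>x. Y x * Q A x \<partial>M) + (\<integral>x. (Q A x)\<^sup>2 \<partial>M)"
      using sqint_square[OF Y] sqint_square[OF Qs[OF A(2)]] sqint_mult_integrable[OF Y Qs[OF A(2)]] by simp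
    also have "\<dots> = (\<integral>x. (Y x)\<^sup>2 \<partial>M) - 2 * (\<Sum>j\<in>A. (lam j)\<^sup>2)"
      unfolding YQ Qnorm[OF A] by simp
    finally show ?thesis using sum_nonneg[of A "\<lambda>j. (lam j)\<^sup>2"] by simp
  qed
  define Jn where "Jn m = {j\<in>J. j < m}" for m :: nat
  have Jn: "finite (Jn m)" "Jn m \<subseteq> J" for m by (auto simp: Jn_def)
  have Jmono: "Jn m \<subseteq> Jn n" if "m \<le> n" for m n using that by (auto simp: Jn_def)
  define s where "s m = (\<Sum>j\<in>Jn m. (lam j)\<^sup>2)" for m
  have "incseq s"
    unfolding s_def incseq_def by (intro allI impI sum_mono2 Jn Jmono) auto
  moreover have "s m \<le> (\<integral>x. (Y x)\<^sup>2 \<partial>M)" for m unfolding s_def by (rule bessel[OF Jn])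
  ultimately have "convergent s"
    by (metis incseq_convergent convergent_def)
  hence scau: "Cauchy s" by (simp add: convergent_eq_Cauchy[symmetric] convergent_def)
  have Qdiff: "(\<integral>x. (Q (Jn m) x - Q (Jn n) x)\<^sup>2 \<partial>M) = 2 * \<bar>s m - s n\<bar>" for m n
  proof -
    have *: "(\<integral>x. (Q (Jn n) x - Q (Jn m) x)\<^sup>2 \<partial>M) = 2 * (s n - s m)" if "m \<le> n" for m n
    proof -
      have "Q (Jn n) x - Q (Jn m) x = Q (Jn n - Jn m) x" for x
        unfolding Q_def by (rule sum_diff[OF Jn(1) Jmono[OF that], symmetric])
      hence "(\<integral>x. (Q (Jn n) x - Q (Jn m) x)\<^sup>2 \<partial>M) = 2 * (\<Sum>j\<in>Jn n - Jn m. (lam j)\<^sup>2)"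
        using Jn Qnorm[of "Jn n - Jn m"] by auto
      thus ?thesis unfolding s_def by (simp add: sum_diff[OF Jn(1) Jmono[OF that]])
    qed
    have pos: "s m \<le> s n" if "m \<le> n" for m n
      using \<open>incseq s\<close> that by (auto simp: incseq_def)
    show ?thesis
    proof (cases "m \<le> n")
      case True
      thus ?thesis using *[OF True] pos[OF True] by (simp add: power2_commute)
    next
      case False
      thus ?thesis using *[of n m] pos[of n m] by simp
    qed
  qed
  have "\<exists>K. \<forall>m\<ge>K. \<forall>n\<ge>K. (\<integral>x. (Q (Jn m) x - Q (Jn n) x)\<^sup>2 \<partial>M) < \<epsilon>" if "\<epsilon> > 0" for \<epsilon>
  proof -
    obtain K where "\<forall>m\<ge>K. \<forall>n\<ge>K. norm (s m - s n) < \<epsilon> / 2"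
      using CauchyD[OF scau, of "\<epsilon>/2"] \<open>\<epsilon> > 0\<close> by auto
    thus ?thesis unfolding Qdiff by (intro exI[of _ K]) fastforce
  qed
  then obtain R where R: "R \<in> sqint M" and limR: "(\<lambda>m. \<integral>x. (Q (Jn m) x - R x)\<^sup>2 \<partial>M) \<longlonglongrightarrow> 0"
    using sqint_complete[of "\<lambda>m. Q (Jn m)"] Qs[OF Jn(2)] by blast
  define Z where "Z x = Y x - R x" for x
  have Z: "Z \<in> sqint M" unfolding Z_def using Y R by (rule sqint_diff)
  \<comment> \<open>The approximants of \<open>Y\<close> and the partial sums tending to
    \<open>R\<close> run with a common index, so their differences stay in the span and tend to
    \<open>Z\<close>.\<close>
  have ZC: "Z \<in> wick_chaos2 M H"
  proof -
    obtain f where f: "\<And>k. f k \<in> wick2_span M H" and fY: "(\<lambda>k. \<integral>x. (f k x - Y x)\<^sup>2 \<partial>M) \<longlonglongrightarrow> 0"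
      using YC by (auto simp: wick_chaos2_def L2_conv_def)
    have "(\<lambda>x. f k x + (\<Sum>j\<in>Jn k. (- lam j) * w j x)) \<in> wick2_span M H" for k
      unfolding w_def using Jn e by (intro wick2_span_add_sum f) auto
    hence g: "(\<lambda>x. f k x - Q (Jn k) x) \<in> wick2_span M H" for k
      by (simp add: Q_def sum_negf)
    have "(\<lambda>k. \<integral>x. ((f k x - Q (Jn k) x) - Z x)\<^sup>2 \<partial>M) \<longlonglongrightarrow> 0"
    proof (rule tendsto_sandwich[OF _ _ tendsto_const])
      show "\<forall>\<^sub>F k in sequentially. (\<integral>x. ((f k x - Q (Jn k) x) - Z x)\<^sup>2 \<partial>M)
          \<le> 2 * (\<integral>x. (f k x - Y x)\<^sup>2 \<partial>M) + 2 * (\<integral>x. (Q (Jn k) x - R x)\<^sup>2 \<partial>M)"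
      proof (intro always_eventually allI)
        fix k
        have "(\<integral>x. ((f k x - Q (Jn k) x) - Z x)\<^sup>2 \<partial>M) = (\<integral>x. ((f k x - Y x) + (R x - Q (Jn k) x))\<^sup>2 \<partial>M)"
          by (intro Bochner_Integration.integral_cong) (auto simp: Z_def algebra_simps)
        also have "\<dots> \<le> 2 * (\<integral>x. (f k x - Y x)\<^sup>2 \<partial>M) + 2 * (\<integral>x. (R x - Q (Jn k) x)\<^sup>2 \<partial>M)"
          by (intro sqint_sum_square_le sqint_diff wick2_span_sqint[OF f] Y R Qs Jn)
        finally show "(\<integral>x. ((f k x - Q (Jn k) x) - Z x)\<^sup>2 \<partial>M)
          \<le> 2 * (\<integral>x. (f k x - Y x)\<^sup>2 \<partial>M) + 2 * (\<integral>x. (Q (Jn k) x - R x)\<^sup>2 \<partial>M)"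
          by (simp add: power2_commute)
      qed
      show "(\<lambda>k. 2 * (\<integral>x. (f k x - Y x)\<^sup>2 \<partial>M) + 2 * (\<integral>x. (Q (Jn k) x - R x)\<^sup>2 \<partial>M)) \<longlonglongrightarrow> 0"
        by (rule tendsto_eq_intros fY limR refl)+ simp
    qed auto
    thus ?thesis using Z g unfolding wick_chaos2_def L2_conv_def sqint_def
      by (auto intro!: exI[of _ "\<lambda>k x. f k x - Q (Jn k) x"])
  qed
  have Z0: "(\<integral>x. Z x \<partial>M) = 0" by (rule wick_chaos2_expectation[OF ZC])
  have wQ: "wform M (Q A) \<xi> \<eta> = (\<Sum>j\<in>A. lam j * ((\<integral>x. e j x * \<xi> x \<partial>M) * (\<integral>x. e j x * \<eta> x \<partial>M)))"
    if A: "A \<subseteq> J" and \<xi>: "\<xi> \<in> H" and \<eta>: "\<eta> \<in> H" for A \<xi> \<eta>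
  proof -
    have "wform M (Q A) \<xi> \<eta> = (1/2) * (\<integral>x. (\<Sum>j\<in>A. lam j * (w j x * (\<xi> x * \<eta> x))) \<partial>M)"
      by (simp add: wform_def Q_def sum_distrib_right mult.assoc)
    also have "\<dots> = (1/2) * (\<Sum>j\<in>A. lam j * (\<integral>x. w j x * (\<xi> x * \<eta> x) \<partial>M))"
      using A ws \<xi> \<eta> by (subst Bochner_Integration.integral_sum) (auto intro!: integrable_mult_right sqint_mult_integrable H_mult_sqint)
    also have "(\<Sum>j\<in>A. lam j * (\<integral>x. w j x * (\<xi> x * \<eta> x) \<partial>M)) =
        (\<Sum>j\<in>A. lam j * (2 * ((\<integral>x. e j x * \<xi> x \<partial>M) * (\<integral>x. e j x * \<eta> x \<partial>M))))"
      using A e \<xi> \<eta> by (intro sum.cong refl) (auto simp: w_def wick2_inner subset_iff)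
    finally show ?thesis by (simp add: sum_distrib_left mult_ac)
  qed
  have limQ: "(\<lambda>m. wform M (Q (Jn m)) \<xi> \<eta>) \<longlonglongrightarrow> wform M R \<xi> \<eta>" if "\<xi> \<in> H" "\<eta> \<in> H" for \<xi> \<eta>
    unfolding wform_def mult.assoc
    by (intro tendsto_mult_left sqint_tendsto_inner[OF Qs R H_mult_sqint[OF that] limR] Jn)
  have wZ: "wform M Z \<xi> \<eta> = wform M Y \<xi> \<eta> - wform M R \<xi> \<eta>" if "\<xi> \<in> H" "\<eta> \<in> H" for \<xi> \<eta>
    unfolding Z_def by (rule wform_diff_weight[OF Y R that])
  have Zpos: "0 \<le> wform M Z \<xi> \<xi>" if \<xi>: "\<xi> \<in> H" for \<xi>
  proof -
    have "wform M (Q (Jn m)) \<xi> \<xi> \<le> wform M Y \<xi> \<xi>" for m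
    proof -
      \<comment> \<open>The projection of \<open>\<xi>\<close> onto finitely many eigenvectors. On
        it the form of \<open>Y\<close> agrees with that of \<open>Q (Jn m)\<close> at
        \<open>\<xi>\<close>, so nonnegativity of the form of \<open>Y\<close> at
        \<open>\<zeta> - \<xi>\<close> is exactly the wanted inequality.\<close>
      define \<zeta> where "\<zeta> x = (\<Sum>j\<in>Jn m. (\<integral>x. e j x * \<xi> x \<partial>M) * e j x)" for x
      have \<zeta>: "\<zeta> \<in> H" unfolding \<zeta>_def using Jn e by (intro H_sum H_scale) auto
      have w\<zeta>: "wform M Y \<zeta> \<eta> = (\<Sum>j\<in>Jn m. lam j * ((\<integral>x. e j x * \<xi> x \<partial>M) * (\<integral>x. e j x * \<eta> x \<partial>M)))"
        if \<eta>: "\<eta> \<in> H" for \<eta>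
      proof -
        have "wform M Y \<zeta> \<eta> = (1/2) * (\<integral>x. (\<Sum>j\<in>Jn m. (\<integral>x. e j x * \<xi> x \<partial>M) * (Y x * e j x * \<eta> x)) \<partial>M)"
          by (simp add: wform_def \<zeta>_def sum_distrib_right sum_distrib_left mult_ac)
        also have "\<dots> = (1/2) * (\<Sum>j\<in>Jn m. (\<integral>x. e j x * \<xi> x \<partial>M) * (\<integral>x. Y x * e j x * \<eta> x \<partial>M))"
          using Jn e \<eta> Y by (subst Bochner_Integration.integral_sum) (auto intro!: integrable_mult_right wform_integrable)
        also have "\<dots> = (\<Sum>j\<in>Jn m. (\<integral>x. e j x * \<xi> x \<partial>M) * wform M Y (e j) \<eta>)"
          by (simp add: wform_def sum_distrib_left mult_ac)
        also have "\<dots> = (\<Sum>j\<in>Jn m. lam j * ((\<integral>x. e j x * \<xi> x \<partial>M) * (\<integral>x. e j x * \<eta> x \<partial>M)))"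
          using Jn \<eta> by (intro sum.cong refl) (auto simp: eig subset_iff)
        finally show ?thesis .
      qed
      have e\<zeta>: "(\<integral>x. e i x * \<zeta> x \<partial>M) = (\<integral>x. e i x * \<xi> x \<partial>M)" if i: "i \<in> Jn m" for i
      proof -
        have iJ: "i \<in> J" using i Jn by auto
        have "(\<integral>x. e i x * \<zeta> x \<partial>M) = (\<integral>x. (\<Sum>j\<in>Jn m. (\<integral>x. e j x * \<xi> x \<partial>M) * (e i x * e j x)) \<partial>M)"
          by (simp add: \<zeta>_def sum_distrib_left mult_ac)
        also have "\<dots> = (\<Sum>j\<in>Jn m. (\<integral>x. e j x * \<xi> x \<partial>M) * (\<integral>x. e i x * e j x \<partial>M))"
          using Jn e iJ by (subst Bochner_Integration.integral_sum) (auto intro!: integrable_mult_right H_mult_integrable)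
        also have "\<dots> = (\<Sum>j\<in>Jn m. if i = j then (\<integral>x. e j x * \<xi> x \<partial>M) else 0)"
          using Jn iJ by (intro sum.cong refl) (auto simp: orth subset_iff)
        finally show ?thesis using Jn i by simp
      qed
      have "0 \<le> wform M Y (\<lambda>x. \<zeta> x + (-1) * \<xi> x) (\<lambda>x. \<zeta> x + (-1) * \<xi> x)"
        by (intro pos H_add H_scale \<zeta> \<xi>)
      also have "\<dots> = wform M Y \<zeta> \<zeta> - 2 * wform M Y \<zeta> \<xi> + wform M Y \<xi> \<xi>"
        by (subst wform_quadratic[OF Y \<zeta> \<xi>]) simp
      also have "wform M Y \<zeta> \<zeta> = wform M Y \<zeta> \<xi>"
        unfolding w\<zeta>[OF \<zeta>] w\<zeta>[OF \<xi>] using e\<zeta> by simp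
      finally show ?thesis unfolding wQ[OF Jn(2) \<xi> \<xi>] w\<zeta>[OF \<xi>] by simp
    qed
    hence "wform M R \<xi> \<xi> \<le> wform M Y \<xi> \<xi>"
      by (intro LIMSEQ_le_const2[OF limQ[OF \<xi> \<xi>]]) auto
    thus ?thesis by (simp add: wZ[OF \<xi> \<xi>])
  qed
  have eR: "wform M Z (e i) \<eta> = 0" if i: "i \<in> J" and \<eta>: "\<eta> \<in> H" for i \<eta>
  proof -
    \<comment> \<open>The index \<open>i\<close> belongs to \<open>Jn m\<close> as soon as
      \<open>i < m\<close>, and by orthonormality its term is the only one left.\<close>
    have "wform M (Q (Jn m)) (e i) \<eta> = lam i * (\<integral>x. e i x * \<eta> x \<partial>M)" if m: "m \<ge> Suc i" for m
    proof -
      have "wform M (Q (Jn m)) (e i) \<eta> = (\<Sum>j\<in>Jn m. if i = j then lam j * (\<integral>x. e j x * \<eta> x \<partial>M) else 0)"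
        unfolding wQ[OF Jn(2) e[OF i] \<eta>] using Jn i by (intro sum.cong refl) (auto simp: orth subset_iff)
      moreover have "i \<in> Jn m" using i m by (simp add: Jn_def)
      ultimately show ?thesis using Jn by simp
    qed
    hence "\<forall>\<^sub>F m in sequentially. wform M (Q (Jn m)) (e i) \<eta> = lam i * (\<integral>x. e i x * \<eta> x \<partial>M)"
      by (auto simp: eventually_sequentially)
    hence "(\<lambda>m. wform M (Q (Jn m)) (e i) \<eta>) \<longlonglongrightarrow> lam i * (\<integral>x. e i x * \<eta> x \<partial>M)"
      by (rule tendsto_eventually)
    hence "wform M R (e i) \<eta> = lam i * (\<integral>x. e i x * \<eta> x \<partial>M)"
      using LIMSEQ_unique[OF limQ[OF e[OF i] \<eta>]] by simp
    thus ?thesis by (simp add: wZ[OF e[OF i] \<eta>] eig[OF i \<eta>])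
  qed
  have Zzero: "wform M Z \<xi>0 \<xi>0 = 0" if \<xi>0: "\<xi>0 \<in> H" for \<xi>0
  proof (rule ccontr)
    assume "wform M Z \<xi>0 \<xi>0 \<noteq> 0"
    hence "wform M Z \<xi>0 \<xi>0 > 0" using Zpos[OF \<xi>0] by simp
    then obtain \<mu> \<xi> where \<mu>: "\<mu> > 0" and \<xi>: "\<xi> \<in> H" "(\<integral>x. (\<xi> x)\<^sup>2 \<partial>M) = 1"
      and ev: "\<And>\<eta>. \<eta> \<in> H \<Longrightarrow> wform M Z \<xi> \<eta> = \<mu> * (\<integral>x. \<xi> x * \<eta> x \<partial>M)"
      using wform_eigenvector_exists[OF ZC Zpos \<xi>0] by blast
    have orth\<xi>: "(\<integral>x. \<xi> x * e j x \<partial>M) = 0" if j: "j \<in> J" for j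
      using ev[OF e[OF j]] eR[OF j \<xi>(1)] \<mu> wform_sym[of M Z \<xi> "e j"] by simp
    have "wform M Y \<xi> \<eta> = \<mu> * (\<integral>x. \<xi> x * \<eta> x \<partial>M)" if \<eta>: "\<eta> \<in> H" for \<eta>
    proof -
      have "wform M (Q (Jn m)) \<xi> \<eta> = 0" for m
        unfolding wQ[OF Jn(2) \<xi>(1) \<eta>] using Jn orth\<xi> by (intro sum.neutral) (auto simp: mult.commute subset_iff)
      hence "wform M R \<xi> \<eta> = 0" using limQ[OF \<xi>(1) \<eta>] by (simp add: LIMSEQ_const_iff)
      thus ?thesis using ev[OF \<eta>] wZ[OF \<xi>(1) \<eta>] by simp
    qed
    hence "AE \<omega> in M. \<xi> \<omega> = (\<Sum>j\<in>{j\<in>J. lam j = \<mu>}. (\<integral>x. \<xi> x * e j x \<partial>M) * e j \<omega>)"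
      using \<mu> \<xi>(1) by (intro span) auto
    hence "AE \<omega> in M. (\<xi> \<omega>)\<^sup>2 = 0"
      by eventually_elim (simp add: orth\<xi>)
    hence "(\<integral>x. (\<xi> x)\<^sup>2 \<partial>M) = (\<integral>x. 0 \<partial>M)"
      using H_measurable[OF \<xi>(1)] by (intro integral_cong_AE) auto
    thus False using \<xi>(2) by simp
  qed
  have Zform: "wform M Z a b = 0" if ab: "a \<in> H" "b \<in> H" for a b
    using wform_quadratic[OF Z ab, of 1] Zzero[OF ab(1)] Zzero[OF ab(2)] Zzero[OF H_add[OF ab]] by simp
  \<comment> \<open>A vanishing form makes \<open>Z\<close> orthogonal to the span of the Wick
    products, and \<open>Z\<close> lies in the closure of that span, so it is orthogonal to
    itself.\<close>
  have ZZ: "(\<integral>x. (Z x)\<^sup>2 \<partial>M) = 0"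
  proof -
    obtain g where g: "\<And>k. g k \<in> wick2_span M H" and gZ: "(\<lambda>k. \<integral>x. (g k x - Z x)\<^sup>2 \<partial>M) \<longlonglongrightarrow> 0"
      using ZC by (auto simp: wick_chaos2_def L2_conv_def)
    have "(\<lambda>k. \<integral>x. g k x * Z x \<partial>M) \<longlonglongrightarrow> (\<integral>x. Z x * Z x \<partial>M)"
      by (rule sqint_tendsto_inner[OF wick2_span_sqint[OF g] Z Z gZ])
    moreover have "(\<integral>x. g k x * Z x \<partial>M) = 0" for k by (rule wick2_span_inner[OF g Z Z0 Zform])
    ultimately show ?thesis by (simp add: LIMSEQ_const_iff power2_eq_square)
  qed
  have "(\<lambda>m. \<integral>x. (Q (Jn m) x - Y x)\<^sup>2 \<partial>M) \<longlonglongrightarrow> 0"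
  proof (rule tendsto_sandwich[OF _ _ tendsto_const])
    show "\<forall>\<^sub>F m in sequentially. (\<integral>x. (Q (Jn m) x - Y x)\<^sup>2 \<partial>M) \<le> 2 * (\<integral>x. (Q (Jn m) x - R x)\<^sup>2 \<partial>M)"
    proof (intro always_eventually allI)
      fix m
      have "(\<integral>x. (Q (Jn m) x - Y x)\<^sup>2 \<partial>M) = (\<integral>x. ((Q (Jn m) x - R x) + (R x - Y x))\<^sup>2 \<partial>M)"
        by simp
      also have "\<dots> \<le> 2 * (\<integral>x. (Q (Jn m) x - R x)\<^sup>2 \<partial>M) + 2 * (\<integral>x. (R x - Y x)\<^sup>2 \<partial>M)"
        by (intro sqint_sum_square_le sqint_diff Y R Qs Jn)
      also have "(\<integral>x. (R x - Y x)\<^sup>2 \<partial>M) = 0" using ZZ by (simp add: Z_def power2_commute)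
      finally show "(\<integral>x. (Q (Jn m) x - Y x)\<^sup>2 \<partial>M) \<le> 2 * (\<integral>x. (Q (Jn m) x - R x)\<^sup>2 \<partial>M)" by simp
    qed
    show "(\<lambda>m. 2 * (\<integral>x. (Q (Jn m) x - R x)\<^sup>2 \<partial>M)) \<longlonglongrightarrow> 0"
      using tendsto_mult_left[OF limR, of 2] by simp
  qed auto
  moreover have "Q (Jn m) x = (\<Sum>j\<in>{j\<in>J. j < m}. lam j * ((e j x)\<^sup>2 - 1))" for m x
    unfolding Q_def Jn_def by (intro sum.cong refl) (auto simp: w_eq)
  ultimately show ?thesis by simp
qed

end

section \<open>Weighted sums of squares of independent standard normal variables\<close>

text \<open>Unit second moment excludes the degenerate alternative in
  \<open>centered_gaussian\<close> and forces the standard deviation to be 1.\<close>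

lemma (in gaussian_space) orthonormal_std_normal:
  assumes "\<xi> \<in> H" "(\<integral>x. (\<xi> x)\<^sup>2 \<partial>M) = 1"
  shows "distributed M lborel \<xi> std_normal_density"
  using H_gaussian[OF assms(1)] unfolding centered_gaussian_def
proof (elim conjE disjE exE)
  assume [measurable]: "\<xi> \<in> borel_measurable M" and "AE \<omega> in M. \<xi> \<omega> = 0"
  hence "(\<integral>x. (\<xi> x)\<^sup>2 \<partial>M) = (\<integral>x. 0 \<partial>M)"
    by (intro integral_cong_AE) auto
  thus ?thesis using assms by simp
next
  fix \<sigma> :: real assume \<sigma>: "\<sigma> > 0" and D: "distributed M lborel \<xi> (normal_density 0 \<sigma>)"
  have "\<sigma>\<^sup>2 = 1"
    using normal_distributed_variance[OF \<sigma> D] normal_distributed_expectation[OF \<sigma> D] assms by simp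
  hence "\<sigma> = 1" using \<sigma> by (simp add: power2_eq_1_iff)
  thus ?thesis using D by simp
qed

text \<open>Every finite linear combination lies in \<open>H\<close> and is therefore Gaussian.
  Orthonormality makes its variance the sum of the squared coefficients, so the exponential of the
  variance splits into the required factors.\<close>

lemma (in gaussian_space) orthonormal_indep:
  assumes e: "\<And>j. j \<in> J \<Longrightarrow> e j \<in> H"
    and orth: "\<And>i j. i \<in> J \<Longrightarrow> j \<in> J \<Longrightarrow> (\<integral>x. e i x * e j x \<partial>M) = (if i = j then 1 else 0)"
  shows "indep_vars (\<lambda>_. borel) e J"
proof (rule indep_vars_of_char)
  show "e j \<in> borel_measurable M" if "j \<in> J" for j using e that H_measurable by blast
next
  fix K u assume K: "finite K" "K \<subseteq> J"
  have "(\<integral>x. (\<Sum>j\<in>K. u j * e j x)\<^sup>2 \<partial>M) = (\<integral>x. (\<Sum>i\<in>K. \<Sum>j\<in>K. u i * u j * (e i x * e j x)) \<partial>M)"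
    by (simp add: power2_eq_square sum_product mult_ac)
  also have "\<dots> = (\<Sum>i\<in>K. \<Sum>j\<in>K. u i * u j * (\<integral>x. e i x * e j x \<partial>M))"
  proof -
    have "integrable M (\<lambda>x. e i x * e j x)" if "i \<in> K" "j \<in> K" for i j
      using e K that by (intro H_mult_integrable) auto
    thus ?thesis by (simp add: Bochner_Integration.integral_sum Bochner_Integration.integrable_sum)
  qed
  also have "\<dots> = (\<Sum>i\<in>K. \<Sum>j\<in>K. if i = j then (u i)\<^sup>2 else 0)"
    using K by (intro sum.cong refl) (auto simp: orth power2_eq_square subset_iff)
  also have "\<dots> = (\<Sum>j\<in>K. (u j)\<^sup>2)" using K by simp
  finally have var: "(\<integral>x. (\<Sum>j\<in>K. u j * e j x)\<^sup>2 \<partial>M) = (\<Sum>j\<in>K. (u j)\<^sup>2)" .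
  have "(\<lambda>x. \<Sum>j\<in>K. u j * e j x) \<in> H" using K e by (intro H_sum H_scale) auto
  from H_moments(4)[OF this]
  have "(CLINT x|M. iexp (\<Sum>j\<in>K. u j * e j x)) = complex_of_real (exp (\<Sum>j\<in>K. - (u j)\<^sup>2 / 2))"
    unfolding var by (simp only: sum_negf[symmetric] sum_divide_distrib)
  also have "\<dots> = (\<Prod>j\<in>K. complex_of_real (exp (- (u j)\<^sup>2 / 2)))"
    using K by (simp add: exp_sum)
  also have "\<dots> = (\<Prod>j\<in>K. CLINT x|M. iexp (u j * e j x))"
  proof (intro prod.cong refl)
    fix j assume "j \<in> K"
    hence j: "j \<in> J" using K by auto
    have "(\<integral>x. (u j * e j x)\<^sup>2 \<partial>M) = (u j)\<^sup>2"
      using orth[OF j j] by (simp add: power_mult_distrib flip: power2_eq_square)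
    thus "complex_of_real (exp (- (u j)\<^sup>2 / 2)) = (CLINT x|M. iexp (u j * e j x))"
      using H_moments(4)[OF H_scale[OF e[OF j], of "u j"]] by (simp only:)
  qed
  finally show "(CLINT x|M. iexp (\<Sum>j\<in>K. u j * e j x)) = (\<Prod>j\<in>K. CLINT x|M. iexp (u j * e j x))" .
qed

section \<open>Moments of a single standard normal variable\<close>

context prob_space
begin

lemma std_normal_measurable: "distributed M lborel \<xi> std_normal_density \<Longrightarrow> \<xi> \<in> borel_measurable M"
  using distributed_measurable[of M lborel \<xi>] by simp

lemma std_normal_square:
  assumes D: "distributed M lborel \<xi> std_normal_density"
  shows "integrable M (\<lambda>x. (\<xi> x)\<^sup>2)" "(\<integral>x. (\<xi> x)\<^sup>2 \<partial>M) = 1" "(\<lambda>x. (\<xi> x)\<^sup>2) \<in> sqint M"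
proof -
  note [measurable] = std_normal_measurable[OF D]
  have m2: "has_bochner_integral lborel (\<lambda>x. std_normal_density x * x\<^sup>2) 1"
    using std_normal_moment_even[of 1] by simp
  show "integrable M (\<lambda>x. (\<xi> x)\<^sup>2)"
    using distributed_integrable[OF D, of "\<lambda>x. x\<^sup>2"] m2 by (auto simp: has_bochner_integral_iff)
  show "(\<integral>x. (\<xi> x)\<^sup>2 \<partial>M) = 1"
    using distributed_integral[OF D, of "\<lambda>x. x\<^sup>2"] m2 by (auto simp: has_bochner_integral_iff)
  have "integrable M (\<lambda>x. \<xi> x ^ 4)"
    using distributed_integrable[OF D, of "\<lambda>x. x^4"] integrable_std_normal_moment[of 4] by simp
  thus "(\<lambda>x. (\<xi> x)\<^sup>2) \<in> sqint M" by (simp add: sqint_def)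
qed

text \<open>The density is positive everywhere, so a null event would make the interval Lebesgue
  null. Positivity is needed to divide by the probability of the localizing event in the trace
  bound.\<close>

lemma std_normal_near_zero:
  assumes D: "distributed M lborel \<xi> std_normal_density" and \<delta>: "\<delta> > 0"
  shows "(\<integral>x. indicator {-\<delta><..<\<delta>} (\<xi> x) \<partial>M) > (0::real)"
proof (rule ccontr)
  note [measurable] = std_normal_measurable[OF D]
  assume "\<not> ?thesis"
  hence "(\<integral>x. indicator {-\<delta><..<\<delta>} (\<xi> x) \<partial>M) = (0::real)"
    by (metis integral_nonneg_AE AE_I2 indicator_pos_le less_eq_real_def)
  moreover have "integrable M (\<lambda>x. indicator {-\<delta><..<\<delta>} (\<xi> x) :: real)"
    by (intro integrable_const_bound[of _ 1]) auto
  ultimately have "AE x in M. indicator {-\<delta><..<\<delta>} (\<xi> x) = (0::real)"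
    by (subst (asm) integral_nonneg_eq_0_iff_AE) auto
  hence "AE x in M. \<xi> x \<notin> {-\<delta><..<\<delta>}" by (simp add: indicator_eq_0_iff)
  hence "AE x in distr M lborel \<xi>. x \<notin> {-\<delta><..<\<delta>}"
    by (subst AE_distr_iff) auto
  hence "AE x in density lborel (\<lambda>x. ennreal (std_normal_density x)). x \<notin> {-\<delta><..<\<delta>}"
    unfolding distributed_distr_eq_density[OF D] .
  hence "AE x in lborel. x \<notin> {-\<delta><..<\<delta>}"
    by (subst (asm) AE_density) (auto simp: normal_density_pos)
  hence "emeasure lborel {-\<delta><..<\<delta>} = 0"
    by (subst (asm) AE_iff_measurable[of "{-\<delta><..<\<delta>}"]) auto
  thus False using \<delta> by simp
qed

lemma std_normal_exp_square:
  assumes D: "distributed M lborel \<xi> std_normal_density" and s: "2 * s < 1"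
  shows "integrable M (\<lambda>x. exp (s * (\<xi> x)\<^sup>2))"
    "(\<integral>x. exp (s * (\<xi> x)\<^sup>2) \<partial>M) = (1 - 2 * s) powr (-1/2)"
proof -
  \<comment> \<open>Tilting the standard normal density by \<open>exp (s * x\<^sup>2)\<close> gives
    a Gaussian of variance \<open>1 / (1 - 2 * s)\<close>; its missing normalization
    \<open>\<sigma>\<close> is the value of the integral.\<close>
  define \<sigma> where "\<sigma> = 1 / sqrt (1 - 2 * s)"
  have \<sigma>: "\<sigma> > 0" using s by (simp add: \<sigma>_def)
  have \<sigma>2: "\<sigma>\<^sup>2 = 1 / (1 - 2 * s)" using s by (simp add: \<sigma>_def power_divide)
  have eq: "std_normal_density x * exp (s * x\<^sup>2) = \<sigma> * normal_density 0 \<sigma> x" for x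
  proof -
    have "- x\<^sup>2 / 2 + s * x\<^sup>2 = - x\<^sup>2 / (2 * \<sigma>\<^sup>2)"
      using s unfolding \<sigma>2 by (simp add: field_simps)
    hence "exp (- x\<^sup>2 / 2) * exp (s * x\<^sup>2) = exp (- x\<^sup>2 / (2 * \<sigma>\<^sup>2))"
      by (simp flip: exp_add)
    thus ?thesis using \<sigma> by (simp add: normal_density_def real_sqrt_mult field_simps)
  qed
  show "integrable M (\<lambda>x. exp (s * (\<xi> x)\<^sup>2))"
    using distributed_integrable[OF D, of "\<lambda>x. exp (s * x\<^sup>2)"] integrable_normal_density[OF \<sigma>, of 0] eq by simp
  have "(\<integral>x. exp (s * (\<xi> x)\<^sup>2) \<partial>M) = \<sigma>"
    using distributed_integral[OF D, of "\<lambda>x. exp (s * x\<^sup>2)"] integral_normal_density[OF \<sigma>, of 0] eq by simp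
  also have "\<sigma> = (1 - 2 * s) powr (-1/2)"
    using s by (simp add: \<sigma>_def powr_minus_divide powr_half_sqrt)
  finally show "(\<integral>x. exp (s * (\<xi> x)\<^sup>2) \<partial>M) = (1 - 2 * s) powr (-1/2)" .
qed

section \<open>Trace bound and almost everywhere convergence\<close>

text \<open>Testing \<open>X \<ge> 0\<close> against the indicator of \<open>\<bar>e j\<bar> < \<delta>\<close> for all \<open>j < n\<close>: the
  contribution of \<open>j \<ge> n\<close> vanishes by independence, and each \<open>j < n\<close> contributes
  at most \<open>(\<delta>\<^sup>2 - 1) lam j\<close>.\<close>

lemma partial_trace_le_expectation:
  fixes J :: "nat set" and lam :: "nat \<Rightarrow> real"
  assumes indep: "indep_vars (\<lambda>_. borel) e J"
    and std: "\<And>j. j \<in> J \<Longrightarrow> distributed M lborel (e j) std_normal_density"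
    and lam: "\<And>j. j \<in> J \<Longrightarrow> 0 \<le> lam j"
    and X: "integrable M X" "AE x in M. 0 \<le> X x" "(\<lambda>x. X x - (\<integral>x. X x \<partial>M)) \<in> sqint M"
    and lim: "(\<lambda>m. \<integral>x. ((\<Sum>j\<in>{j\<in>J. j < m}. lam j * ((e j x)\<^sup>2 - 1)) - (X x - (\<integral>x. X x \<partial>M)))\<^sup>2 \<partial>M) \<longlonglongrightarrow> 0"
  shows "(\<Sum>j\<in>{j\<in>J. j < n}. lam j) \<le> (\<integral>x. X x \<partial>M)"
proof (rule field_le_mult_one_interval)
  fix z :: real assume z: "0 < z" "z < 1"
  \<comment> \<open>With a factor \<open>z < 1\<close> to spare,
    \<open>\<delta>\<^sup>2 = 1 - z\<close> makes \<open>(e i x)\<^sup>2 - 1\<close> at most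
    \<open>- z\<close> on the event.\<close>
  define \<delta> where "\<delta> = sqrt (1 - z)"
  have \<delta>: "\<delta> > 0" and \<delta>2: "\<delta>\<^sup>2 = 1 - z" using z by (auto simp: \<delta>_def)
  define A where "A = {j\<in>J. j < n}"
  have A: "finite A" "A \<subseteq> J" by (auto simp: A_def)
  define I where "I = (indicator {-\<delta><..<\<delta>} :: real \<Rightarrow> real)"
  have [measurable]: "I \<in> borel_measurable borel" by (simp add: I_def)
  have I01: "0 \<le> I u" "I u \<le> 1" for u by (auto simp: I_def indicator_def)
  define W where "W x = (\<Prod>j\<in>A. I (e j x))" for x
  have em: "e j \<in> borel_measurable M" if "j \<in> J" for j using std_normal_measurable[OF std[OF that]] .
  have [measurable]: "W \<in> borel_measurable M"
    unfolding W_def using em A by (intro borel_measurable_prod measurable_compose[OF _ \<open>I \<in> borel_measurable borel\<close>]) auto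
  have W01: "0 \<le> W x" "W x \<le> 1" for x
    unfolding W_def by (auto intro!: prod_nonneg prod_le_1 I01)
  have Ws: "W \<in> sqint M" unfolding sqint_def
    using W01 by (auto intro!: integrable_const_bound[of _ 1] simp: power_le_one)
  have Ii: "integrable M (\<lambda>x. I (e j x))" if "j \<in> J" for j
    using I01 em[OF that] measurable_compose[OF em[OF that] \<open>I \<in> borel_measurable borel\<close>]
    by (intro integrable_const_bound[of _ 1]) auto
  have iI: "indep_vars (\<lambda>_. borel) (\<lambda>j x. I (e j x)) A"
    by (rule indep_vars_compose2[OF indep_vars_subset[OF indep A(2)]]) simp
  have "(\<integral>x. W x \<partial>M) = (\<Prod>j\<in>A. \<integral>x. I (e j x) \<partial>M)"
    unfolding W_def using A Ii by (intro indep_vars_lebesgue_integral iI) auto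
  also have "\<dots> > 0"
    using A std by (intro prod_pos) (auto simp: I_def subset_iff intro!: std_normal_near_zero \<delta>)
  finally have Wpos: "(\<integral>x. W x \<partial>M) > 0" .
  have sq1: "(\<lambda>x. (e i x)\<^sup>2 - 1) \<in> sqint M" if "i \<in> J" for i
    using std_normal_square(3)[OF std[OF that]] by (intro sqint_diff sqint_const) auto
  have outside: "(\<integral>x. ((e i x)\<^sup>2 - 1) * W x \<partial>M) = 0" if i: "i \<in> J" "i \<notin> A" for i
  proof -
    \<comment> \<open>A single family of functions holds both the centred square at \<open>i\<close>
      and the indicators over \<open>A\<close>, so that independence factorizes the whole product;
      the factor at \<open>i\<close> has mean zero.\<close>
    define F where "F j = (if j = i then (\<lambda>u. u\<^sup>2 - 1) else I)" for j
    have Fm: "F j \<in> borel_measurable borel" for j by (auto simp: F_def)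
    have Fi: "integrable M (\<lambda>x. F j (e j x))" if "j \<in> insert i A" for j
      using that i A Ii sqint_integrable[OF sq1[OF i(1)]] by (auto simp: F_def subset_iff)
    have iF: "indep_vars (\<lambda>_. borel) (\<lambda>j x. F j (e j x)) (insert i A)"
      using i A by (intro indep_vars_compose2[OF indep_vars_subset[OF indep]] Fm) auto
    have "(\<integral>x. ((e i x)\<^sup>2 - 1) * W x \<partial>M) = (\<integral>x. (\<Prod>j\<in>insert i A. F j (e j x)) \<partial>M)"
    proof (intro Bochner_Integration.integral_cong refl)
      fix x
      have "(\<Prod>j\<in>A. F j (e j x)) = W x"
        unfolding W_def using i by (intro prod.cong) (auto simp: F_def)
      thus "((e i x)\<^sup>2 - 1) * W x = (\<Prod>j\<in>insert i A. F j (e j x))"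
        using A i by (simp add: F_def)
    qed
    also have "\<dots> = (\<Prod>j\<in>insert i A. \<integral>x. F j (e j x) \<partial>M)"
      using A Fi by (intro indep_vars_lebesgue_integral iF) auto
    also have "(\<integral>x. F i (e i x) \<partial>M) = 0"
      using std_normal_square(1,2)[OF std[OF i(1)]] by (simp add: F_def prob_space)
    hence "(\<Prod>j\<in>insert i A. \<integral>x. F j (e j x) \<partial>M) = 0" using A by (intro prod_zero) auto
    finally show ?thesis .
  qed
  have inside: "(\<integral>x. ((e i x)\<^sup>2 - 1) * W x \<partial>M) \<le> - z * (\<integral>x. W x \<partial>M)" if i: "i \<in> A" for i
  proof -
    have "((e i x)\<^sup>2 - 1) * W x \<le> - z * W x" for x
    proof (cases "e i x \<in> {-\<delta><..<\<delta>}")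
      case True
      hence "\<bar>e i x\<bar> \<le> \<delta>" by auto
      hence "(e i x)\<^sup>2 \<le> \<delta>\<^sup>2" using \<delta> by (simp add: abs_le_square_iff[symmetric])
      thus ?thesis using W01 by (intro mult_right_mono) (auto simp: \<delta>2)
    next
      case False
      hence "W x = 0" unfolding W_def using A i by (intro prod_zero bexI[of _ i]) (auto simp: I_def)
      thus ?thesis by simp
    qed
    hence "(\<integral>x. ((e i x)\<^sup>2 - 1) * W x \<partial>M) \<le> (\<integral>x. - z * W x \<partial>M)"
      using i A sq1[of i] Ws sqint_integrable[OF Ws] by (intro integral_mono sqint_mult_integrable) (auto intro: sqint_const)
    thus ?thesis by simp
  qed
  define P where "P m x = (\<Sum>j\<in>{j\<in>J. j < m}. lam j * ((e j x)\<^sup>2 - 1))" for m x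
  have Ps: "P m \<in> sqint M" for m unfolding P_def by (intro sqint_sum sqint_scale sq1) auto
  have PW: "(\<integral>x. P m x * W x \<partial>M) \<le> - z * (\<integral>x. W x \<partial>M) * (\<Sum>j\<in>A. lam j)" if m: "m \<ge> n" for m
  proof -
    have sub: "A \<subseteq> {j\<in>J. j < m}" using m by (auto simp: A_def)
    have "(\<integral>x. P m x * W x \<partial>M) = (\<integral>x. (\<Sum>j\<in>{j\<in>J. j < m}. lam j * (((e j x)\<^sup>2 - 1) * W x)) \<partial>M)"
      by (simp add: P_def sum_distrib_right mult.assoc)
    also have "\<dots> = (\<Sum>j\<in>{j\<in>J. j < m}. lam j * (\<integral>x. ((e j x)\<^sup>2 - 1) * W x \<partial>M))"
      using sq1 Ws by (subst Bochner_Integration.integral_sum) (auto intro!: integrable_mult_right sqint_mult_integrable)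
    also have "\<dots> = (\<Sum>j\<in>A. lam j * (\<integral>x. ((e j x)\<^sup>2 - 1) * W x \<partial>M))"
      using sub outside by (intro sum.mono_neutral_right) auto
    also have "\<dots> \<le> (\<Sum>j\<in>A. lam j * (- z * (\<integral>x. W x \<partial>M)))"
      using A lam inside by (intro sum_mono mult_left_mono) auto
    also have "\<dots> = - z * (\<integral>x. W x \<partial>M) * (\<Sum>j\<in>A. lam j)"
      by (simp add: sum_distrib_left mult_ac sum_negf)
    finally show ?thesis .
  qed
  have "(\<lambda>m. \<integral>x. P m x * W x \<partial>M) \<longlonglongrightarrow> (\<integral>x. (X x - (\<integral>x. X x \<partial>M)) * W x \<partial>M)"
    by (rule sqint_tendsto_inner[OF Ps X(3) Ws]) (use lim in \<open>simp add: P_def\<close>)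
  hence "(\<integral>x. (X x - (\<integral>x. X x \<partial>M)) * W x \<partial>M) \<le> - z * (\<integral>x. W x \<partial>M) * (\<Sum>j\<in>A. lam j)"
    using PW by (intro LIMSEQ_le_const2) auto
  moreover have "(\<integral>x. (X x - (\<integral>x. X x \<partial>M)) * W x \<partial>M) = (\<integral>x. X x * W x \<partial>M) - (\<integral>x. X x \<partial>M) * (\<integral>x. W x \<partial>M)"
  proof -
    have "integrable M (\<lambda>x. (X x - (\<integral>x. X x \<partial>M)) * W x + (\<integral>x. X x \<partial>M) * W x)"
      using sqint_mult_integrable[OF X(3) Ws] sqint_integrable[OF Ws] by auto
    hence "integrable M (\<lambda>x. X x * W x)" by (simp add: algebra_simps)
    thus ?thesis using sqint_integrable[OF Ws] by (simp add: left_diff_distrib)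
  qed
  moreover have "0 \<le> (\<integral>x. X x * W x \<partial>M)"
    using X(2) W01 by (intro integral_nonneg_AE) (auto elim!: eventually_mono)
  ultimately have "(z * (\<Sum>j\<in>A. lam j)) * (\<integral>x. W x \<partial>M) \<le> (\<integral>x. X x \<partial>M) * (\<integral>x. W x \<partial>M)"
    by (simp add: algebra_simps)
  thus "z * (\<Sum>j\<in>{j\<in>J. j < n}. lam j) \<le> (\<integral>x. X x \<partial>M)"
    using Wpos unfolding A_def by (simp add: mult_le_cancel_right)
qed

end

text \<open>Since \<open>r n \<ge> n\<close>, the limit along the subsequence bounds the whole
  sequence. This removes the passage to a subsequence that mean convergence imposes on sums of
  nonnegative terms.\<close>

lemma incseq_subseq_tendsto:
  fixes X :: "nat \<Rightarrow> real"
  assumes "incseq X" "strict_mono r" "(\<lambda>n. X (r n)) \<longlonglongrightarrow> L"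
  shows "X \<longlonglongrightarrow> L"
proof -
  have inc: "incseq (\<lambda>n. X (r n))"
    using assms(1,2) by (auto simp: incseq_def strict_mono_less_eq)
  have "X n \<le> L" for n
    using incseqD[OF assms(1) seq_suble[OF assms(2), of n]] incseq_le[OF inc assms(3), of n] by linarith
  then obtain L' where L': "X \<longlonglongrightarrow> L'" using incseq_convergent[OF assms(1)] by metis
  have "(\<lambda>n. X (r n)) \<longlonglongrightarrow> L'" using LIMSEQ_subseq_LIMSEQ[OF L' assms(2)] by (simp add: o_def)
  thus ?thesis using L' assms(3) LIMSEQ_unique by blast
qed

context prob_space
begin

text \<open>The trace bound makes the sums of \<open>lam\<close> converge to some \<open>s\<close>,
  which allows the centring to be undone: the sums of \<open>lam j * (e j)\<^sup>2\<close> tend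
  almost everywhere to \<open>X - m + s\<close>. Being limits of nonnegative sums, these values give
  \<open>X \<ge> m - s\<close>, and \<open>small\<close> then forces \<open>s = m\<close>.\<close>

lemma weighted_squares_tendsto:
  fixes J :: "nat set" and lam :: "nat \<Rightarrow> real"
  assumes indep: "indep_vars (\<lambda>_. borel) e J"
    and std: "\<And>j. j \<in> J \<Longrightarrow> distributed M lborel (e j) std_normal_density"
    and lam: "\<And>j. j \<in> J \<Longrightarrow> 0 \<le> lam j"
    and X: "integrable M X" "AE x in M. 0 \<le> X x" "(\<lambda>x. X x - (\<integral>x. X x \<partial>M)) \<in> sqint M"
    and small: "\<And>\<epsilon>. \<epsilon> > 0 \<Longrightarrow> prob {x \<in> space M. X x < \<epsilon>} > 0"
    and lim: "(\<lambda>m. \<integral>x. ((\<Sum>j\<in>{j\<in>J. j < m}. lam j * ((e j x)\<^sup>2 - 1)) - (X x - (\<integral>x. X x \<partial>M)))\<^sup>2 \<partial>M) \<longlonglongrightarrow> 0"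
  shows "(\<lambda>n. \<Sum>j\<in>{j\<in>J. j < n}. lam j) \<longlonglongrightarrow> (\<integral>x. X x \<partial>M)"
    "AE x in M. (\<lambda>n. \<Sum>j\<in>{j\<in>J. j < n}. lam j * (e j x)\<^sup>2) \<longlonglongrightarrow> X x"
proof -
  define m where "m = (\<integral>x. X x \<partial>M)"
  define T where "T n = (\<Sum>j\<in>{j\<in>J. j < n}. lam j)" for n
  have "incseq T" unfolding T_def incseq_def using lam by (auto intro!: sum_mono2)
  moreover have Tm: "T n \<le> m" for n
    unfolding T_def m_def by (rule partial_trace_le_expectation[OF indep std lam X lim])
  ultimately obtain s where s: "T \<longlonglongrightarrow> s" by (metis incseq_convergent)
  have sm: "s \<le> m" using s Tm by (intro LIMSEQ_le_const2) auto
  define G where "G n x = (\<Sum>j\<in>{j\<in>J. j < n}. lam j * (e j x)\<^sup>2)" for n x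
  have Gs: "G n \<in> sqint M" for n
    unfolding G_def using std_normal_square(3)[OF std] by (intro sqint_sum sqint_scale) auto
  have incG: "incseq (\<lambda>n. G n x)" for x
    unfolding G_def incseq_def using lam by (auto intro!: sum_mono2)
  define d where "d n x = G n x - T n - (X x - m)" for n x
  have d: "d n \<in> sqint M" for n
    unfolding d_def m_def by (rule sqint_diff[OF sqint_diff[OF Gs sqint_const] X(3)])
  have "(\<Sum>j\<in>{j\<in>J. j < n}. lam j * ((e j x)\<^sup>2 - 1)) = G n x - T n" for n x
    unfolding G_def T_def by (simp add: sum_subtractf right_diff_distrib)
  hence d2: "(\<lambda>n. \<integral>x. (d n x)\<^sup>2 \<partial>M) \<longlonglongrightarrow> 0" using lim by (simp add: d_def m_def)
  have "(\<lambda>n. (\<integral>x. \<bar>d n x\<bar> \<partial>M)\<^sup>2) \<longlonglongrightarrow> 0"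
    by (rule tendsto_sandwich[OF _ _ tendsto_const d2]) (use sqint_L1_le[OF d] in auto)
  hence "(\<lambda>n. \<integral>x. norm (d n x) \<partial>M) \<longlonglongrightarrow> 0" by (simp add: power_tendsto_0_iff)
  then obtain r where r: "strict_mono (r :: nat \<Rightarrow> nat)" "AE x in M. (\<lambda>n. d (r n) x) \<longlonglongrightarrow> 0"
    using tendsto_L1_AE_subseq[of M d] sqint_integrable[OF d] by blast
  have conv: "AE x in M. (\<lambda>n. G n x) \<longlonglongrightarrow> X x - m + s"
    using r(2)
  proof eventually_elim
    case (elim x)
    have "(\<lambda>n. d (r n) x + T (r n) + (X x - m)) \<longlonglongrightarrow> 0 + s + (X x - m)"
      using LIMSEQ_subseq_LIMSEQ[OF s r(1)] by (intro tendsto_intros elim) (simp add: o_def)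
    hence "(\<lambda>n. G (r n) x) \<longlonglongrightarrow> X x - m + s" by (simp add: d_def algebra_simps)
    thus ?case by (rule incseq_subseq_tendsto[OF incG r(1)])
  qed
  have ge: "AE x in M. X x \<ge> m - s"
    using conv
  proof eventually_elim
    case (elim x)
    have "G n x \<ge> 0" for n unfolding G_def using lam by (intro sum_nonneg) auto
    hence "X x - m + s \<ge> 0" using elim by (intro LIMSEQ_le_const) auto
    thus ?case by simp
  qed
  have "s = m"
  proof (rule ccontr)
    assume "s \<noteq> m"
    hence "prob {x \<in> space M. X x < m - s} > 0" using sm by (intro small) simp
    moreover have "prob {x \<in> space M. X x < m - s} = 0"
      using ge X(1) by (subst prob_eq_0) (auto elim!: eventually_mono)
    ultimately show False by simp
  qed
  thus "(\<lambda>n. \<Sum>j\<in>{j\<in>J. j < n}. lam j) \<longlonglongrightarrow> (\<integral>x. X x \<partial>M)"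
    "AE x in M. (\<lambda>n. \<Sum>j\<in>{j\<in>J. j < n}. lam j * (e j x)\<^sup>2) \<longlonglongrightarrow> X x"
    using s conv unfolding T_def[abs_def] G_def[abs_def] m_def by auto
qed

end

section \<open>Exponential moments of the limit\<close>

text \<open>Follows from \<open>- ln (1 - x) \<le> x / (1 - x) \<le> x / (1 - q)\<close>. The bound
  sees the factors only through their sum, so it is uniform in the number of factors when the trace
  is finite.\<close>

lemma prod_powr_half_le:
  fixes x :: "'i \<Rightarrow> real"
  assumes "\<And>j. j \<in> A \<Longrightarrow> 0 \<le> x j" "\<And>j. j \<in> A \<Longrightarrow> x j \<le> q" "q < 1"
  shows "(\<Prod>j\<in>A. (1 - x j) powr (-1/2)) \<le> exp ((\<Sum>j\<in>A. x j) / (2 * (1 - q)))"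
proof (cases "finite A")
  case True
  have "(\<Prod>j\<in>A. (1 - x j) powr (-1/2)) \<le> (\<Prod>j\<in>A. exp (x j / (2 * (1 - q))))"
  proof (intro prod_mono conjI)
    fix j assume j: "j \<in> A"
    have x1: "1 - x j > 0" using assms(2)[OF j] assms(3) by simp
    have "- ln (1 - x j) = ln (1 / (1 - x j))" using x1 by (simp add: ln_div)
    also have "\<dots> \<le> 1 / (1 - x j) - 1" using x1 by (intro ln_le_minus_one) simp
    also have "\<dots> = x j / (1 - x j)" using x1 by (simp add: field_simps)
    also have "\<dots> \<le> x j / (1 - q)"
      using assms(1,2)[OF j] assms(3) by (intro divide_left_mono mult_pos_pos) auto
    finally have "- ln (1 - x j) / 2 \<le> x j / (1 - q) / 2" by (rule divide_right_mono) simp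
    also have "\<dots> = x j / (2 * (1 - q))" by simp
    finally have "exp (- ln (1 - x j) / 2) \<le> exp (x j / (2 * (1 - q)))" by (rule exp_mono)
    moreover have "(1 - x j) powr (-1/2) = exp (- ln (1 - x j) / 2)" using x1 by (simp add: powr_def)
    ultimately show "(1 - x j) powr (-1/2) \<le> exp (x j / (2 * (1 - q)))" by (simp only:)
  qed auto
  thus ?thesis using True by (simp add: exp_sum sum_divide_distrib)
qed auto

text \<open>Dominated convergence. For \<open>t \<le> 0\<close> the constant 1 dominates; for
  \<open>t > 0\<close> the limit \<open>exp (t * X x)\<close> itself dominates by monotonicity, and
  its integrability comes from Fatou's lemma and a uniform bound on the finite products.\<close>

lemma (in prob_space) weighted_squares_mgf:
  fixes J :: "nat set" and lam :: "nat \<Rightarrow> real"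
  assumes indep: "indep_vars (\<lambda>_. borel) e J"
    and std: "\<And>j. j \<in> J \<Longrightarrow> distributed M lborel (e j) std_normal_density"
    and lam: "\<And>j. j \<in> J \<Longrightarrow> 0 \<le> lam j"
    and [measurable]: "X \<in> borel_measurable M"
    and trace: "(\<lambda>n. \<Sum>j\<in>{j\<in>J. j < n}. lam j) \<longlonglongrightarrow> s"
    and conv: "AE x in M. (\<lambda>n. \<Sum>j\<in>{j\<in>J. j < n}. lam j * (e j x)\<^sup>2) \<longlonglongrightarrow> X x"
    and t: "\<And>j. j \<in> J \<Longrightarrow> 2 * lam j * t < 1"
  shows "integrable M (\<lambda>x. exp (t * X x))"
    "(\<lambda>n. \<Prod>j\<in>{j\<in>J. j < n}. (1 - 2 * lam j * t) powr (-1/2)) \<longlonglongrightarrow> (\<integral>x. exp (t * X x) \<partial>M)"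
proof -
  define G where "G n x = (\<Sum>j\<in>{j\<in>J. j < n}. lam j * (e j x)\<^sup>2)" for n x
  have em: "e j \<in> borel_measurable M" if "j \<in> J" for j using std_normal_measurable[OF std[OF that]] .
  have [measurable]: "G n \<in> borel_measurable M" for n
    unfolding G_def using em by (intro borel_measurable_sum borel_measurable_times borel_measurable_power) auto
  have incG: "incseq (\<lambda>n. G n x)" for x
    unfolding G_def incseq_def using lam by (auto intro!: sum_mono2)
  have Gpos: "G n x \<ge> 0" for n x unfolding G_def using lam by (intro sum_nonneg) auto
  have conv: "AE x in M. (\<lambda>n. G n x) \<longlonglongrightarrow> X x" using conv by (simp add: G_def)
  have lime: "AE x in M. (\<lambda>n. exp (t * G n x)) \<longlonglongrightarrow> exp (t * X x)"
    using conv by eventually_elim (intro tendsto_intros)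
  have finG: "integrable M (\<lambda>x. exp (t * G n x))"
    "(\<integral>x. exp (t * G n x) \<partial>M) = (\<Prod>j\<in>{j\<in>J. j < n}. (1 - 2 * lam j * t) powr (-1/2))" for n
  proof -
    define A where "A = {j\<in>J. j < n}"
    have A: "finite A" "A \<subseteq> J" by (auto simp: A_def)
    have ind: "indep_vars (\<lambda>_. borel) (\<lambda>j x. exp ((t * lam j) * (e j x)\<^sup>2)) A"
      by (rule indep_vars_compose2[OF indep_vars_subset[OF indep A(2)]]) measurable
    have int: "integrable M (\<lambda>x. exp ((t * lam j) * (e j x)\<^sup>2))"
      "(\<integral>x. exp ((t * lam j) * (e j x)\<^sup>2) \<partial>M) = (1 - 2 * lam j * t) powr (-1/2)" if "j \<in> A" for j
      using std_normal_exp_square[OF std, of j "t * lam j"] t[of j] that A by (auto simp: mult_ac subset_iff)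
    have eq: "exp (t * G n x) = (\<Prod>j\<in>A. exp ((t * lam j) * (e j x)\<^sup>2))" for x
      unfolding G_def A_def[symmetric] using A by (simp add: sum_distrib_left exp_sum mult.assoc)
    show "integrable M (\<lambda>x. exp (t * G n x))"
      unfolding eq using A int by (intro indep_vars_integrable ind) auto
    have "(\<integral>x. exp (t * G n x) \<partial>M) = (\<Prod>j\<in>A. \<integral>x. exp ((t * lam j) * (e j x)\<^sup>2) \<partial>M)"
      unfolding eq using A int by (intro indep_vars_lebesgue_integral ind) auto
    thus "(\<integral>x. exp (t * G n x) \<partial>M) = (\<Prod>j\<in>{j\<in>J. j < n}. (1 - 2 * lam j * t) powr (-1/2))"
      using int by (simp add: A_def)
  qed
  have "integrable M (\<lambda>x. exp (t * X x)) \<and> (\<exists>w. integrable M w \<and> (\<forall>n. AE x in M. norm (exp (t * G n x)) \<le> w x))"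
  proof (cases "t \<le> 0")
    case True
    have "AE x in M. X x \<ge> 0"
      using conv by eventually_elim (use Gpos in \<open>auto intro: LIMSEQ_le_const\<close>)
    hence "AE x in M. norm (exp (t * X x)) \<le> 1"
      by eventually_elim (use True in \<open>auto intro: mult_nonpos_nonneg\<close>)
    hence "integrable M (\<lambda>x. exp (t * X x))" by (intro integrable_const_bound[of _ 1]) auto
    moreover have "norm (exp (t * G n x)) \<le> 1" for n x
      using True Gpos[of n x] by (auto intro: mult_nonpos_nonneg)
    ultimately show ?thesis by (intro conjI exI[of _ "\<lambda>_. 1"]) auto
  next
    case False
    hence t0: "t > 0" by simp
    define f where "f j = (if j \<in> J then lam j else 0)" for j
    have fsum: "(\<Sum>j<n. f j) = (\<Sum>j\<in>{j\<in>J. j < n}. lam j)" for n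
    proof -
      have "(\<Sum>j<n. f j) = (\<Sum>j\<in>{j\<in>J. j < n}. f j)"
        by (intro sum.mono_neutral_right) (auto simp: f_def)
      thus ?thesis by (simp add: f_def)
    qed
    have "f sums s" using trace unfolding sums_def fsum .
    hence "f \<longlonglongrightarrow> 0" by (intro summable_LIMSEQ_zero) (rule sums_summable)
    hence "\<forall>\<^sub>F j in sequentially. f j < 1 / (4 * t)" using t0 by (intro order_tendstoD(2)) auto
    then obtain K where K: "\<And>j. j \<ge> K \<Longrightarrow> f j < 1 / (4 * t)" by (auto simp: eventually_sequentially)
    \<comment> \<open>The hypothesis bounds each \<open>2 * lam j * t\<close> separately, while a
      common bound below 1 is needed. Summability sends \<open>lam j\<close> to 0, so beyond
      \<open>K\<close> the value 1/2 works, and before \<open>K\<close> there are finitely many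
      indices. Inserting 1/2 also keeps the set nonempty.\<close>
    define q where "q = Max (insert (1/2) ((\<lambda>j. 2 * lam j * t) ` {j\<in>J. j < K}))"
    have q1: "q < 1" unfolding q_def using t by (subst Max_less_iff) auto
    have q: "2 * lam j * t \<le> q" if j: "j \<in> J" for j
    proof (cases "j < K")
      case True
      thus ?thesis unfolding q_def using j by (intro Max_ge) auto
    next
      case False
      hence "2 * lam j * t \<le> 1/2" using K[of j] j t0 by (simp add: f_def field_simps)
      also have "\<dots> \<le> q" unfolding q_def by (intro Max_ge) auto
      finally show ?thesis .
    qed
    define C where "C = exp (2 * t * s / (2 * (1 - q)))"
    have bound: "(\<integral>x. exp (t * G n x) \<partial>M) \<le> C" for n
    proof -
      have "(\<integral>x. exp (t * G n x) \<partial>M) \<le> exp ((\<Sum>j\<in>{j\<in>J. j < n}. 2 * lam j * t) / (2 * (1 - q)))"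
        unfolding finG using lam q q1 t0 by (intro prod_powr_half_le) auto
      also have "(\<Sum>j\<in>{j\<in>J. j < n}. 2 * lam j * t) = 2 * t * (\<Sum>j\<in>{j\<in>J. j < n}. lam j)"
        by (simp add: sum_distrib_left mult_ac)
      also have "exp (2 * t * (\<Sum>j\<in>{j\<in>J. j < n}. lam j) / (2 * (1 - q))) \<le> C"
      proof -
        have "incseq (\<lambda>n. \<Sum>j\<in>{j\<in>J. j < n}. lam j)"
          unfolding incseq_def using lam by (auto intro!: sum_mono2)
        hence "(\<Sum>j\<in>{j\<in>J. j < n}. lam j) \<le> s" using trace by (rule incseq_le)
        thus ?thesis unfolding C_def using t0 q1
          by (simp add: divide_right_mono mult_left_mono)
      qed
      finally show ?thesis .
    qed
    have "(\<integral>\<^sup>+x. ennreal (exp (t * X x)) \<partial>M) = (\<integral>\<^sup>+x. liminf (\<lambda>n. ennreal (exp (t * G n x))) \<partial>M)"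
    proof (rule nn_integral_cong_AE)
      show "AE x in M. ennreal (exp (t * X x)) = liminf (\<lambda>n. ennreal (exp (t * G n x)))"
        using lime
      proof eventually_elim
        case (elim x)
        hence "(\<lambda>n. ennreal (exp (t * G n x))) \<longlonglongrightarrow> ennreal (exp (t * X x))" by (intro tendsto_ennrealI)
        thus ?case by (rule lim_imp_Liminf[symmetric, OF trivial_limit_sequentially])
      qed
    qed
    also have "\<dots> \<le> liminf (\<lambda>n. \<integral>\<^sup>+x. ennreal (exp (t * G n x)) \<partial>M)"
      by (rule nn_integral_liminf) measurable
    also have "\<dots> \<le> liminf (\<lambda>n::nat. ennreal C)"
    proof (intro Liminf_mono always_eventually allI)
      fix n
      have "(\<integral>\<^sup>+x. ennreal (exp (t * G n x)) \<partial>M) = ennreal (\<integral>x. exp (t * G n x) \<partial>M)"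
        using finG(1) by (intro nn_integral_eq_integral) auto
      thus "(\<integral>\<^sup>+x. ennreal (exp (t * G n x)) \<partial>M) \<le> ennreal C"
        using bound[of n] by (simp add: ennreal_leI)
    qed
    also have "\<dots> = ennreal C" by (simp add: Liminf_const)
    finally have "(\<integral>\<^sup>+x. ennreal (exp (t * X x)) \<partial>M) < \<infinity>"
      using le_less_trans by fastforce
    hence "integrable M (\<lambda>x. exp (t * X x))" by (intro integrableI_bounded) auto
    moreover have "AE x in M. norm (exp (t * G n x)) \<le> exp (t * X x)" for n
      using conv
    proof eventually_elim
      case (elim x)
      have "G n x \<le> X x" by (rule incseq_le[OF incG elim])
      thus ?case using t0 by simp
    qed
    ultimately show ?thesis by blast
  qed
  then obtain w where int: "integrable M (\<lambda>x. exp (t * X x))" and w: "integrable M w"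
    "\<And>n. AE x in M. norm (exp (t * G n x)) \<le> w x" by blast
  show "integrable M (\<lambda>x. exp (t * X x))" by (rule int)
  have "(\<lambda>n. \<integral>x. exp (t * G n x) \<partial>M) \<longlonglongrightarrow> (\<integral>x. exp (t * X x) \<partial>M)"
    by (rule integral_dominated_convergence[OF _ _ w(1) lime w(2)]) measurable
  thus "(\<lambda>n. \<Prod>j\<in>{j\<in>J. j < n}. (1 - 2 * lam j * t) powr (-1/2)) \<longlonglongrightarrow> (\<integral>x. exp (t * X x) \<partial>M)"
    unfolding finG .
qed

section \<open>Transfer to an arbitrary independent sequence\<close>

text \<open>Independence determines the joint law as the product measure, the same for both
  families. The limit is one measurable function \<open>h\<close> of the coordinates, so its almost
  sure existence and its law pass from \<open>M\<close> to \<open>P\<close>.\<close>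

lemma weighted_squares_distr_eq:
  fixes J :: "nat set" and lam :: "nat \<Rightarrow> real"
  assumes M: "prob_space M" "prob_space.indep_vars M (\<lambda>_. borel) e J"
      "\<And>j. j \<in> J \<Longrightarrow> distributed M lborel (e j) std_normal_density"
    and P: "prob_space P" "prob_space.indep_vars P (\<lambda>_. borel) \<xi> J"
      "\<And>j. j \<in> J \<Longrightarrow> distributed P lborel (\<xi> j) std_normal_density"
    and X [measurable]: "X \<in> borel_measurable M"
    and conv: "AE x in M. (\<lambda>n. \<Sum>j\<in>{j\<in>J. j < n}. lam j * (e j x)\<^sup>2) \<longlonglongrightarrow> X x"
  shows "\<exists>S\<in>borel_measurable P.
    (AE x in P. (\<lambda>n. \<Sum>j\<in>{j\<in>J. j < n}. lam j * (\<xi> j x)\<^sup>2) \<longlonglongrightarrow> S x) \<and> distr P borel S = distr M borel X"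
proof -
  interpret M: prob_space M by fact
  interpret P: prob_space P by fact
  define L where "L = PiM J (\<lambda>_. borel :: real measure)"
  define E where "E x = (\<lambda>j\<in>J. e j x)" for x
  define \<Xi> where "\<Xi> x = (\<lambda>j\<in>J. \<xi> j x)" for x
  have em: "e j \<in> borel_measurable M" if "j \<in> J" for j using M.std_normal_measurable[OF M(3)[OF that]] .
  have \<xi>m: "\<xi> j \<in> borel_measurable P" if "j \<in> J" for j using P.std_normal_measurable[OF P(3)[OF that]] .
  have E [measurable]: "E \<in> measurable M L" unfolding E_def L_def using em by (intro measurable_restrict) auto
  have \<Xi> [measurable]: "\<Xi> \<in> measurable P L" unfolding \<Xi>_def L_def using \<xi>m by (intro measurable_restrict) auto
  have law: "distr M L E = distr P L \<Xi>"
  \<comment> \<open>The description of independence by a product measure is used for nonempty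
    \<open>J\<close>; for empty \<open>J\<close> both maps are the same constant.\<close>
  proof (cases "J = {}")
    case True
    have "E = (\<lambda>_ _. undefined)" "\<Xi> = (\<lambda>_ _. undefined)" "(\<lambda>_. undefined) \<in> space L"
      by (auto simp: E_def \<Xi>_def L_def True space_PiM fun_eq_iff)
    thus ?thesis by (simp add: M.distr_const P.distr_const)
  next
    case False
    have std: "distr N borel f = density lborel (\<lambda>x. ennreal (std_normal_density x))"
      if "distributed N lborel f std_normal_density" for N and f :: "'z \<Rightarrow> real"
      unfolding distributed_distr_eq_density[OF that, symmetric] by (intro distr_cong) auto
    have "distr M L E = PiM J (\<lambda>j. distr M borel (e j))"
      unfolding L_def E_def by (rule M.indep_vars_iff_distr_eq_PiM'[OF False em, THEN iffD1, OF _ M(2)])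
    also have "\<dots> = PiM J (\<lambda>j. distr P borel (\<xi> j))"
      using std[OF M(3)] std[OF P(3)] by (intro PiM_cong refl) simp
    also have "\<dots> = distr P L \<Xi>"
      unfolding L_def \<Xi>_def
      by (rule P.indep_vars_iff_distr_eq_PiM'[OF False \<xi>m, THEN iffD1, OF _ P(2), symmetric])
    finally show ?thesis .
  qed
  define g where "g n y = (\<Sum>j\<in>{j\<in>J. j < n}. lam j * (y j)\<^sup>2)" for n and y :: "nat \<Rightarrow> real"
  have [measurable]: "g n \<in> borel_measurable L" for n
    unfolding g_def L_def by (intro borel_measurable_sum borel_measurable_times borel_measurable_power) auto
  have gE: "g n (E x) = (\<Sum>j\<in>{j\<in>J. j < n}. lam j * (e j x)\<^sup>2)"
    and g\<Xi>: "g n (\<Xi> z) = (\<Sum>j\<in>{j\<in>J. j < n}. lam j * (\<xi> j z)\<^sup>2)" for n x z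
    by (auto simp: g_def E_def \<Xi>_def intro!: sum.cong)
  \<comment> \<open>\<open>lim\<close> is total, hence measurable everywhere; its values at
    divergent points lie in a null set.\<close>
  define h where "h y = lim (\<lambda>n. g n y)" for y
  have [measurable]: "h \<in> borel_measurable L" unfolding h_def by measurable
  have "AE x in M. convergent (\<lambda>n. g n (E x))"
    using conv by eventually_elim (auto simp: gE convergent_def)
  hence "AE y in distr M L E. convergent (\<lambda>n. g n y)"
    \<comment> \<open>Reading convergence as the Cauchy property exhibits the event as
      measurable.\<close>
    by (subst AE_distr_iff) (simp_all add: Cauchy_convergent_iff[symmetric])
  hence "AE z in P. convergent (\<lambda>n. g n (\<Xi> z))"
    unfolding law by (rule AE_distrD[OF \<Xi>])
  hence c: "AE z in P. (\<lambda>n. g n (\<Xi> z)) \<longlonglongrightarrow> h (\<Xi> z)"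
    by eventually_elim (simp add: h_def convergent_LIMSEQ_iff)
  have "AE x in M. h (E x) = X x"
    using conv by eventually_elim (auto simp: h_def gE intro: limI)
  hence "distr M borel X = distr M borel (\<lambda>x. h (E x))"
    by (intro distr_cong_AE) (auto elim!: eventually_mono)
  also have "\<dots> = distr (distr M L E) borel h" by (subst distr_distr) (auto simp: o_def)
  also have "\<dots> = distr P borel (\<lambda>z. h (\<Xi> z))" unfolding law by (subst distr_distr) (auto simp: o_def)
  finally have "distr P borel (\<lambda>z. h (\<Xi> z)) = distr M borel X" by simp
  moreover have "(\<lambda>z. h (\<Xi> z)) \<in> borel_measurable P" by measurable
  ultimately show ?thesis using c unfolding g\<Xi> by (intro bexI[of _ "\<lambda>z. h (\<Xi> z)"]) auto
qed

theorem mainTheorem20: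
  fixes M :: "'a measure" and H :: "('a \<Rightarrow> real) set" and X :: "'a \<Rightarrow> real"
    and N :: enat and lam :: "nat \<Rightarrow> real"
  assumes "prob_space M"
    and "gaussian_hilbert_space M H"
    and "X \<in> borel_measurable M" and "integrable M X"
    and "(\<lambda>\<omega>. X \<omega> - integral\<^sup>L M X) \<in> wick_chaos2 M H"
    and "AE \<omega> in M. X \<omega> \<ge> 0"
    and "\<forall>\<epsilon>>0. measure M {\<omega>\<in>space M. X \<omega> < \<epsilon>} > 0"
    and "\<forall>\<xi>\<in>H. (1/2) * integral\<^sup>L M (\<lambda>\<omega>. (X \<omega> - integral\<^sup>L M X) * \<xi> \<omega> * \<xi> \<omega>) \<ge> 0"
    and "nonzero_eigenvalues_mult M H
           (\<lambda>\<xi> \<eta>. (1/2) * integral\<^sup>L M (\<lambda>\<omega>. (X \<omega> - integral\<^sup>L M X) * \<xi> \<omega> * \<eta> \<omega>))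
           {j. enat j < N} lam"
  shows "(\<forall>j\<in>{j. enat j < N}. lam j > 0)
    \<and> (\<forall>(P :: 'b measure) (\<xi> :: nat \<Rightarrow> 'b \<Rightarrow> real).
          prob_space P \<and> prob_space.indep_vars P (\<lambda>_. borel) \<xi> {j. enat j < N}
          \<and> (\<forall>j\<in>{j. enat j < N}. distributed P lborel (\<xi> j) (normal_density 0 1))
        \<longrightarrow> (\<exists>S \<in> borel_measurable P.
              (AE \<omega> in P. (\<lambda>n. \<Sum>j\<in>{j. enat j < N \<and> j < n}. lam j * (\<xi> j \<omega>)\<^sup>2)
                               \<longlonglongrightarrow> S \<omega>)
              \<and> distr P borel S = distr M borel X))
    \<and> (lam has_sum integral\<^sup>L M X) {j. enat j < N}
    \<and> (\<forall>t::real. (\<forall>j\<in>{j. enat j < N}. 2 * lam j * t < 1) \<longrightarrow>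
          integrable M (\<lambda>\<omega>. exp (t * X \<omega>)) \<and>
          (\<lambda>j. if enat j < N then (1 - 2 * lam j * t) powr (-1/2) else 1)
            has_prod integral\<^sup>L M (\<lambda>\<omega>. exp (t * X \<omega>)))"
proof -
  interpret gaussian_space M H
    using assms(1,2) by (auto simp: gaussian_space_def gaussian_space_axioms_def)
  define J where "J = {j. enat j < N}"
  define m where "m = integral\<^sup>L M X"
  define Y where "Y \<omega> = X \<omega> - m" for \<omega>
  have YC: "Y \<in> wick_chaos2 M H" using assms(5) by (simp add: Y_def[abs_def] m_def)
  have pos: "0 \<le> wform M Y \<xi> \<xi>" if "\<xi> \<in> H" for \<xi>
    using assms(8) that by (simp add: wform_def Y_def m_def)
  have "nonzero_eigenvalues_mult M H (wform M Y) J lam"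
    using assms(9) by (simp add: wform_def[abs_def] Y_def m_def J_def)
  then obtain e where e: "\<And>j. j \<in> J \<Longrightarrow> e j \<in> H" and nz: "\<And>j. j \<in> J \<Longrightarrow> lam j \<noteq> 0"
    and eig: "\<And>j \<eta>. j \<in> J \<Longrightarrow> \<eta> \<in> H \<Longrightarrow> wform M Y (e j) \<eta> = lam j * (\<integral>x. e j x * \<eta> x \<partial>M)"
    and orth: "\<And>i j. i \<in> J \<Longrightarrow> j \<in> J \<Longrightarrow> (\<integral>x. e i x * e j x \<partial>M) = (if i = j then 1 else 0)"
    and span: "\<And>c \<xi>. c \<noteq> 0 \<Longrightarrow> \<xi> \<in> H \<Longrightarrow> (\<And>\<eta>. \<eta> \<in> H \<Longrightarrow> wform M Y \<xi> \<eta> = c * (\<integral>x. \<xi> x * \<eta> x \<partial>M)) \<Longrightarrow>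
      AE \<omega> in M. \<xi> \<omega> = (\<Sum>j\<in>{j\<in>J. lam j = c}. (\<integral>x. \<xi> x * e j x \<partial>M) * e j \<omega>)"
    unfolding nonzero_eigenvalues_mult_def form_eigvec_def by (elim exE conjE) blast
  have lam_pos: "lam j > 0" if j: "j \<in> J" for j
    using pos[OF e[OF j]] eig[OF j e[OF j]] orth[OF j j] nz[OF j] by simp
  hence lam: "0 \<le> lam j" if "j \<in> J" for j using that less_imp_le by blast
  have std: "distributed M lborel (e j) std_normal_density" if j: "j \<in> J" for j
    using orth[OF j j] by (intro orthonormal_std_normal e j) (simp add: power2_eq_square)
  have indep: "indep_vars (\<lambda>_. borel) e J" by (rule orthonormal_indep[OF e orth])
  have lim: "(\<lambda>n. \<integral>x. ((\<Sum>j\<in>{j\<in>J. j < n}. lam j * ((e j x)\<^sup>2 - 1)) - Y x)\<^sup>2 \<partial>M) \<longlonglongrightarrow> 0"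
    by (rule wick_chaos2_expansion[OF YC pos e eig orth span])
  have Ys: "(\<lambda>x. X x - integral\<^sup>L M X) \<in> sqint M"
    using wick_chaos2_sqint[OF assms(5)] .
  have small: "prob {x \<in> space M. X x < \<epsilon>} > 0" if "\<epsilon> > 0" for \<epsilon> using assms(7) that by blast
  have trace: "(\<lambda>n. \<Sum>j\<in>{j\<in>J. j < n}. lam j) \<longlonglongrightarrow> integral\<^sup>L M X"
    and conv: "AE x in M. (\<lambda>n. \<Sum>j\<in>{j\<in>J. j < n}. lam j * (e j x)\<^sup>2) \<longlonglongrightarrow> X x"
    using weighted_squares_tendsto[OF indep std lam assms(4,6) Ys small lim[unfolded Y_def m_def]] by simp_all
  have part1: "\<forall>j\<in>J. lam j > 0" using lam_pos by blast
  have part2: "\<forall>(P :: 'b measure) (\<xi> :: nat \<Rightarrow> 'b \<Rightarrow> real).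
          prob_space P \<and> prob_space.indep_vars P (\<lambda>_. borel) \<xi> J
          \<and> (\<forall>j\<in>J. distributed P lborel (\<xi> j) (normal_density 0 1))
        \<longrightarrow> (\<exists>S \<in> borel_measurable P.
              (AE \<omega> in P. (\<lambda>n. \<Sum>j\<in>{j\<in>J. j < n}. lam j * (\<xi> j \<omega>)\<^sup>2) \<longlonglongrightarrow> S \<omega>)
              \<and> distr P borel S = distr M borel X)"
    using weighted_squares_distr_eq[OF assms(1) indep std _ _ _ assms(3) conv] by blast
  have part3: "(lam has_sum integral\<^sup>L M X) J"
  proof -
    \<comment> \<open>Extension by zero turns the sum over \<open>J\<close> into a series over the
      naturals; nonnegativity of the terms upgrades ordered to unconditional summation.\<close>
    define f where "f j = (if j \<in> J then lam j else 0)" for j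
    have "(\<Sum>j<n. f j) = (\<Sum>j\<in>{j\<in>J. j < n}. lam j)" for n
    proof -
      have "(\<Sum>j<n. f j) = (\<Sum>j\<in>{j\<in>J. j < n}. f j)"
        by (intro sum.mono_neutral_right) (auto simp: f_def)
      thus ?thesis by (simp add: f_def)
    qed
    hence "f sums integral\<^sup>L M X" using trace by (simp add: sums_def)
    hence "(f has_sum integral\<^sup>L M X) UNIV"
      using lam by (intro sums_nonneg_imp_has_sum) (auto simp: f_def)
    thus ?thesis by (subst has_sum_cong_neutral[of UNIV J f]) (auto simp: f_def)
  qed
  have part4: "integrable M (\<lambda>\<omega>. exp (t * X \<omega>)) \<and>
      (\<lambda>j. if j \<in> J then (1 - 2 * lam j * t) powr (-1/2) else 1) has_prod integral\<^sup>L M (\<lambda>\<omega>. exp (t * X \<omega>))"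
    if t: "\<And>j. j \<in> J \<Longrightarrow> 2 * lam j * t < 1" for t :: real
  proof -
    have int: "integrable M (\<lambda>x. exp (t * X x))"
      and mgf: "(\<lambda>n. \<Prod>j\<in>{j\<in>J. j < n}. (1 - 2 * lam j * t) powr (-1/2)) \<longlonglongrightarrow> (\<integral>x. exp (t * X x) \<partial>M)"
      using weighted_squares_mgf[OF indep std lam assms(3) trace conv t] by simp_all
    define f where "f j = (if j \<in> J then (1 - 2 * lam j * t) powr (-1/2) else 1)" for j
    \<comment> \<open>\<open>has_prod\<close> uses products up to and including \<open>n\<close>,
      hence the shift to \<open>Suc n\<close>.\<close>
    have "(\<Prod>j\<le>n. f j) = (\<Prod>j\<in>{j\<in>J. j < Suc n}. (1 - 2 * lam j * t) powr (-1/2))" for n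
    proof -
      have "(\<Prod>j\<le>n. f j) = (\<Prod>j\<in>{j\<in>J. j < Suc n}. f j)"
        by (intro prod.mono_neutral_right) (auto simp: f_def)
      thus ?thesis by (simp add: f_def)
    qed
    hence "(\<lambda>n. \<Prod>j\<le>n. f j) \<longlonglongrightarrow> integral\<^sup>L M (\<lambda>\<omega>. exp (t * X \<omega>))"
      using LIMSEQ_Suc[OF mgf] by simp
    \<comment> \<open>Convergence of an infinite product requires a nonzero limit here, and the
      integral of an exponential is strictly positive.\<close>
    moreover have "(\<integral>\<omega>. 0 \<partial>M) < integral\<^sup>L M (\<lambda>\<omega>. exp (t * X \<omega>))"
      using int by (intro integral_less_AE_space) (auto simp: emeasure_space_1)
    ultimately have "f has_prod integral\<^sup>L M (\<lambda>\<omega>. exp (t * X \<omega>))"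
      unfolding has_prod_def raw_has_prod_def by auto
    thus ?thesis using int by (simp add: f_def[abs_def])
  qed
  show ?thesis
    using part1 part2 part3 part4 unfolding J_def by auto
qed

end
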